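(* Let $J\subseteq G\langle X\rangle^{(2)}$ and $J^-\subseteq F\langle X^-\rangle^{(2)}$ be constitution homogeneous Hopf ideals of $G\langle X\rangle$ and $F\langle X^-\rangle$, respectively. Denote by $\mathfrak A$ the algebra generated over $H$ by $X\cup X^-$ (that is, the quotient of $H\langle X\cup X^-\rangle$) and defined by the relations $[x_i,x_j^-]=\delta_i^j(1-g_if_i)$, $1\le i,j\le n$, and $u_s=0$, $s\in S$, $u_t^-=0$, $t\in T$, where $\{u_s, s\in S\}$ (respectively $\{u_t^-,t\in T\}$) is a set of homogeneous generators of the ideal $J$ (respectively $J^-$). Then $$\mathfrak A=(F\langle X^-\rangle/J^-)\otimes_{\mathbf k[F]}\mathbf k[H]\otimes_{\mathbf k[G]}(G\langle X\rangle/J),$$ i.e. the natural map from the right-hand side to $\mathfrak A$ induced by multiplication is a linear isomorphism.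
   Context: Let $\mathbf k$ be a field, $G$ a commutative group, $g_1,\dots,g_n\in G$, $\chi^1,\dots,\chi^n:G\to\mathbf k^*$ characters, and $p_{ij}=\chi^i(g_j)$. Let $F$ be an abelian group generated by elements $f_1,\dots,f_n$ that has characters $\chi_-^i$ with $\chi^i_-(f_j)=p_{ji}^{-1}$. Extend the characters $\chi^i$ to $G\times F$ by $\chi^i(f_j)=p_{ji}$ and put $\chi^i_-=(\chi^i)^{-1}$ as characters of $G\times F$. Let $H=(G\times F)/N$, where $N$ is a subgroup with $\chi^i(N)=1$ for $1\le i\le n$, such that $G$ and $F$ embed in $H$ (so $G,F\subseteq H$). Let $X=\{x_1,\dots,x_n\}$, $X^-=\{x_1^-,\dots,x_n^-\}$. $H\langle X\cup X^-\rangle$ is the skew group algebra generated by $\mathbf k[H]$ and the free algebra $\mathbf k\langle X\cup X^-\rangle$ with $g^{-1}x_ig=\chi^i(g)x_i$, $g^{-1}x_i^-g=\chi^i(g)^{-1}x_i^-$, $g\in H$. It is a Hopf algebra with group-like elements $g\in H$ and $\Delta(x_i)=x_i\otimes1+g_i\otimes x_i$, $\Delta(x_i^-)=x_i^-\otimes1+f_i\otimes x_i^-$. $G\langle X\rangle$ and $F\langle X^-\rangle$ are its Hopf subalgebras generated by $G\cup X$ and $F\cup X^-$. $G\langle X\rangle^{(2)}$ is the ideal generated by all $x_ix_j$ (elements without free and linear terms in $X$); $F\langle X^-\rangle^{(2)}$ is the ideal generated by all $x_i^-x_j^-$. The bracket is $[x_i,x_j^-]=x_ix_j^--\chi^i(f_j)\,x_j^-x_i$.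 "Constitution homogeneous" means homogeneous in each variable $x_i$ (respectively $x_i^-$), group elements having degree zero; homogeneous generators are taken in $\mathbf k\langle X\rangle$, resp. $\mathbf k\langle X^-\rangle$. *)

theory Defs
  imports "HOL-Algebra.QuotRing" "HOL-Algebra.Module" "HOL-Algebra.Generated_Rings" "HOL-Library.Poly_Mapping"
begin

section \<open>Vector spaces of finitely supported functions\<close>

text \<open>A vector space with basis \<open>'b\<close> over the field \<open>'k\<close> is modelled by \<open>'b \<Rightarrow>\<^sub>0 'k\<close>.\<close>

definition pm_scale :: "'k \<Rightarrow> ('b \<Rightarrow>\<^sub>0 'k::field) \<Rightarrow> ('b \<Rightarrow>\<^sub>0 'k)" where
  "pm_scale c p = Poly_Mapping.map ((*) c) p"

lemma lookup_pm_scale [simp]: "Poly_Mapping.lookup (pm_scale c p) b = c * Poly_Mapping.lookup p b"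
  by (simp add: pm_scale_def Poly_Mapping.map.rep_eq when_def)

lemma vector_space_pm_scale: "vector_space (pm_scale :: 'k::field \<Rightarrow> ('b \<Rightarrow>\<^sub>0 'k) \<Rightarrow> _)"
  by unfold_locales (auto intro!: poly_mapping_eqI simp: lookup_add algebra_simps)

abbreviation pm_span :: "('b \<Rightarrow>\<^sub>0 'k::field) set \<Rightarrow> ('b \<Rightarrow>\<^sub>0 'k) set" where
  "pm_span \<equiv> Modules.module.span pm_scale"

definition lin_ext :: "('b \<Rightarrow> ('c \<Rightarrow>\<^sub>0 'k)) \<Rightarrow> ('b \<Rightarrow>\<^sub>0 'k::field) \<Rightarrow> ('c \<Rightarrow>\<^sub>0 'k)" where
  "lin_ext \<phi> p = (\<Sum>b\<in>Poly_Mapping.keys p. pm_scale (Poly_Mapping.lookup p b) (\<phi> b))"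

text \<open>The tensor square of the space with basis \<open>'b\<close> is the space with basis \<open>'b \<times> 'b\<close>.\<close>

definition pm_tensor :: "('b \<Rightarrow>\<^sub>0 'k::field) \<Rightarrow> ('b \<Rightarrow>\<^sub>0 'k) \<Rightarrow> ('b \<times> 'b \<Rightarrow>\<^sub>0 'k)" where
  "pm_tensor p q =
     (\<Sum>a\<in>Poly_Mapping.keys p. \<Sum>b\<in>Poly_Mapping.keys q.
        Poly_Mapping.single (a, b) (Poly_Mapping.lookup p a * Poly_Mapping.lookup q b))"

text \<open>The bilinear product with \<open>a \<cdot> b = \<sigma> a b (m a b)\<close> on basis elements.\<close>

definition twisted_mult ::
    "('b \<Rightarrow> 'b \<Rightarrow> 'b) \<Rightarrow> ('b \<Rightarrow> 'b \<Rightarrow> 'k) \<Rightarrow> ('b \<Rightarrow>\<^sub>0 'k::field) \<Rightarrow> ('b \<Rightarrow>\<^sub>0 'k) \<Rightarrow> ('b \<Rightarrow>\<^sub>0 'k)" where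
  "twisted_mult m \<sigma> p q =
     (\<Sum>a\<in>Poly_Mapping.keys p. \<Sum>b\<in>Poly_Mapping.keys q.
        Poly_Mapping.single (m a b) (\<sigma> a b * Poly_Mapping.lookup p a * Poly_Mapping.lookup q b))"


section \<open>Algebras, quotients and tensor products\<close>

text \<open>
  A \<open>\<^bold>k\<close>-algebra, or just a \<open>\<^bold>k\<close>-vector space, is a record of type \<open>('k, 'a) module\<close>, the scalars
  being all of the field type \<open>'k\<close>.
\<close>

definition kstar :: "'k::field monoid" where
  "kstar = \<lparr>carrier = UNIV - {0}, monoid.mult = (*), one = 1\<rparr>"

definition subalg :: "('k, 'a) module \<Rightarrow> 'a set \<Rightarrow> ('k, 'a) module" where
  "subalg A S = A\<lparr>carrier := generate_ring A (range (\<lambda>c. c \<odot>\<^bsub>A\<^esub> \<one>\<^bsub>A\<^esub>) \<union> S)\<rparr>"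

text \<open>The quotient \<open>A Quot I\<close> of HOL-Algebra, with the induced scalar multiplication.\<close>

definition quot_alg :: "('k, 'a) module \<Rightarrow> 'a set \<Rightarrow> ('k, 'a set) module" where
  "quot_alg A I = ring.extend (A Quot I) (module.fields (\<lambda>c Q. \<Union>x\<in>Q. I +>\<^bsub>A\<^esub> (c \<odot>\<^bsub>A\<^esub> x)))"

definition linear_iso :: "('k, 'a) module \<Rightarrow> ('k, 'b) module \<Rightarrow> ('a \<Rightarrow> 'b) \<Rightarrow> bool" where
  "linear_iso V W \<phi> \<longleftrightarrow>
     bij_betw \<phi> (carrier V) (carrier W) \<and>
     (\<forall>x\<in>carrier V. \<forall>y\<in>carrier V. \<phi> (x \<oplus>\<^bsub>V\<^esub> y) = \<phi> x \<oplus>\<^bsub>W\<^esub> \<phi> y) \<and>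
     (\<forall>c. \<forall>x\<in>carrier V. \<phi> (c \<odot>\<^bsub>V\<^esub> x) = c \<odot>\<^bsub>W\<^esub> \<phi> x)"

text \<open>The fields \<open>mult\<close> and \<open>one\<close> are irrelevant here and in \<open>tensor3\<close>: these are vector spaces only.\<close>

definition free_space :: "'b set \<Rightarrow> ('k::field, 'b \<Rightarrow>\<^sub>0 'k) module" where
  "free_space B = \<lparr>carrier = {p. Poly_Mapping.keys p \<subseteq> B}, monoid.mult = undefined, one = undefined,
     zero = 0, add = (+), smult = pm_scale\<rparr>"

text \<open>
  The tensor product \<open>A \<otimes>\<^sub>R B \<otimes>\<^sub>S C\<close>, where \<open>A\<close> is a right \<open>R\<close>-module through \<open>\<alpha> : R \<rightarrow> A\<close>,
  \<open>B\<close> is an \<open>(R, S)\<close>-bimodule through \<open>\<beta> : R \<rightarrow> B\<close> and \<open>\<beta>' : S \<rightarrow> B\<close>, and \<open>C\<close> is a left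
  \<open>S\<close>-module through \<open>\<gamma> : S \<rightarrow> C\<close>: the vector space freely spanned by \<open>A \<times> B \<times> C\<close>, modulo
  \<open>\<^bold>k\<close>-multilinearity and \<open>R\<close>- and \<open>S\<close>-balancedness.
\<close>

definition tensor3_rels ::
    "('k::field, 'a) module \<Rightarrow> ('k, 'b) module \<Rightarrow> ('k, 'c) module \<Rightarrow>
     'r set \<Rightarrow> ('r \<Rightarrow> 'a) \<Rightarrow> ('r \<Rightarrow> 'b) \<Rightarrow> 's set \<Rightarrow> ('s \<Rightarrow> 'b) \<Rightarrow> ('s \<Rightarrow> 'c) \<Rightarrow>
     ('a \<times> 'b \<times> 'c \<Rightarrow>\<^sub>0 'k) set" where
  "tensor3_rels A B C R \<alpha> \<beta> S \<beta>' \<gamma> = (let e = (\<lambda>a b c. Poly_Mapping.single (a, b, c) 1) in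
     {e (a \<oplus>\<^bsub>A\<^esub> a') b c - e a b c - e a' b c |a a' b c.
        a \<in> carrier A \<and> a' \<in> carrier A \<and> b \<in> carrier B \<and> c \<in> carrier C} \<union>
     {e a (b \<oplus>\<^bsub>B\<^esub> b') c - e a b c - e a b' c |a b b' c.
        a \<in> carrier A \<and> b \<in> carrier B \<and> b' \<in> carrier B \<and> c \<in> carrier C} \<union>
     {e a b (c \<oplus>\<^bsub>C\<^esub> c') - e a b c - e a b c' |a b c c'.
        a \<in> carrier A \<and> b \<in> carrier B \<and> c \<in> carrier C \<and> c' \<in> carrier C} \<union>
     {e (t \<odot>\<^bsub>A\<^esub> a) b c - pm_scale t (e a b c) |t a b c.
        a \<in> carrier A \<and> b \<in> carrier B \<and> c \<in> carrier C} \<union>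
     {e a (t \<odot>\<^bsub>B\<^esub> b) c - pm_scale t (e a b c) |t a b c.
        a \<in> carrier A \<and> b \<in> carrier B \<and> c \<in> carrier C} \<union>
     {e a b (t \<odot>\<^bsub>C\<^esub> c) - pm_scale t (e a b c) |t a b c.
        a \<in> carrier A \<and> b \<in> carrier B \<and> c \<in> carrier C} \<union>
     {e (a \<otimes>\<^bsub>A\<^esub> \<alpha> r) b c - e a (\<beta> r \<otimes>\<^bsub>B\<^esub> b) c |a r b c.
        a \<in> carrier A \<and> r \<in> R \<and> b \<in> carrier B \<and> c \<in> carrier C} \<union>
     {e a (b \<otimes>\<^bsub>B\<^esub> \<beta>' s) c - e a b (\<gamma> s \<otimes>\<^bsub>C\<^esub> c) |a b s c.
        a \<in> carrier A \<and> b \<in> carrier B \<and> s \<in> S \<and> c \<in> carrier C})"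

definition tensor3 ::
    "('k::field, 'a) module \<Rightarrow> ('k, 'b) module \<Rightarrow> ('k, 'c) module \<Rightarrow>
     'r set \<Rightarrow> ('r \<Rightarrow> 'a) \<Rightarrow> ('r \<Rightarrow> 'b) \<Rightarrow> 's set \<Rightarrow> ('s \<Rightarrow> 'b) \<Rightarrow> ('s \<Rightarrow> 'c) \<Rightarrow>
     ('k, ('a \<times> 'b \<times> 'c \<Rightarrow>\<^sub>0 'k) set) module" where
  "tensor3 A B C R \<alpha> \<beta> S \<beta>' \<gamma> =
     quot_alg (free_space (carrier A \<times> carrier B \<times> carrier C))
       (pm_span (tensor3_rels A B C R \<alpha> \<beta> S \<beta>' \<gamma>))"

definition pure3 ::
    "('k::field, 'a) module \<Rightarrow> ('k, 'b) module \<Rightarrow> ('k, 'c) module \<Rightarrow>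
     'r set \<Rightarrow> ('r \<Rightarrow> 'a) \<Rightarrow> ('r \<Rightarrow> 'b) \<Rightarrow> 's set \<Rightarrow> ('s \<Rightarrow> 'b) \<Rightarrow> ('s \<Rightarrow> 'c) \<Rightarrow>
     'a \<Rightarrow> 'b \<Rightarrow> 'c \<Rightarrow> ('a \<times> 'b \<times> 'c \<Rightarrow>\<^sub>0 'k) set" where
  "pure3 A B C R \<alpha> \<beta> S \<beta>' \<gamma> a b c =
     pm_span (tensor3_rels A B C R \<alpha> \<beta> S \<beta>' \<gamma>)
       +>\<^bsub>free_space (carrier A \<times> carrier B \<times> carrier C)\<^esub> Poly_Mapping.single (a, b, c) 1"


section \<open>The skew group algebra of a free algebra and its Hopf structure\<close>

text \<open>
  Throughout, \<open>H\<close> is an abelian group, and each letter \<open>x\<close> carries a character \<open>\<psi> x\<close> of \<open>H\<close> and a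
  group element \<open>d x\<close>.  The basis element \<open>(h, w)\<close> stands for the product \<open>h w\<close> of a group element
  and a word, so \<open>h\<^sup>-\<^sup>1 x h = \<psi> x h x\<close> gives \<open>(g, v) (h, w) = (\<Prod>x\<leftarrow>v. \<psi> x h) (g h, v w)\<close>.
\<close>

type_synonym ('h, 'x, 'k) skew = "'h \<times> 'x list \<Rightarrow>\<^sub>0 'k"
type_synonym ('h, 'x, 'k) skew2 = "('h \<times> 'x list) \<times> ('h \<times> 'x list) \<Rightarrow>\<^sub>0 'k"

definition basis_mult :: "('h, 'm) monoid_scheme \<Rightarrow> 'h \<times> 'x list \<Rightarrow> 'h \<times> 'x list \<Rightarrow> 'h \<times> 'x list" where
  "basis_mult H = (\<lambda>(g, v) (h, w). (g \<otimes>\<^bsub>H\<^esub> h, v @ w))"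

definition basis_twist :: "('x \<Rightarrow> 'h \<Rightarrow> 'k::field) \<Rightarrow> 'h \<times> 'x list \<Rightarrow> 'h \<times> 'x list \<Rightarrow> 'k" where
  "basis_twist \<psi> = (\<lambda>(g, v) (h, w). \<Prod>x\<leftarrow>v. \<psi> x h)"

definition skew_alg ::
    "('h, 'm) monoid_scheme \<Rightarrow> ('x \<Rightarrow> 'h \<Rightarrow> 'k::field) \<Rightarrow> ('k, ('h, 'x, 'k) skew) module" where
  "skew_alg H \<psi> = \<lparr>carrier = {p. Poly_Mapping.keys p \<subseteq> carrier H \<times> UNIV},
     monoid.mult = twisted_mult (basis_mult H) (basis_twist \<psi>),
     one = Poly_Mapping.single (\<one>\<^bsub>H\<^esub>, []) 1, zero = 0, add = (+), smult = pm_scale\<rparr>"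

definition gr :: "'h \<Rightarrow> ('h, 'x, 'k::field) skew" where
  "gr h = Poly_Mapping.single (h, []) 1"

definition letter :: "('h, 'm) monoid_scheme \<Rightarrow> 'x \<Rightarrow> ('h, 'x, 'k::field) skew" where
  "letter H x = Poly_Mapping.single (\<one>\<^bsub>H\<^esub>, [x]) 1"

text \<open>Multiplication in the tensor square, \<open>(a \<otimes> b) (a' \<otimes> b') = a a' \<otimes> b b'\<close>.\<close>

definition mult2 :: "('h, 'm) monoid_scheme \<Rightarrow> ('x \<Rightarrow> 'h \<Rightarrow> 'k::field) \<Rightarrow>
    ('h, 'x, 'k) skew2 \<Rightarrow> ('h, 'x, 'k) skew2 \<Rightarrow> ('h, 'x, 'k) skew2" where
  "mult2 H \<psi> = twisted_mult
     (\<lambda>(a, b) (a', b'). (basis_mult H a a', basis_mult H b b'))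
     (\<lambda>(a, b) (a', b'). basis_twist \<psi> a a' * basis_twist \<psi> b b')"

text \<open>
  The coproduct is the algebra map with \<open>h \<mapsto> h \<otimes> h\<close> and \<open>x \<mapsto> x \<otimes> 1 + d x \<otimes> x\<close>.  The antipode is
  the algebra antihomomorphism with \<open>h \<mapsto> h\<^sup>-\<^sup>1\<close> and \<open>x \<mapsto> - (d x)\<^sup>-\<^sup>1 x\<close>.
\<close>

definition coprod_letter ::
    "('h, 'm) monoid_scheme \<Rightarrow> ('x \<Rightarrow> 'h) \<Rightarrow> 'x \<Rightarrow> ('h, 'x, 'k::field) skew2" where
  "coprod_letter H d x = pm_tensor (letter H x) (gr \<one>\<^bsub>H\<^esub>) + pm_tensor (gr (d x)) (letter H x)"

definition coprod :: "('h, 'm) monoid_scheme \<Rightarrow> ('x \<Rightarrow> 'h \<Rightarrow> 'k::field) \<Rightarrow> ('x \<Rightarrow> 'h) \<Rightarrow>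
    ('h, 'x, 'k) skew \<Rightarrow> ('h, 'x, 'k) skew2" where
  "coprod H \<psi> d = lin_ext (\<lambda>(h, w).
     mult2 H \<psi> (pm_tensor (gr h) (gr h))
       (foldr (\<lambda>x. mult2 H \<psi> (coprod_letter H d x)) w (pm_tensor (gr \<one>\<^bsub>H\<^esub>) (gr \<one>\<^bsub>H\<^esub>))))"

definition counit :: "('h, 'x, 'k::field) skew \<Rightarrow> 'k" where
  "counit p = (\<Sum>(h, w)\<in>Poly_Mapping.keys p. if w = [] then Poly_Mapping.lookup p (h, w) else 0)"

definition antipode_letter ::
    "('h, 'm) monoid_scheme \<Rightarrow> ('x \<Rightarrow> 'h) \<Rightarrow> 'x \<Rightarrow> ('h, 'x, 'k::field) skew" where
  "antipode_letter H d x = Poly_Mapping.single (inv\<^bsub>H\<^esub> (d x), [x]) (- 1)"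

definition antipode :: "('h, 'm) monoid_scheme \<Rightarrow> ('x \<Rightarrow> 'h \<Rightarrow> 'k::field) \<Rightarrow> ('x \<Rightarrow> 'h) \<Rightarrow>
    ('h, 'x, 'k) skew \<Rightarrow> ('h, 'x, 'k) skew" where
  "antipode H \<psi> d = lin_ext (\<lambda>(h, w).
     foldr (\<lambda>x p. antipode_letter H d x \<otimes>\<^bsub>skew_alg H \<psi>\<^esub> p) (rev w) (gr (inv\<^bsub>H\<^esub> h)))"

text \<open>
  Hopf ideals of a Hopf subalgebra \<open>A\<close> of \<open>skew_alg H \<psi>\<close>: the structure maps of \<open>A\<close> are the
  restrictions of those above, and \<open>A \<otimes> A\<close> is a subspace of the tensor square.
\<close>

definition hopf_ideal :: "('h, 'm) monoid_scheme \<Rightarrow> ('x \<Rightarrow> 'h \<Rightarrow> 'k::field) \<Rightarrow> ('x \<Rightarrow> 'h) \<Rightarrow>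
    ('k, ('h, 'x, 'k) skew) module \<Rightarrow> ('h, 'x, 'k) skew set \<Rightarrow> bool" where
  "hopf_ideal H \<psi> d A J \<longleftrightarrow> ideal J A \<and>
     (\<forall>u\<in>J. coprod H \<psi> d u \<in> pm_span ({pm_tensor a b |a b. a \<in> J \<and> b \<in> carrier A} \<union>
                                        {pm_tensor a b |a b. a \<in> carrier A \<and> b \<in> J})) \<and>
     (\<forall>u\<in>J. counit u = 0) \<and>
     (\<forall>u\<in>J. antipode H \<psi> d u \<in> J)"

text \<open>The constitution of a word \<open>w\<close> is the function \<open>count_list w\<close>.\<close>

definition const_homogeneous :: "('h, 'x, 'k::field) skew \<Rightarrow> bool" where
  "const_homogeneous p \<longleftrightarrow> (\<exists>m. \<forall>(h, w)\<in>Poly_Mapping.keys p. count_list w = m)"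

definition const_component :: "('x \<Rightarrow> nat) \<Rightarrow> ('h, 'x, 'k::field) skew \<Rightarrow> ('h, 'x, 'k) skew" where
  "const_component m p = Poly_Mapping.mapp (\<lambda>(h, w) c. if count_list w = m then c else 0) p"

definition const_homogeneous_ideal :: "('h, 'x, 'k::field) skew set \<Rightarrow> bool" where
  "const_homogeneous_ideal J \<longleftrightarrow> (\<forall>p\<in>J. \<forall>m. const_component m p \<in> J)"


section \<open>The group \<open>H = (G \<times> F) / N\<close> and the relations\<close>

definition embG :: "('g, 'm) monoid_scheme \<Rightarrow> ('f, 'n) monoid_scheme \<Rightarrow>
    ('g \<times> 'f) set \<Rightarrow> 'g \<Rightarrow> ('g \<times> 'f) set" where
  "embG G F N a = N #>\<^bsub>G \<times>\<times> F\<^esub> (a, \<one>\<^bsub>F\<^esub>)"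

definition embF :: "('g, 'm) monoid_scheme \<Rightarrow> ('f, 'n) monoid_scheme \<Rightarrow>
    ('g \<times> 'f) set \<Rightarrow> 'f \<Rightarrow> ('g \<times> 'f) set" where
  "embF G F N b = N #>\<^bsub>G \<times>\<times> F\<^esub> (\<one>\<^bsub>G\<^esub>, b)"

text \<open>
  The extension of \<open>\<chi>\<^sup>i\<close> to \<open>G \<times> F\<close>; since \<open>\<chi>\<^sub>-\<^sup>i (f\<^sub>j) = p\<^sub>j\<^sub>i\<^sup>-\<^sup>1\<close>, it satisfies \<open>\<chi>\<^sup>i (f\<^sub>j) = p\<^sub>j\<^sub>i\<close>.
\<close>

definition ext_char :: "('i \<Rightarrow> 'g \<Rightarrow> 'k) \<Rightarrow> ('i \<Rightarrow> 'f \<Rightarrow> 'k) \<Rightarrow> 'i \<Rightarrow> 'g \<times> 'f \<Rightarrow> 'k::field" where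
  "ext_char \<chi> \<chi>m i = (\<lambda>(a, b). \<chi> i a * inverse (\<chi>m i b))"

text \<open>The value on a coset is that on any representative, \<open>\<chi>\<^sup>i\<close> being trivial on \<open>N\<close>.\<close>

definition quot_char :: "('i \<Rightarrow> 'g \<Rightarrow> 'k) \<Rightarrow> ('i \<Rightarrow> 'f \<Rightarrow> 'k) \<Rightarrow> 'i \<Rightarrow> ('g \<times> 'f) set \<Rightarrow> 'k::field" where
  "quot_char \<chi> \<chi>m i c = the_elem (ext_char \<chi> \<chi>m i ` c)"

text \<open>The letters are \<open>x\<^sub>i = Inl i\<close> and \<open>x\<^sub>i\<^sup>- = Inr i\<close>, the latter with the inverse character.\<close>

definition letter_char :: "('i \<Rightarrow> 'h \<Rightarrow> 'k::field) \<Rightarrow> 'i + 'i \<Rightarrow> 'h \<Rightarrow> 'k" where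
  "letter_char \<psi> = case_sum \<psi> (\<lambda>i h. inverse (\<psi> i h))"

text \<open>The bracket \<open>[x\<^sub>i, x\<^sub>j\<^sup>-]\<close>.\<close>

definition bracket :: "('h, 'm) monoid_scheme \<Rightarrow> ('i \<Rightarrow> 'h \<Rightarrow> 'k::field) \<Rightarrow> ('i \<Rightarrow> 'h) \<Rightarrow> 'i \<Rightarrow> 'i \<Rightarrow>
    ('h, 'i + 'i, 'k) skew" where
  "bracket H \<psi> f i j = (let A = skew_alg H (letter_char \<psi>) in
     letter H (Inl i) \<otimes>\<^bsub>A\<^esub> letter H (Inr j) - pm_scale (\<psi> i (f j)) (letter H (Inr j) \<otimes>\<^bsub>A\<^esub> letter H (Inl i)))"

definition bracket_rels :: "('h, 'm) monoid_scheme \<Rightarrow> ('i \<Rightarrow> 'h \<Rightarrow> 'k::field) \<Rightarrow> ('i \<Rightarrow> 'h) \<Rightarrow> ('i \<Rightarrow> 'h) \<Rightarrow>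
    ('h, 'i + 'i, 'k) skew set" where
  "bracket_rels H \<psi> g f =
     {bracket H \<psi> f i j - (if i = j then gr \<one>\<^bsub>H\<^esub> - gr (g i \<otimes>\<^bsub>H\<^esub> f i) else 0) |i j. True}"

end

theory Submission
  imports Defs "HOL-Library.Multiset"
begin

text \<open>
  Let \<open>J\<close> and \<open>J\<^sup>-\<close> be the given Hopf ideals. The algebra defined by the bracket relations alone acts on
  normal words \<open>h v w\<close>, with \<open>v\<close> a word in the \<open>x\<^sub>j\<^sup>-\<close> and \<open>w\<close> a word in the \<open>x\<^sub>i\<close>, in the way of a Verma
  module, and acting on \<open>1\<close> computes normal forms. Commuting an element \<open>u\<close> past an \<open>x\<^sub>j\<^sup>-\<close> produces, besides
  twisted copies of \<open>u\<close>, its two skew derivatives, which are the components linear in \<open>x\<^sub>j\<close> of the coproduct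
  of \<open>u\<close>. Since \<open>J\<close> is a coideal without linear terms, it is stable under these derivations; the
  twists are diagonal automorphisms, which preserve \<open>J\<close> because its generators are homogeneous and contain no
  group elements. The same holds for \<open>J\<^sup>-\<close>, so the normal words with a factor from \<open>J\<^sup>-\<close> or \<open>J\<close> span
  a submodule, and the normal forms of the elements of the defining ideal lie in it. Reading off tensors
  from normal forms therefore inverts the multiplication map.
\<close>

section \<open>Linear maps between spaces of finitely supported functions\<close>

text \<open>The obstacle is injectivity of the multiplication map: the ideal might contain
  unforeseen combinations of normal words. A check of overlapping rewriting rules is avoided by
  letting the algebra act on all words, normal or not, so that the bracket is the only relation to
  be verified for the action. The two ideals play different roles. An element of \<open>J^-\<close>
  acting on a normal word meets the left factor at once. It is an \<open>x_i\<close> that has to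
  cross a factor from \<open>J^-\<close>, which calls for the derivations of \<open>J^-\<close>. An
  element of \<open>J\<close> has to cross every \<open>x_j^-\<close> before it reaches the right
  factor, which calls for the derivations of \<open>J\<close>. That crossing yields exactly the skew
  derivations, scalars included, rests on \<open>\<chi>^j(g_i) = p_ji = \<chi>^i(f_j)\<close>. Maps
  between quotients are handled as linear maps between the spaces above them, inverse to each other
  modulo the subspaces divided out.\<close>

global_interpretation pm: vector_space "pm_scale :: 'k::field \<Rightarrow> ('b \<Rightarrow>\<^sub>0 'k) \<Rightarrow> _"
  by (rule vector_space_pm_scale)

abbreviation pm_linear :: "(('b \<Rightarrow>\<^sub>0 'k::field) \<Rightarrow> ('c \<Rightarrow>\<^sub>0 'k)) \<Rightarrow> bool" where
  "pm_linear \<equiv> Modules.module_hom pm_scale pm_scale"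

lemma pm_linearI:
  "(\<And>p q. f (p + q) = f p + f q) \<Longrightarrow> (\<And>c p. f (pm_scale c p) = pm_scale c (f p)) \<Longrightarrow> pm_linear f"
  by (simp add: module_hom_iff pm.module_axioms)

lemma pm_linearD:
  assumes "pm_linear f"
  shows "f (p + q) = f p + f q" "f (p - q) = f p - f q" "f (pm_scale c p) = pm_scale c (f p)" "f 0 = 0"
    "f (- p) = - f p" "f (\<Sum>i\<in>X. h i) = (\<Sum>i\<in>X. f (h i))"
  using assms by (simp_all add: module_hom.add module_hom.diff module_hom.scale module_hom.zero
      module_hom.neg module_hom.sum)

named_theorems pm_lin

lemma pm_linear_ident [pm_lin]: "pm_linear (\<lambda>x. x)"
  by (rule pm_linearI) auto

lemma pm_linear_add [pm_lin]: "pm_linear f \<Longrightarrow> pm_linear g \<Longrightarrow> pm_linear (\<lambda>x. f x + g x)"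
  by (rule pm_linearI) (auto simp: pm_linearD pm.scale_right_distrib)

lemma pm_linear_diff [pm_lin]: "pm_linear f \<Longrightarrow> pm_linear g \<Longrightarrow> pm_linear (\<lambda>x. f x - g x)"
  by (rule pm_linearI) (auto simp: pm_linearD pm.scale_right_diff_distrib)

lemma pm_linear_scale [pm_lin]: "pm_linear f \<Longrightarrow> pm_linear (\<lambda>x. pm_scale c (f x))"
  by (rule pm_linearI) (auto simp: pm_linearD pm.scale_right_distrib mult.commute)

lemma pm_linear_comp: "pm_linear L \<Longrightarrow> pm_linear f \<Longrightarrow> pm_linear (\<lambda>x. L (f x))"
  by (rule pm_linearI) (auto simp: pm_linearD)

lemma pm_scale_single [simp]: "pm_scale c (Poly_Mapping.single b x) = Poly_Mapping.single b (c * x)"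
  by (rule poly_mapping_eqI) (auto simp: lookup_single when_def)

lemma keys_pm_scale_subset: "Poly_Mapping.keys (pm_scale c p) \<subseteq> Poly_Mapping.keys p"
  by (auto simp: in_keys_iff)

lemma pm_expand: "p = (\<Sum>b\<in>Poly_Mapping.keys p. pm_scale (Poly_Mapping.lookup p b) (Poly_Mapping.single b 1))"
  by (rule poly_mapping_eqI)
    (auto simp: lookup_sum lookup_single when_def in_keys_iff if_distrib cong: if_cong)

lemma lin_ext_superset:
  assumes "finite X" "Poly_Mapping.keys p \<subseteq> X"
  shows "lin_ext \<phi> p = (\<Sum>b\<in>X. pm_scale (Poly_Mapping.lookup p b) (\<phi> b))"
  unfolding lin_ext_def using assms by (intro sum.mono_neutral_left) (auto simp: in_keys_iff)

lemma pm_linear_lin_ext: "pm_linear (lin_ext (\<phi> :: 'b \<Rightarrow> ('c \<Rightarrow>\<^sub>0 'k::field)))"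
proof (rule pm_linearI)
  fix p q :: "'b \<Rightarrow>\<^sub>0 'k"
  let ?X = "Poly_Mapping.keys p \<union> Poly_Mapping.keys q"
  have "Poly_Mapping.keys (p + q) \<subseteq> ?X" by (rule keys_add)
  then show "lin_ext \<phi> (p + q) = lin_ext \<phi> p + lin_ext \<phi> q"
    by (simp add: lin_ext_superset[where X = ?X] lookup_add pm.scale_left_distrib sum.distrib)
next
  fix c and p :: "'b \<Rightarrow>\<^sub>0 'k"
  show "lin_ext \<phi> (pm_scale c p) = pm_scale c (lin_ext \<phi> p)"
    using keys_pm_scale_subset[of c p]
    by (simp add: lin_ext_superset[where X = "Poly_Mapping.keys p"] pm.scale_sum_right)
qed

lemmas pm_linear_lin_ext' [pm_lin] = pm_linear_comp[OF pm_linear_lin_ext]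

lemma lin_ext_single: "lin_ext \<phi> (Poly_Mapping.single b c) = pm_scale c (\<phi> b)"
  by (subst lin_ext_superset[where X = "{b}"]) auto

lemma lin_ext_single_1 [simp]: "lin_ext \<phi> (Poly_Mapping.single b 1) = \<phi> b"
  by (simp add: lin_ext_single)

text \<open>Reduction to basis elements, behind most membership proofs below. The bound
  \<open>X\<close> on the support matters: group identities are available only for basis elements
  whose group part lies in the carrier.\<close>

lemma pm_linear_mem:
  assumes "pm_linear f" "pm.subspace W" "Poly_Mapping.keys p \<subseteq> X"
    "\<And>b. b \<in> X \<Longrightarrow> f (Poly_Mapping.single b 1) \<in> W"
  shows "f p \<in> W"
proof -
  have "f p = (\<Sum>b\<in>Poly_Mapping.keys p. pm_scale (Poly_Mapping.lookup p b) (f (Poly_Mapping.single b 1)))"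
    by (subst pm_expand[of p]) (simp only: pm_linearD[OF assms(1)])
  also have "\<dots> \<in> W"
    using assms by (intro pm.subspace_sum pm.subspace_scale) auto
  finally show ?thesis .
qed

lemma pm_linear_eq:
  assumes "pm_linear f" "pm_linear g" "Poly_Mapping.keys p \<subseteq> X"
    "\<And>b. b \<in> X \<Longrightarrow> f (Poly_Mapping.single b 1) = g (Poly_Mapping.single b 1)"
  shows "f p = g p"
  using pm_linear_mem[of "\<lambda>x. f x - g x" "{0}" p X] assms by (auto intro: pm_lin)

lemma pm_linear_span_mem:
  assumes "pm_linear f" "pm.subspace W" "p \<in> pm_span S" "\<And>b. b \<in> S \<Longrightarrow> f b \<in> W"
  shows "f p \<in> W"
proof -
  have "pm_span S \<subseteq> {x. f x \<in> W}"
    by (rule pm.span_minimal) (use assms in \<open>auto intro: module_hom.subspace_linear_preimage\<close>)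
  then show ?thesis using assms(3) by auto
qed

lemma subspace_keys: "pm.subspace {p :: 'b \<Rightarrow>\<^sub>0 'k::field. Poly_Mapping.keys p \<subseteq> X}"
proof (rule pm.subspaceI)
  fix p q :: "'b \<Rightarrow>\<^sub>0 'k"
  assume "p \<in> {p. Poly_Mapping.keys p \<subseteq> X}" "q \<in> {p. Poly_Mapping.keys p \<subseteq> X}"
  then show "p + q \<in> {p. Poly_Mapping.keys p \<subseteq> X}"
    using keys_add[of p q] by blast
next
  fix p :: "'b \<Rightarrow>\<^sub>0 'k" and c
  assume "p \<in> {p. Poly_Mapping.keys p \<subseteq> X}"
  then show "pm_scale c p \<in> {p. Poly_Mapping.keys p \<subseteq> X}"
    using keys_pm_scale_subset[of c p] by blast
qed auto

lemma pm_linear_sum [pm_lin]: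
  assumes "\<And>i. i \<in> X \<Longrightarrow> pm_linear (f i)"
  shows "pm_linear (\<lambda>x. \<Sum>i\<in>X. f i x)"
  using assms by (intro pm_linearI) (simp_all add: pm_linearD sum.distrib pm.scale_sum_right)

section \<open>Bilinear products, tensors and slice maps\<close>

lemma twisted_mult_lin_ext:
  "twisted_mult m \<sigma> p q = lin_ext (\<lambda>a. lin_ext (\<lambda>b. Poly_Mapping.single (m a b) (\<sigma> a b)) q) p"
  by (simp add: twisted_mult_def lin_ext_def pm.scale_sum_right mult_ac)

lemma pm_linear_twisted_mult_left [pm_lin]: "pm_linear f \<Longrightarrow> pm_linear (\<lambda>x. twisted_mult m \<sigma> (f x) q)"
  by (simp only: twisted_mult_lin_ext pm_linear_lin_ext')

lemma pm_linear_twisted_mult_right [pm_lin]: "pm_linear f \<Longrightarrow> pm_linear (\<lambda>x. twisted_mult m \<sigma> p (f x))"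
  unfolding twisted_mult_lin_ext lin_ext_def[of _ p] by (intro pm_lin)

lemma twisted_mult_single [simp]:
  "twisted_mult m \<sigma> (Poly_Mapping.single a x) (Poly_Mapping.single b y) =
     Poly_Mapping.single (m a b) (\<sigma> a b * x * y)"
  by (simp add: twisted_mult_lin_ext lin_ext_single mult_ac)

lemma pm_tensor_lin_ext:
  "pm_tensor p q = lin_ext (\<lambda>a. lin_ext (\<lambda>b. Poly_Mapping.single (a, b) 1) q) p"
  by (simp add: pm_tensor_def lin_ext_def pm.scale_sum_right)

lemma pm_tensor_single [simp]:
  "pm_tensor (Poly_Mapping.single a x) (Poly_Mapping.single b y) = Poly_Mapping.single (a, b) (x * y)"
  by (simp add: pm_tensor_lin_ext lin_ext_single)

text \<open>The slice map \<open>\<mu> \<otimes> id\<close>, where \<open>\<mu>\<close> also stands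
  for the functional with these values on basis elements; \<open>contract_right\<close> is
  \<open>id \<otimes> \<mu>\<close>.\<close>

definition contract_left :: "('b \<Rightarrow> 'k::field) \<Rightarrow> ('b \<times> 'c \<Rightarrow>\<^sub>0 'k) \<Rightarrow> ('c \<Rightarrow>\<^sub>0 'k)" where
  "contract_left \<mu> = lin_ext (\<lambda>(a, b). Poly_Mapping.single b (\<mu> a))"

definition contract_right :: "('c \<Rightarrow> 'k::field) \<Rightarrow> ('b \<times> 'c \<Rightarrow>\<^sub>0 'k) \<Rightarrow> ('b \<Rightarrow>\<^sub>0 'k)" where
  "contract_right \<mu> = lin_ext (\<lambda>(a, b). Poly_Mapping.single a (\<mu> b))"

lemma pm_linear_contract:
  "pm_linear (contract_left \<mu>)" "pm_linear (contract_right \<nu>)"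
  by (simp_all add: contract_left_def contract_right_def pm_linear_lin_ext)

lemmas pm_linear_contract' [pm_lin] = pm_linear_contract[THEN pm_linear_comp]

lemma contract_single [simp]:
  "contract_left \<mu> (Poly_Mapping.single (a, b) c) = Poly_Mapping.single b (c * \<mu> a)"
  "contract_right \<nu> (Poly_Mapping.single (a, b) c) = Poly_Mapping.single a (c * \<nu> b)"
  by (simp_all add: contract_left_def contract_right_def lin_ext_single)

lemma pm_linear_tensor [pm_lin]:
  "pm_linear f \<Longrightarrow> pm_linear (\<lambda>x. pm_tensor (f x) q)"
  by (simp only: pm_tensor_lin_ext pm_linear_lin_ext')

lemma pm_linear_tensor_right [pm_lin]: "pm_linear f \<Longrightarrow> pm_linear (\<lambda>x. pm_tensor p (f x))"
  unfolding pm_tensor_lin_ext lin_ext_def[of _ p] by (intro pm_lin)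

definition evaluate :: "('b \<Rightarrow> 'k) \<Rightarrow> ('b \<Rightarrow>\<^sub>0 'k::field) \<Rightarrow> 'k" where
  "evaluate \<mu> p = (\<Sum>b\<in>Poly_Mapping.keys p. Poly_Mapping.lookup p b * \<mu> b)"

text \<open>If the functional vanishes on a subspace \<open>J\<close>, the slice kills
  \<open>J \<otimes> A\<close> and maps \<open>A \<otimes> J\<close> into \<open>J\<close>. This is
  how a coideal condition becomes a stability statement.\<close>

lemma contract_left_tensor: "contract_left \<mu> (pm_tensor p q) = pm_scale (evaluate \<mu> p) q"
proof -
  have "contract_left \<mu> (pm_tensor p q) = lin_ext (\<lambda>a. pm_scale (\<mu> a) q) p"
  proof (rule pm_linear_eq[where X = UNIV and p = p])
    fix a
    show "contract_left \<mu> (pm_tensor (Poly_Mapping.single a 1) q) =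
        lin_ext (\<lambda>a. pm_scale (\<mu> a) q) (Poly_Mapping.single a 1)"
      by (rule pm_linear_eq[where X = UNIV and p = q]) (auto intro!: pm_lin)
  qed (auto intro!: pm_lin)
  also have "\<dots> = pm_scale (evaluate \<mu> p) q"
    by (simp add: lin_ext_def evaluate_def pm.scale_sum_left)
  finally show ?thesis .
qed

lemma contract_right_tensor: "contract_right \<nu> (pm_tensor p q) = pm_scale (evaluate \<nu> q) p"
proof -
  have "contract_right \<nu> (pm_tensor p q) = lin_ext (\<lambda>b. pm_scale (\<nu> b) p) q"
  proof (rule pm_linear_eq[where X = UNIV and p = q])
    fix b
    show "contract_right \<nu> (pm_tensor p (Poly_Mapping.single b 1)) =
        lin_ext (\<lambda>b. pm_scale (\<nu> b) p) (Poly_Mapping.single b 1)"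
      by (rule pm_linear_eq[where X = UNIV and p = p]) (auto intro!: pm_lin)
  qed (auto intro!: pm_lin)
  also have "\<dots> = pm_scale (evaluate \<nu> q) p"
    by (simp add: lin_ext_def evaluate_def pm.scale_sum_left)
  finally show ?thesis .
qed

section \<open>Quotients of subspaces\<close>

text \<open>Serves every quotient of the theorem: of algebras by ideals, and of the free space by
  the tensor relations, which is a vector space only. Addition is that of the type, so all questions
  reduce to \<open>x - y \<in> W\<close>.\<close>

locale concrete_space =
  fixes R :: "('k::field, 'b \<Rightarrow>\<^sub>0 'k) module" and W :: "('b \<Rightarrow>\<^sub>0 'k) set"
  assumes zero_eq: "zero R = 0" and add_eq: "add R = (+)" and smult_eq: "smult R = pm_scale"
    and subspace_carrier: "pm.subspace (carrier R)" and subspace_W: "pm.subspace W"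
    and W_subset: "W \<subseteq> carrier R"
begin

lemma coset_eq: "W +>\<^bsub>R\<^esub> x = {w + x |w. w \<in> W}"
  by (auto simp: a_r_coset_def r_coset_def add_eq)

lemma coset_mem_iff: "y \<in> W +>\<^bsub>R\<^esub> x \<longleftrightarrow> y - x \<in> W"
  by (auto simp: coset_eq intro: exI[of _ "y - x"])

lemma coset_eq_iff: "W +>\<^bsub>R\<^esub> x = W +>\<^bsub>R\<^esub> y \<longleftrightarrow> x - y \<in> W"
proof
  assume "W +>\<^bsub>R\<^esub> x = W +>\<^bsub>R\<^esub> y"
  moreover have "x \<in> W +>\<^bsub>R\<^esub> x" by (simp add: coset_mem_iff pm.subspace_0[OF subspace_W])
  ultimately show "x - y \<in> W" by (simp add: coset_mem_iff)
next
  assume *: "x - y \<in> W"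
  show "W +>\<^bsub>R\<^esub> x = W +>\<^bsub>R\<^esub> y"
  proof (rule Set.set_eqI)
    fix z
    show "z \<in> W +>\<^bsub>R\<^esub> x \<longleftrightarrow> z \<in> W +>\<^bsub>R\<^esub> y"
      using pm.subspace_add[OF subspace_W _ *, of "z - x"] pm.subspace_diff[OF subspace_W _ *, of "z - y"]
      by (auto simp: coset_mem_iff algebra_simps)
  qed
qed

lemma quot_carrier: "carrier (quot_alg R W) = {W +>\<^bsub>R\<^esub> x |x. x \<in> carrier R}"
  by (auto simp: quot_alg_def ring.defs module.defs FactRing_def A_RCOSETS_def' a_r_coset_def')

lemma quot_carrierI: "x \<in> carrier R \<Longrightarrow> W +>\<^bsub>R\<^esub> x \<in> carrier (quot_alg R W)"
  by (auto simp: quot_carrier)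

lemma quot_carrierE:
  assumes "Q \<in> carrier (quot_alg R W)"
  obtains x where "x \<in> carrier R" "Q = W +>\<^bsub>R\<^esub> x"
  using assms by (auto simp: quot_carrier)

lemma quot_add: "(W +>\<^bsub>R\<^esub> x) \<oplus>\<^bsub>quot_alg R W\<^esub> (W +>\<^bsub>R\<^esub> y) = W +>\<^bsub>R\<^esub> (x + y)"
proof -
  have "(W +>\<^bsub>R\<^esub> x) \<oplus>\<^bsub>quot_alg R W\<^esub> (W +>\<^bsub>R\<^esub> y) = {a + b |a b. a \<in> W +>\<^bsub>R\<^esub> x \<and> b \<in> W +>\<^bsub>R\<^esub> y}"
    by (auto simp: quot_alg_def ring.defs module.defs FactRing_def set_add_def set_mult_def add_eq)
  also have "\<dots> = W +>\<^bsub>R\<^esub> (x + y)"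
  proof (intro equalityI subsetI)
    fix z assume "z \<in> {a + b |a b. a \<in> W +>\<^bsub>R\<^esub> x \<and> b \<in> W +>\<^bsub>R\<^esub> y}"
    then obtain a b where "z = a + b" "a - x \<in> W" "b - y \<in> W" by (auto simp: coset_mem_iff)
    then show "z \<in> W +>\<^bsub>R\<^esub> (x + y)"
      using pm.subspace_add[OF subspace_W, of "a - x" "b - y"] by (simp add: coset_mem_iff algebra_simps)
  next
    fix z assume "z \<in> W +>\<^bsub>R\<^esub> (x + y)"
    then have "z - y \<in> W +>\<^bsub>R\<^esub> x" "y \<in> W +>\<^bsub>R\<^esub> y" "z = (z - y) + y"
      by (simp_all add: coset_mem_iff algebra_simps pm.subspace_0[OF subspace_W])
    then show "z \<in> {a + b |a b. a \<in> W +>\<^bsub>R\<^esub> x \<and> b \<in> W +>\<^bsub>R\<^esub> y}" by blast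
  qed
  finally show ?thesis .
qed

lemma quot_smult: "c \<odot>\<^bsub>quot_alg R W\<^esub> (W +>\<^bsub>R\<^esub> x) = W +>\<^bsub>R\<^esub> pm_scale c x"
proof -
  have "W +>\<^bsub>R\<^esub> pm_scale c y = W +>\<^bsub>R\<^esub> pm_scale c x" if "y \<in> W +>\<^bsub>R\<^esub> x" for y
    using that pm.subspace_scale[OF subspace_W, of "y - x" c]
    by (simp add: coset_eq_iff coset_mem_iff pm.scale_right_diff_distrib)
  moreover have "x \<in> W +>\<^bsub>R\<^esub> x" by (simp add: coset_mem_iff pm.subspace_0[OF subspace_W])
  ultimately have "(\<Union>y\<in>W +>\<^bsub>R\<^esub> x. W +>\<^bsub>R\<^esub> pm_scale c y) = W +>\<^bsub>R\<^esub> pm_scale c x"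
    by (intro UN_constant_eq ballI)
  then show ?thesis
    by (simp add: quot_alg_def ring.defs module.defs smult_eq)
qed

lemma coset_someI:
  assumes "x \<in> carrier R"
  shows "(SOME y. y \<in> W +>\<^bsub>R\<^esub> x) - x \<in> W" "(SOME y. y \<in> W +>\<^bsub>R\<^esub> x) \<in> carrier R"
proof -
  have "x \<in> W +>\<^bsub>R\<^esub> x" by (simp add: coset_mem_iff pm.subspace_0[OF subspace_W])
  then have "(SOME y. y \<in> W +>\<^bsub>R\<^esub> x) \<in> W +>\<^bsub>R\<^esub> x" by (rule someI)
  then show *: "(SOME y. y \<in> W +>\<^bsub>R\<^esub> x) - x \<in> W" by (simp add: coset_mem_iff)
  then have "(SOME y. y \<in> W +>\<^bsub>R\<^esub> x) - x + x \<in> carrier R"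
    using W_subset assms by (intro pm.subspace_add[OF subspace_carrier]) auto
  then show "(SOME y. y \<in> W +>\<^bsub>R\<^esub> x) \<in> carrier R" by simp
qed

end

text \<open>The maps \<open>f\<close> and \<open>g\<close> live on the spaces above the quotients
  and are inverse to each other only modulo \<open>W\<close> and \<open>W'\<close>. More cannot be
  expected later on, where representatives of cosets are chosen and normal forms taken.\<close>

lemma linear_iso_quot:
  fixes R :: "('k::field, 'b \<Rightarrow>\<^sub>0 'k) module" and R' :: "('k, 'c \<Rightarrow>\<^sub>0 'k) module"
  assumes "concrete_space R W" "concrete_space R' W'"
    and f: "pm_linear f" and fC: "\<And>x. x \<in> carrier R \<Longrightarrow> f x \<in> carrier R'"
    and fW: "\<And>x. x \<in> W \<Longrightarrow> f x \<in> W'"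
    and g: "pm_linear g" and gC: "\<And>y. y \<in> carrier R' \<Longrightarrow> g y \<in> carrier R"
    and gW: "\<And>y. y \<in> W' \<Longrightarrow> g y \<in> W"
    and gf: "\<And>x. x \<in> carrier R \<Longrightarrow> g (f x) - x \<in> W"
    and fg: "\<And>y. y \<in> carrier R' \<Longrightarrow> f (g y) - y \<in> W'"
  shows "\<exists>\<phi>. linear_iso (quot_alg R W) (quot_alg R' W') \<phi> \<and>
           (\<forall>x\<in>carrier R. \<phi> (W +>\<^bsub>R\<^esub> x) = W' +>\<^bsub>R'\<^esub> f x)"
proof -
  interpret a: concrete_space R W by fact
  interpret b: concrete_space R' W' by fact
  \<comment> \<open>The choice of representative is immaterial because \<open>f\<close> maps
    \<open>W\<close> into \<open>W'\<close>.\<close>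
  define \<phi> where "\<phi> Q = W' +>\<^bsub>R'\<^esub> f (SOME x. x \<in> Q)" for Q
  have \<phi>: "\<phi> (W +>\<^bsub>R\<^esub> x) = W' +>\<^bsub>R'\<^esub> f x" if "x \<in> carrier R" for x
    using fW[OF a.coset_someI(1)[OF that]] by (simp add: \<phi>_def b.coset_eq_iff pm_linearD[OF f])
  have "inj_on \<phi> (carrier (quot_alg R W))"
  proof (rule inj_onI)
    fix P Q assume "P \<in> carrier (quot_alg R W)" "Q \<in> carrier (quot_alg R W)" and eq: "\<phi> P = \<phi> Q"
    then obtain x y where xy: "x \<in> carrier R" "y \<in> carrier R" "P = W +>\<^bsub>R\<^esub> x" "Q = W +>\<^bsub>R\<^esub> y"
      by (auto elim!: a.quot_carrierE)
    then have "f x - f y \<in> W'" using eq by (simp add: \<phi> b.coset_eq_iff)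
    then have "g (f x) - g (f y) \<in> W" using gW by (metis pm_linearD(2)[OF g])
    moreover have "(g (f x) - g (f y)) - ((g (f x) - x) - (g (f y) - y)) = x - y" by simp
    ultimately have "x - y \<in> W" using gf xy by (metis pm.subspace_diff[OF a.subspace_W])
    then show "P = Q" using xy by (simp add: a.coset_eq_iff)
  qed
  moreover have "\<phi> ` carrier (quot_alg R W) = carrier (quot_alg R' W')"
  proof (intro equalityI subsetI)
    fix Q assume "Q \<in> \<phi> ` carrier (quot_alg R W)"
    then show "Q \<in> carrier (quot_alg R' W')" by (auto elim!: a.quot_carrierE simp: \<phi> intro!: b.quot_carrierI fC)
  next
    fix Q assume "Q \<in> carrier (quot_alg R' W')"
    then obtain y where y: "y \<in> carrier R'" "Q = W' +>\<^bsub>R'\<^esub> y" by (rule b.quot_carrierE)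
    then have "Q = \<phi> (W +>\<^bsub>R\<^esub> g y)"
      using fg[OF y(1)] b.coset_eq_iff[of "f (g y)" y] by (simp add: \<phi> gC)
    then show "Q \<in> \<phi> ` carrier (quot_alg R W)" using gC[OF y(1)] a.quot_carrierI by blast
  qed
  moreover have "x + y \<in> carrier R" "pm_scale c x \<in> carrier R" if "x \<in> carrier R" "y \<in> carrier R" for x y c
    using that by (simp_all add: pm.subspace_add[OF a.subspace_carrier] pm.subspace_scale[OF a.subspace_carrier])
  ultimately have "linear_iso (quot_alg R W) (quot_alg R' W') \<phi>"
    unfolding linear_iso_def bij_betw_def
    by (auto elim!: a.quot_carrierE simp: a.quot_add a.quot_smult \<phi> b.quot_add b.quot_smult pm_linearD[OF f])
  with \<phi> show ?thesis by blast
qed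

section \<open>The skew group algebra and its coordinate subalgebras\<close>

locale skew_hopf = comm_group H for H :: "('h, 'm) monoid_scheme" (structure) +
  fixes \<psi> :: "'x \<Rightarrow> 'h \<Rightarrow> 'k::field" and d :: "'x \<Rightarrow> 'h"
  assumes char: "\<psi> x \<in> hom H kstar" and d_closed [simp]: "d x \<in> carrier H"
begin

lemma char_mult [simp]: "g \<in> carrier H \<Longrightarrow> h \<in> carrier H \<Longrightarrow> \<psi> x (g \<otimes> h) = \<psi> x g * \<psi> x h"
  using char[of x] by (simp add: hom_def kstar_def)

lemma char_nonzero [simp]: "h \<in> carrier H \<Longrightarrow> \<psi> x h \<noteq> 0"
  using char[of x] by (auto simp: hom_def kstar_def)

lemma char_one [simp]: "\<psi> x \<one> = 1"
  using char_mult[of \<one> \<one> x] char_nonzero[of \<one> x] by simp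

text \<open>The character carried by a word: \<open>h^-1 w h = wchar w h * w\<close>.\<close>

definition wchar :: "'x list \<Rightarrow> 'h \<Rightarrow> 'k" where
  "wchar w h = (\<Prod>x\<leftarrow>w. \<psi> x h)"

lemma wchar_simps [simp]:
  "wchar [] h = 1" "wchar (x # w) h = \<psi> x h * wchar w h" "wchar (v @ w) h = wchar v h * wchar w h"
  by (simp_all add: wchar_def)

lemma wchar_mult [simp]:
  "g \<in> carrier H \<Longrightarrow> h \<in> carrier H \<Longrightarrow> wchar w (g \<otimes> h) = wchar w g * wchar w h"
  by (induction w) auto

lemma wchar_nonzero [simp]: "h \<in> carrier H \<Longrightarrow> wchar w h \<noteq> 0"
  by (induction w) auto

lemma inverse_wchar: "h \<in> carrier H \<Longrightarrow> (\<Prod>x\<leftarrow>w. inverse (\<psi> x h)) * wchar w h = 1"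
  by (induction w) (auto simp: field_simps)

lemma wchar_one [simp]: "wchar w \<one> = 1"
  by (induction w) auto

abbreviation A :: "('k, ('h, 'x, 'k) skew) module" where
  "A \<equiv> skew_alg H \<psi>"

definition mul :: "('h, 'x, 'k) skew \<Rightarrow> ('h, 'x, 'k) skew \<Rightarrow> ('h, 'x, 'k) skew" (infixl \<open>\<cdot>\<close> 75) where
  "mul = twisted_mult (basis_mult H) (basis_twist \<psi>)"

definition mon :: "'h \<Rightarrow> 'x list \<Rightarrow> ('h, 'x, 'k) skew" where
  "mon h w = Poly_Mapping.single (h, w) 1"

text \<open>One family for all algebras of the theorem: \<open>G<X>\<close> and
  \<open>F<X^->\<close> with \<open>P\<close> one half of the alphabet, the group algebras with
  \<open>P\<close> empty, the free algebras with \<open>K\<close> trivial.\<close>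

definition sub :: "'h set \<Rightarrow> 'x set \<Rightarrow> ('h, 'x, 'k) skew set" where
  "sub K P = {p. Poly_Mapping.keys p \<subseteq> K \<times> lists P}"

abbreviation C :: "('h, 'x, 'k) skew set" where
  "C \<equiv> sub (carrier H) UNIV"

definition alg :: "'h set \<Rightarrow> 'x set \<Rightarrow> ('k, ('h, 'x, 'k) skew) module" where
  "alg K P = A\<lparr>carrier := sub K P\<rparr>"

lemma alg_simps [simp]:
  "carrier (alg K P) = sub K P" "monoid.mult (alg K P) = mul" "one (alg K P) = mon \<one> []"
  "zero (alg K P) = 0" "add (alg K P) = (+)" "smult (alg K P) = pm_scale"
  by (simp_all add: alg_def skew_alg_def mul_def mon_def)

lemma A_eq_alg: "A = alg (carrier H) UNIV"
  by (simp add: alg_def sub_def skew_alg_def lists_UNIV)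

lemma A_simps [simp]:
  "carrier A = C" "monoid.mult A = mul" "one A = mon \<one> []"
  "zero A = 0" "add A = (+)" "smult A = pm_scale"
  by (simp_all add: A_eq_alg)

lemma gr_mon: "gr h = mon h []" and letter_mon: "letter H x = mon \<one> [x]"
  by (simp_all add: gr_def letter_def mon_def)

lemma pm_linear_mul_left [pm_lin]: "pm_linear f \<Longrightarrow> pm_linear (\<lambda>x. f x \<cdot> q)"
  and pm_linear_mul_right [pm_lin]: "pm_linear f \<Longrightarrow> pm_linear (\<lambda>x. p \<cdot> f x)"
  unfolding mul_def by (intro pm_lin; assumption)+

lemmas mul_left = pm_linearD[OF pm_linear_mul_left[OF pm_linear_ident]]
lemmas mul_right = pm_linearD[OF pm_linear_mul_right[OF pm_linear_ident]]

lemma mul_single: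
  "Poly_Mapping.single (g, v) a \<cdot> Poly_Mapping.single (h, w) b =
     Poly_Mapping.single (g \<otimes> h, v @ w) (wchar v h * a * b)"
  by (simp add: mul_def basis_mult_def basis_twist_def wchar_def)

lemma mul_mon: "mon g v \<cdot> mon h w = pm_scale (wchar v h) (mon (g \<otimes> h) (v @ w))"
  by (simp add: mon_def mul_single)

lemma subspace_sub [simp]: "pm.subspace (sub K P)"
  unfolding sub_def by (rule subspace_keys)

lemma sub_closed [simp]:
  "0 \<in> sub K P" "p \<in> sub K P \<Longrightarrow> q \<in> sub K P \<Longrightarrow> p + q \<in> sub K P"
  "p \<in> sub K P \<Longrightarrow> q \<in> sub K P \<Longrightarrow> p - q \<in> sub K P"
  "p \<in> sub K P \<Longrightarrow> - p \<in> sub K P" "p \<in> sub K P \<Longrightarrow> pm_scale c p \<in> sub K P"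
  by (simp_all add: pm.subspace_0 pm.subspace_add pm.subspace_diff pm.subspace_neg pm.subspace_scale)

lemma sub_single: "h \<in> K \<Longrightarrow> w \<in> lists P \<Longrightarrow> Poly_Mapping.single (h, w) c \<in> sub K P"
  by (simp add: sub_def)

lemma sub_mon: "h \<in> K \<Longrightarrow> w \<in> lists P \<Longrightarrow> mon h w \<in> sub K P"
  by (simp add: mon_def sub_single)

lemma C_mon [simp]: "h \<in> carrier H \<Longrightarrow> mon h w \<in> C"
  by (simp add: sub_mon)

lemma sub_mono: "K \<subseteq> K' \<Longrightarrow> P \<subseteq> P' \<Longrightarrow> sub K P \<subseteq> sub K' P'"
  unfolding sub_def using lists_mono[of P P'] by blast

lemma sub_linear_mem:
  assumes "p \<in> sub K P" "pm_linear f" "pm.subspace W"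
    "\<And>h w. h \<in> K \<Longrightarrow> w \<in> lists P \<Longrightarrow> f (mon h w) \<in> W"
  shows "f p \<in> W"
proof (rule pm_linear_mem[OF assms(2,3)])
  show "Poly_Mapping.keys p \<subseteq> K \<times> lists P" using assms(1) by (simp add: sub_def)
qed (use assms(4) in \<open>auto simp only: mon_def mem_Times_iff split_paired_all fst_conv snd_conv\<close>)

lemma sub_linear_eq:
  assumes "p \<in> sub K P" "pm_linear f" "pm_linear g"
    "\<And>h w. h \<in> K \<Longrightarrow> w \<in> lists P \<Longrightarrow> f (mon h w) = g (mon h w)"
  shows "f p = g p"
proof (rule pm_linear_eq[OF assms(2,3)])
  show "Poly_Mapping.keys p \<subseteq> K \<times> lists P" using assms(1) by (simp add: sub_def)
qed (use assms(4) in \<open>auto simp only: mon_def mem_Times_iff split_paired_all fst_conv snd_conv\<close>)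

lemma sub_mul:
  assumes K: "\<And>g h. g \<in> K \<Longrightarrow> h \<in> K \<Longrightarrow> g \<otimes> h \<in> K" and "p \<in> sub K P" "q \<in> sub K P"
  shows "p \<cdot> q \<in> sub K P"
proof (rule sub_linear_mem[OF assms(2)])
  fix g v assume "g \<in> K" "v \<in> lists P"
  then show "mon g v \<cdot> q \<in> sub K P"
    by (intro sub_linear_mem[OF assms(3), of "\<lambda>q. mon g v \<cdot> q" "sub K P"])
      (auto intro!: pm_lin simp: mul_mon K sub_mon)
qed (auto intro: pm_lin)

lemma C_mul [simp]: "p \<in> C \<Longrightarrow> q \<in> C \<Longrightarrow> p \<cdot> q \<in> C"
  by (rule sub_mul) auto

text \<open>The twist \<open>wchar v h\<close> is multiplicative in the word and in the group
  element, hence a 2-cocycle.\<close>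

lemma mul_assoc:
  assumes "p \<in> C" "q \<in> C" "r \<in> C"
  shows "p \<cdot> q \<cdot> r = p \<cdot> (q \<cdot> r)"
proof (rule sub_linear_eq[OF assms(1)])
  fix g v assume g: "g \<in> carrier H"
  show "mon g v \<cdot> q \<cdot> r = mon g v \<cdot> (q \<cdot> r)"
  proof (rule sub_linear_eq[OF assms(2)])
    fix h w assume h: "h \<in> carrier H"
    show "mon g v \<cdot> mon h w \<cdot> r = mon g v \<cdot> (mon h w \<cdot> r)"
      by (rule sub_linear_eq[OF assms(3)])
        (auto intro!: pm_lin simp: mul_mon mul_left mul_right m_assoc g h mult_ac)
  qed (auto intro!: pm_lin)
qed (auto intro!: pm_lin)

lemma one_mul [simp]: "p \<in> C \<Longrightarrow> mon \<one> [] \<cdot> p = p"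
  by (erule sub_linear_eq) (auto intro!: pm_lin simp: mul_mon)

lemma mul_one [simp]: "p \<in> C \<Longrightarrow> p \<cdot> mon \<one> [] = p"
  by (erule sub_linear_eq) (auto intro!: pm_lin simp: mul_mon)

lemma subset_C: "K \<subseteq> carrier H \<Longrightarrow> p \<in> sub K P \<Longrightarrow> p \<in> C"
  using sub_mono[of K "carrier H" P UNIV] by auto

lemma ring_alg:
  assumes K: "subgroup K H"
  shows "ring (alg K P)"
proof -
  note KC = subset_C[OF subgroup.subset[OF K], of _ P]
  show ?thesis
  proof (rule ringI)
    show "abelian_group (alg K P)"
      by (rule abelian_groupI) (auto simp: add.assoc add.commute intro: exI[of _ "- _"] bexI[of _ "- _"])
    show "Group.monoid (alg K P)"
      by (rule monoidI) (auto simp: mul_assoc KC sub_mul subgroup.m_closed[OF K] subgroup.one_closed[OF K] sub_mon)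
  qed (auto simp: mul_left mul_right)
qed

section \<open>Two-sided ideals, generated ideals and generated subalgebras\<close>

definition two_sided :: "('h, 'x, 'k) skew set \<Rightarrow> ('h, 'x, 'k) skew set \<Rightarrow> bool" where
  "two_sided B J \<longleftrightarrow> J \<subseteq> B \<and> pm.subspace J \<and> (\<forall>b\<in>B. \<forall>u\<in>J. b \<cdot> u \<in> J \<and> u \<cdot> b \<in> J)"

lemma two_sidedD:
  assumes "two_sided B J"
  shows "J \<subseteq> B" "pm.subspace J" "b \<in> B \<Longrightarrow> u \<in> J \<Longrightarrow> b \<cdot> u \<in> J" "b \<in> B \<Longrightarrow> u \<in> J \<Longrightarrow> u \<cdot> b \<in> J"
  using assms by (auto simp: two_sided_def)

text \<open>Ring ideals are subspaces here because scaling by \<open>c\<close> is multiplication by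
  \<open>c\<close> times the unit, an element of the algebra.\<close>

lemma ideal_alg_iff:
  assumes K: "subgroup K H"
  shows "ideal J (alg K P) \<longleftrightarrow> two_sided (sub K P) J"
proof
  interpret r: ring "alg K P" by (rule ring_alg[OF K])
  note KC = subset_C[OF subgroup.subset[OF K], of _ P]
  show "two_sided (sub K P) J" if "ideal J (alg K P)"
  proof -
    interpret ideal J "alg K P" by (rule that)
    have sub: "J \<subseteq> sub K P" using a_subset by simp
    moreover have "pm.subspace J"
    proof (rule pm.subspaceI)
      show "0 \<in> J" using zero_closed by simp
      show "p + q \<in> J" if "p \<in> J" "q \<in> J" for p q using a_closed that by simp
      show "pm_scale c p \<in> J" if "p \<in> J" for c p
      proof -
        have "pm_scale c (mon \<one> []) \<cdot> p \<in> J"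
          using I_l_closed[of p "pm_scale c (mon \<one> [])"] that
          by (simp add: sub_mon subgroup.one_closed[OF K])
        then show ?thesis using KC sub that by (auto simp: mul_left)
      qed
    qed
    ultimately show ?thesis using I_l_closed I_r_closed by (auto simp: two_sided_def)
  qed
  show "ideal J (alg K P)" if J: "two_sided (sub K P) J"
  proof (rule idealI[OF ring_alg[OF K]])
    show "subgroup J (add_monoid (alg K P))"
    proof (rule group.subgroupI)
      show "group (add_monoid (alg K P))" by (rule r.a_group)
      fix a assume a: "a \<in> J"
      have "inv\<^bsub>add_monoid (alg K P)\<^esub> a = - a"
        using two_sidedD(1)[OF J] a
        by (intro group.inv_equality[OF r.a_group]) auto
      then show "inv\<^bsub>add_monoid (alg K P)\<^esub> a \<in> J"
        using pm.subspace_neg[OF two_sidedD(2)[OF J] a] by simp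
    next
      show "J \<noteq> {}" using pm.subspace_0[OF two_sidedD(2)[OF J]] by auto
    qed (use two_sidedD[OF J] pm.subspace_add[OF two_sidedD(2)[OF J]] in auto)
  qed (use two_sidedD[OF J] in auto)
qed

text \<open>Used as an induction principle: to prove a property on a generated ideal, take for
  \<open>J\<close> the set of elements that have it.\<close>

lemma genideal_subset:
  assumes "subgroup K H" "two_sided (sub K P) J" "U \<subseteq> J"
  shows "Idl\<^bsub>alg K P\<^esub> U \<subseteq> J"
  using assms ideal_alg_iff by (auto simp: genideal_def)

lemma two_sided_genideal:
  assumes "subgroup K H" "U \<subseteq> sub K P"
  shows "two_sided (sub K P) (Idl\<^bsub>alg K P\<^esub> U)" "U \<subseteq> Idl\<^bsub>alg K P\<^esub> U"
  using ring.genideal_ideal[OF ring_alg[OF assms(1)], of U P] ring.genideal_self[OF ring_alg[OF assms(1)], of U P]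
    assms by (simp_all add: ideal_alg_iff)

text \<open>\<open>K'\<close> may omit the unit, since scalars always belong to a subalgebra. With
  \<open>K' = {}\<close> and \<open>K = {\<one>}\<close> this covers the free algebra, which has no
  group generators.\<close>

lemma subalg_eq_alg:
  assumes K: "subgroup K H" and K': "K' \<subseteq> K" "K \<subseteq> insert \<one> K'"
  shows "subalg A (gr ` K' \<union> letter H ` P) = alg K P"
proof -
  let ?S = "range (\<lambda>c. c \<odot>\<^bsub>A\<^esub> \<one>\<^bsub>A\<^esub>) \<union> (gr ` K' \<union> letter H ` P)"
  let ?g = "generate_ring A ?S"
  interpret a: ring A using ring_alg[OF subgroup_self] by (simp add: A_eq_alg)
  note KC = subset_C[OF subgroup.subset[OF K], of _ P]
  have "p \<in> sub K P" if "p \<in> ?g" for p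
    using that
  proof (induction rule: generate_ring.induct)
    case one
    then show ?case by (simp add: sub_mon subgroup.one_closed[OF K])
  next
    case (incl h)
    then show ?case using K' by (auto simp: gr_mon letter_mon sub_mon subgroup.one_closed[OF K])
  next
    case (a_inv h)
    have "\<ominus>\<^bsub>A\<^esub> h = - h" using KC[OF a_inv.IH] by (intro a.minus_equality) auto
    then show ?case using a_inv.IH by simp
  next
    case (eng_mult h1 h2)
    then show ?case by (simp add: sub_mul subgroup.m_closed[OF K])
  qed auto
  moreover have "p \<in> ?g" if "p \<in> sub K P" for p
  proof (rule sub_linear_mem[OF that, of "\<lambda>x. x"])
    have scal: "pm_scale c (mon \<one> []) \<in> ?g" for c
      by (rule generate_ring.incl) auto
    have gC: "?g \<subseteq> C"
    proof -
      have "?S \<subseteq> carrier A" using K' subgroup.subset[OF K] by (auto simp: gr_mon letter_mon)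
      then show ?thesis using a.generate_ring_incl by simp
    qed
    show "pm.subspace ?g"
    proof (rule pm.subspaceI)
      show "0 \<in> ?g" using scal[of 0] by simp
      show "p + q \<in> ?g" if "p \<in> ?g" "q \<in> ?g" for p q using generate_ring.eng_add[OF that] by simp
      show "pm_scale c p \<in> ?g" if "p \<in> ?g" for c p
        using generate_ring.eng_mult[OF scal[of c] that] gC that by (auto simp: mul_left)
    qed
    fix h w assume h: "h \<in> K" and "w \<in> lists P"
    from this(2) have "mon \<one> w \<in> ?g"
    proof (induction w)
      case Nil
      show ?case using generate_ring.one[of A] by simp
    next
      case (Cons x w)
      have "mon \<one> [x] \<in> ?g" using Cons.hyps by (intro generate_ring.incl) (auto simp: letter_mon)
      then have "mon \<one> [x] \<cdot> mon \<one> w \<in> ?g" using generate_ring.eng_mult[of _ A] Cons.IH by simp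
      then show ?case by (simp add: mul_mon)
    qed
    moreover have "mon h [] \<in> ?g"
    proof (cases "h \<in> K'")
      case True
      then show ?thesis by (intro generate_ring.incl) (auto simp: gr_mon)
    next
      case False
      then show ?thesis using generate_ring.one[of A] h K' by auto
    qed
    ultimately have "mon h [] \<cdot> mon \<one> w \<in> ?g" using generate_ring.eng_mult[of _ A] by simp
    then show "mon h w \<in> ?g" using h subgroup.subset[OF K] by (auto simp: mul_mon)
  qed (auto intro: pm_lin)
  ultimately have "?g = sub K P" by blast
  then show ?thesis by (simp only: subalg_def alg_def)
qed

subsection \<open>Diagonal automorphisms\<close>

text \<open>All twists below are of this form: conjugation by a group element has
  \<open>\<kappa>\<close> trivial, while crossing by a letter takes for \<open>\<kappa>\<close> the
  character of that letter.\<close>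

definition diag :: "('h \<Rightarrow> 'k) \<Rightarrow> ('x \<Rightarrow> 'k) \<Rightarrow> ('h, 'x, 'k) skew \<Rightarrow> ('h, 'x, 'k) skew" where
  "diag \<kappa> c = lin_ext (\<lambda>(h, w). pm_scale (\<kappa> h * (\<Prod>x\<leftarrow>w. c x)) (mon h w))"

lemma pm_linear_diag: "pm_linear (diag \<kappa> c)"
  by (simp add: diag_def pm_linear_lin_ext)

lemmas pm_linear_diag' [pm_lin] = pm_linear_comp[OF pm_linear_diag]
lemmas diag_linear = pm_linearD[OF pm_linear_diag]

lemma diag_mon [simp]: "diag \<kappa> c (mon h w) = pm_scale (\<kappa> h * (\<Prod>x\<leftarrow>w. c x)) (mon h w)"
  by (simp add: diag_def mon_def lin_ext_single)

lemma diag_sub [simp]: "p \<in> sub K P \<Longrightarrow> diag \<kappa> c p \<in> sub K P"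
  by (erule sub_linear_mem) (auto intro!: pm_lin sub_closed(5) sub_mon)

lemma diag_mul:
  assumes \<kappa>: "\<kappa> \<in> hom H kstar" and "p \<in> C" "q \<in> C"
  shows "diag \<kappa> c (p \<cdot> q) = diag \<kappa> c p \<cdot> diag \<kappa> c q"
proof (rule sub_linear_eq[OF assms(2)])
  fix g v assume g: "g \<in> carrier H"
  show "diag \<kappa> c (mon g v \<cdot> q) = diag \<kappa> c (mon g v) \<cdot> diag \<kappa> c q"
    by (rule sub_linear_eq[OF assms(3)])
      (use \<kappa> g in \<open>auto intro!: pm_lin simp: mul_mon mul_left mul_right diag_linear hom_def kstar_def\<close>)
qed (auto intro!: pm_lin)

text \<open>Scalars commute, so the product sees only the multiset of letters.\<close>

lemma prod_list_count_eq:
  assumes "count_list v = count_list w"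
  shows "(\<Prod>x\<leftarrow>v. c x :: 'k) = (\<Prod>x\<leftarrow>w. c x)"
proof -
  have "mset v = mset w" by (rule multiset_eqI) (simp add: assms count_mset)
  then have "prod_mset (image_mset c (mset v)) = prod_mset (image_mset c (mset w))" by simp
  then show ?thesis by (simp add: prod_mset_prod_list flip: mset_map)
qed

text \<open>All words of \<open>u\<close> share one multiset of letters and the group part
  \<open>\<one>\<close>, where \<open>\<kappa>\<close> is 1; so \<open>u\<close> is an
  eigenvector.\<close>

lemma diag_homogeneous:
  assumes \<kappa>: "\<kappa> \<in> hom H kstar" and u: "u \<in> sub {\<one>} P" "const_homogeneous u"
  shows "\<exists>a. diag \<kappa> c u = pm_scale a u"
proof -
  have \<kappa>1: "\<kappa> \<one> = 1"
    using \<kappa> by (fastforce simp: hom_def kstar_def dest: spec bspec[where x = \<one>])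
  from u(2) obtain m where m: "\<And>h w. (h, w) \<in> Poly_Mapping.keys u \<Longrightarrow> count_list w = m"
    unfolding const_homogeneous_def by fast
  show ?thesis
  proof (cases "Poly_Mapping.keys u = {}")
    case True
    then show ?thesis by (auto simp: diag_linear)
  next
    case False
    then obtain h0 w0 where w0: "(h0, w0) \<in> Poly_Mapping.keys u" by (metis ex_in_conv surj_pair)
    have "diag \<kappa> c u = pm_scale (\<Prod>x\<leftarrow>w0. c x) u"
    proof (rule pm_linear_eq[where X = "Poly_Mapping.keys u" and p = u and f = "diag \<kappa> c"])
      fix b assume "b \<in> Poly_Mapping.keys u"
      moreover obtain h w where "b = (h, w)" by fastforce
      moreover from calculation have "h = \<one>" using u(1) by (auto simp: sub_def)
      ultimately show "diag \<kappa> c (Poly_Mapping.single b 1) = pm_scale (\<Prod>x\<leftarrow>w0. c x) (Poly_Mapping.single b 1)"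
        using m w0 \<kappa>1 prod_list_count_eq[of w w0 c] by (simp flip: mon_def)
    qed (auto intro!: pm_lin)
    then show ?thesis by blast
  qed
qed

text \<open>The preimage of \<open>J\<close> under the automorphism is an ideal that contains the
  generators, as these are eigenvectors. It is here that the generators must be homogeneous and
  taken from the free algebra.\<close>

lemma diag_ideal:
  assumes K: "subgroup K H" and J: "J = Idl\<^bsub>alg K P\<^esub> U" and U: "\<And>u. u \<in> U \<Longrightarrow> u \<in> sub {\<one>} P \<and> const_homogeneous u"
    and \<kappa>: "\<kappa> \<in> hom H kstar" and p: "p \<in> J"
  shows "diag \<kappa> c p \<in> J"
proof -
  note KC = subset_C[OF subgroup.subset[OF K], of _ P]
  have UK: "U \<subseteq> sub K P"
    using U sub_mono[of "{\<one>}" K P P] subgroup.one_closed[OF K] by auto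
  note J' = two_sided_genideal[OF K UK, folded J]
  have "two_sided (sub K P) {p \<in> sub K P. diag \<kappa> c p \<in> J}"
    unfolding two_sided_def
  proof (intro conjI ballI)
    show "pm.subspace {p \<in> sub K P. diag \<kappa> c p \<in> J}"
      using two_sidedD(2)[OF J'(1)]
      by (intro pm.subspaceI) (auto simp: diag_linear pm.subspace_0 pm.subspace_add pm.subspace_scale)
  qed (use KC two_sidedD[OF J'(1)] in \<open>auto simp: diag_mul[OF \<kappa>] sub_mul subgroup.m_closed[OF K]\<close>)
  moreover have "diag \<kappa> c u \<in> J" if "u \<in> U" for u
  proof -
    from U[OF that] obtain a where "diag \<kappa> c u = pm_scale a u" using diag_homogeneous[OF \<kappa>] by blast
    then show ?thesis using that J'(2) pm.subspace_scale[OF two_sidedD(2)[OF J'(1)]] by auto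
  qed
  ultimately have "J \<subseteq> {p \<in> sub K P. diag \<kappa> c p \<in> J}"
    using UK unfolding J by (intro genideal_subset[OF K]) auto
  then show ?thesis using p by auto
qed

subsection \<open>Skew derivations\<close>

text \<open>The group-like in the extreme term \<open>dprod w \<otimes> w\<close> of the coproduct
  of \<open>w\<close>.\<close>

definition dprod :: "'x list \<Rightarrow> 'h" where
  "dprod w = foldr (\<lambda>x h. d x \<otimes> h) w \<one>"

lemma dprod_simps [simp]: "dprod [] = \<one>" "dprod (x # w) = d x \<otimes> dprod w"
  by (simp_all add: dprod_def)

lemma dprod_closed [simp]: "dprod w \<in> carrier H"
  by (induction w) auto

text \<open>In closed form: the sum over all factorizations \<open>w = v y v'\<close> of
  \<open>v v'\<close> with weight \<open>\<psi> y (dprod v')\<close>, so the letters to the right of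
  the deleted one contribute.\<close>

primrec dLw :: "'x \<Rightarrow> 'x list \<Rightarrow> ('h, 'x, 'k) skew" where
  "dLw y [] = 0"
| "dLw y (x # w) = mon \<one> [x] \<cdot> dLw y w + (if x = y then pm_scale (\<psi> y (dprod w)) (mon \<one> w) else 0)"

text \<open>In closed form: the sum over all factorizations \<open>w = v y v'\<close> of
  \<open>v v'\<close> with weight \<open>wchar v (d y)\<close>, so the letters to the left of the
  deleted one contribute.\<close>

primrec dRw :: "'x \<Rightarrow> 'x list \<Rightarrow> ('h, 'x, 'k) skew" where
  "dRw y [] = 0"
| "dRw y (x # w) = pm_scale (\<psi> x (d y)) (mon \<one> [x] \<cdot> dRw y w) + (if x = y then mon \<one> w else 0)"

definition dL :: "'x \<Rightarrow> ('h, 'x, 'k) skew \<Rightarrow> ('h, 'x, 'k) skew" where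
  "dL y = lin_ext (\<lambda>(h, w). mon h [] \<cdot> dLw y w)"

definition dR :: "'x \<Rightarrow> ('h, 'x, 'k) skew \<Rightarrow> ('h, 'x, 'k) skew" where
  "dR y = lin_ext (\<lambda>(h, w). mon h [] \<cdot> dRw y w)"

lemma pm_linear_d: "pm_linear (dL y)" "pm_linear (dR y)"
  by (simp_all add: dL_def dR_def pm_linear_lin_ext)

lemmas pm_linear_d' [pm_lin] = pm_linear_d[THEN pm_linear_comp]

lemma d_mon [simp]: "dL y (mon h w) = mon h [] \<cdot> dLw y w" "dR y (mon h w) = mon h [] \<cdot> dRw y w"
  by (simp_all add: dL_def dR_def mon_def lin_ext_single)

lemma dw_sub:
  assumes "w \<in> lists P"
  shows "dLw y w \<in> sub {\<one>} P" "dRw y w \<in> sub {\<one>} P"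
  using assms by (induction w) (auto intro!: sub_closed(2,5) sub_mul sub_mon)

lemma dw_C [simp]: "dLw y w \<in> C" "dRw y w \<in> C"
  using dw_sub[of w UNIV y] subset_C[of "{\<one>}"] by auto

lemma d_sub:
  assumes "subgroup K H" "p \<in> sub K P"
  shows "dL y p \<in> sub K P" "dR y p \<in> sub K P"
proof -
  have "{\<one>} \<subseteq> K" using subgroup.one_closed[OF assms(1)] by auto
  then have "dLw y w \<in> sub K P" "dRw y w \<in> sub K P" if "w \<in> lists P" for w
    using dw_sub[OF that, of y] subsetD[OF sub_mono[of "{\<one>}" K P P]] by auto
  then have "dL y (mon h w) \<in> sub K P" "dR y (mon h w) \<in> sub K P" if "h \<in> K" "w \<in> lists P" for h w
    using that by (simp_all del: in_lists_conv_set add: sub_mul sub_mon subgroup.m_closed[OF assms(1)])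
  then show "dL y p \<in> sub K P" "dR y p \<in> sub K P"
    using sub_linear_mem[OF assms(2) pm_linear_d(1) subspace_sub]
      sub_linear_mem[OF assms(2) pm_linear_d(2) subspace_sub] by blast+
qed

text \<open>
  \<open>dL y\<close> and \<open>d y \<cdot> dR y\<close> are the components \<open>y \<otimes> _\<close> and \<open>_ \<otimes> y\<close> of the coproduct. A coideal
  without terms of degree at most one is therefore stable under both.
\<close>

abbreviation linear_part :: "'x \<Rightarrow> 'h \<times> 'x list \<Rightarrow> 'k" where
  "linear_part y \<equiv> \<lambda>(h, w). if w = [y] then 1 else 0"

text \<open>Closes the recursion for \<open>linear_part\<close>: when the leading letter of a word
  supplies \<open>y\<close>, the rest of that leg is a group element \<open>h\<close>, and
  \<open>y h = \<psi> y h * h y\<close> produces the weight.\<close>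

abbreviation scalar_part :: "'x \<Rightarrow> 'h \<times> 'x list \<Rightarrow> 'k" where
  "scalar_part y \<equiv> \<lambda>(h, w). if w = [] then \<psi> y h else 0"

definition C2 :: "('h, 'x, 'k) skew2 set" where
  "C2 = {T. Poly_Mapping.keys T \<subseteq> (carrier H \<times> UNIV) \<times> (carrier H \<times> UNIV)}"

lemma pm_linear_mult2 [pm_lin]: "pm_linear f \<Longrightarrow> pm_linear (\<lambda>x. mult2 H \<psi> T (f x))"
  unfolding mult2_def by (intro pm_lin; assumption)

lemma mult2_single:
  "mult2 H \<psi> (Poly_Mapping.single ((g, v), (g', v')) a) (Poly_Mapping.single ((h, w), (h', w')) b) =
     Poly_Mapping.single ((g \<otimes> h, v @ w), (g' \<otimes> h', v' @ w')) (wchar v h * wchar v' h' * a * b)"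
  by (simp add: mult2_def basis_mult_def basis_twist_def wchar_def)

lemma mult2_add: "mult2 H \<psi> (S + S') T = mult2 H \<psi> S T + mult2 H \<psi> S' T"
  using pm_linearD(1)[OF pm_linear_twisted_mult_left[OF pm_linear_ident]] by (simp add: mult2_def)

lemma coprod_letter_eq:
  "coprod_letter H d x = Poly_Mapping.single ((\<one>, [x]), (\<one>, [])) 1 + Poly_Mapping.single ((d x, []), (\<one>, [x])) 1"
  by (simp add: coprod_letter_def letter_def gr_def)

lemma C2_linear_eq:
  assumes "T \<in> C2" "pm_linear f" "pm_linear g"
    "\<And>h w h' w'. h \<in> carrier H \<Longrightarrow> h' \<in> carrier H \<Longrightarrow>
       f (Poly_Mapping.single ((h, w), (h', w')) 1) = g (Poly_Mapping.single ((h, w), (h', w')) 1)"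
  shows "f T = g T"
proof (rule pm_linear_eq[OF assms(2,3)])
  show "Poly_Mapping.keys T \<subseteq> (carrier H \<times> UNIV) \<times> (carrier H \<times> UNIV)" using assms(1) by (simp add: C2_def)
qed (use assms(4) in \<open>auto simp only: mem_Times_iff split_paired_all fst_conv snd_conv\<close>)

lemma C2_closed:
  assumes "T \<in> C2"
  shows "mult2 H \<psi> (coprod_letter H d x) T \<in> C2"
  unfolding C2_def
proof (rule pm_linear_mem[where f = "mult2 H \<psi> (coprod_letter H d x)"])
  show "Poly_Mapping.keys T \<subseteq> (carrier H \<times> UNIV) \<times> (carrier H \<times> UNIV)" using assms by (simp add: C2_def)
  fix b assume "b \<in> (carrier H \<times> (UNIV :: 'x list set)) \<times> (carrier H \<times> (UNIV :: 'x list set))"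
  then show "mult2 H \<psi> (coprod_letter H d x) (Poly_Mapping.single b 1)
      \<in> {T. Poly_Mapping.keys T \<subseteq> (carrier H \<times> UNIV) \<times> (carrier H \<times> UNIV)}"
    unfolding coprod_letter_eq mult2_add
    by (intro pm.subspace_add[OF subspace_keys]) (auto simp: mult2_single split: if_splits)
qed (auto intro!: pm_lin subspace_keys)

definition cpw :: "'x list \<Rightarrow> ('h, 'x, 'k) skew2" where
  "cpw w = foldr (\<lambda>x. mult2 H \<psi> (coprod_letter H d x)) w (pm_tensor (gr \<one>) (gr \<one>))"

lemma cpw_simps: "cpw [] = Poly_Mapping.single ((\<one>, []), (\<one>, [])) 1"
  "cpw (x # w) = mult2 H \<psi> (coprod_letter H d x) (cpw w)"
  by (simp_all add: cpw_def gr_def)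

lemma cpw_C2: "cpw w \<in> C2"
  by (induction w) (simp_all add: cpw_simps C2_closed, simp add: C2_def)

text \<open>Of the two summands of the coproduct of \<open>x\<close>, one lengthens the left leg and
  the other the right leg. Functionals that see only words of length at most one therefore turn
  multiplication by it into the recursions of \<open>dLw\<close> and \<open>dRw\<close>.\<close>

lemma contract_coprod_letter:
  assumes "T \<in> C2"
  shows "contract_left (scalar_part y) (mult2 H \<psi> (coprod_letter H d x) T) =
      pm_scale (\<psi> y (d x)) (mon \<one> [x] \<cdot> contract_left (scalar_part y) T)"
    and "contract_left (linear_part y) (mult2 H \<psi> (coprod_letter H d x) T) =
      mon \<one> [x] \<cdot> contract_left (linear_part y) T + (if x = y then contract_left (scalar_part y) T else 0)"
    and "contract_right (scalar_part y) (mult2 H \<psi> (coprod_letter H d x) T) =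
      mon \<one> [x] \<cdot> contract_right (scalar_part y) T"
    and "contract_right (linear_part y) (mult2 H \<psi> (coprod_letter H d x) T) =
      mon \<one> [x] \<cdot> contract_right (linear_part y) T +
        (if x = y then mon (d y) [] \<cdot> contract_right (scalar_part y) T else 0)"
  by (cases "x = y"; rule C2_linear_eq[OF assms];
      auto intro!: pm_lin simp: coprod_letter_eq mult2_add mult2_single mon_def mul_single mult_ac
        pm_linearD[OF pm_linear_contract(1)] pm_linearD[OF pm_linear_contract(2)])+

lemma contract_cpw:
  shows "contract_left (scalar_part y) (cpw w) = pm_scale (\<psi> y (dprod w)) (mon \<one> w)"
    and "contract_left (linear_part y) (cpw w) = dLw y w"
    and "contract_right (scalar_part y) (cpw w) = mon \<one> w"
    and "contract_right (linear_part y) (cpw w) = mon (d y) [] \<cdot> dRw y w"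
proof -
  show 1: "contract_left (scalar_part y) (cpw w) = pm_scale (\<psi> y (dprod w)) (mon \<one> w)" for w
  proof (induction w)
    case (Cons x w)
    then show ?case by (simp add: cpw_simps contract_coprod_letter[OF cpw_C2] mul_right mul_mon)
  qed (simp add: cpw_simps mon_def)
  show "contract_left (linear_part y) (cpw w) = dLw y w"
    by (induction w) (simp_all add: cpw_simps contract_coprod_letter[OF cpw_C2] 1)
  show 2: "contract_right (scalar_part y) (cpw w) = mon \<one> w" for w
  proof (induction w)
    case (Cons x w)
    then show ?case by (simp add: cpw_simps contract_coprod_letter[OF cpw_C2] mul_mon)
  qed (simp add: cpw_simps mon_def)
  show "contract_right (linear_part y) (cpw w) = mon (d y) [] \<cdot> dRw y w"
  proof (induction w)
    case (Cons x w)
    have "mon \<one> [x] \<cdot> (mon (d y) [] \<cdot> dRw y w) = pm_scale (\<psi> x (d y)) (mon (d y) [] \<cdot> (mon \<one> [x] \<cdot> dRw y w))"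
      by (simp add: mul_mon mul_left flip: mul_assoc)
    with Cons show ?case by (simp add: cpw_simps contract_coprod_letter[OF cpw_C2] 2 mul_right)
  qed (simp add: cpw_simps mul_right)
qed

lemma contract_group_like:
  assumes "T \<in> C2" "h \<in> carrier H"
  shows "contract_left (linear_part y) (mult2 H \<psi> (pm_tensor (gr h) (gr h)) T) = mon h [] \<cdot> contract_left (linear_part y) T"
    and "contract_right (linear_part y) (mult2 H \<psi> (pm_tensor (gr h) (gr h)) T) = mon h [] \<cdot> contract_right (linear_part y) T"
  by (rule C2_linear_eq[OF assms(1)];
      use assms(2) in \<open>auto intro!: pm_lin simp: gr_def mult2_single mon_def mul_single\<close>)+

lemma pm_linear_coprod [pm_lin]: "pm_linear f \<Longrightarrow> pm_linear (\<lambda>x. coprod H \<psi> d (f x))"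
  unfolding coprod_def by (rule pm_lin)

lemma coprod_mon: "coprod H \<psi> d (mon h w) = mult2 H \<psi> (pm_tensor (gr h) (gr h)) (cpw w)"
  by (simp add: coprod_def mon_def lin_ext_single cpw_def)

lemma contract_coprod:
  assumes "p \<in> C"
  shows "contract_left (linear_part y) (coprod H \<psi> d p) = dL y p"
    and "contract_right (linear_part y) (coprod H \<psi> d p) = mon (d y) [] \<cdot> dR y p"
proof -
  show "contract_left (linear_part y) (coprod H \<psi> d p) = dL y p"
    by (rule sub_linear_eq[OF assms])
      (auto intro!: pm_lin simp: coprod_mon contract_group_like[OF cpw_C2] contract_cpw)
  show "contract_right (linear_part y) (coprod H \<psi> d p) = mon (d y) [] \<cdot> dR y p"
    by (rule sub_linear_eq[OF assms])
      (auto intro!: pm_lin simp: coprod_mon contract_group_like[OF cpw_C2] contract_cpw mul_mon m_comm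
        simp flip: mul_assoc)
qed

text \<open>\<open>linear_part y\<close> vanishes on \<open>J\<close>, so slicing the coideal
  condition on either side lands in \<open>J\<close>, and the slices of the coproduct are the
  derivations.\<close>

lemma hopf_ideal_derivation:
  assumes K: "subgroup K H" and J: "hopf_ideal H \<psi> d (alg K P) J"
    and deg: "J \<subseteq> Idl\<^bsub>alg K P\<^esub> {letter H x \<otimes>\<^bsub>A\<^esub> letter H x' |x x'. x \<in> P \<and> x' \<in> P}"
    and u: "u \<in> J"
  shows "dL y u \<in> J" and "d y \<in> K \<Longrightarrow> dR y u \<in> J"
proof -
  note KC = subset_C[OF subgroup.subset[OF K], of _ P]
  have J': "two_sided (sub K P) J" using J by (simp add: hopf_ideal_def ideal_alg_iff[OF K])
  \<comment> \<open>Combinations of words of length at least two form an ideal that contains all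
    products of two letters, hence contains \<open>J\<close>.\<close>
  let ?D = "{p. Poly_Mapping.keys p \<subseteq> K \<times> {w \<in> lists P. 2 \<le> length w}}"
  have "p \<cdot> q \<in> ?D \<and> q \<cdot> p \<in> ?D" if p: "p \<in> sub K P" and q: "q \<in> ?D" for p q
  proof
    have qX: "Poly_Mapping.keys q \<subseteq> K \<times> {w \<in> lists P. 2 \<le> length w}" using q by simp
    show "p \<cdot> q \<in> ?D"
    proof (rule sub_linear_mem[OF p])
      fix h w assume "h \<in> K" "w \<in> lists P"
      then show "mon h w \<cdot> q \<in> ?D"
        by (intro pm_linear_mem[OF _ _ qX, of "\<lambda>q. mon h w \<cdot> q"])
          (auto intro!: pm_lin subspace_keys simp: mon_def mul_single subgroup.m_closed[OF K] split: if_splits)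
    qed (auto intro!: pm_lin subspace_keys)
    show "q \<cdot> p \<in> ?D"
    proof (rule sub_linear_mem[OF p])
      fix h w assume "h \<in> K" "w \<in> lists P"
      then show "q \<cdot> mon h w \<in> ?D"
        by (intro pm_linear_mem[OF _ _ qX, of "\<lambda>q. q \<cdot> mon h w"])
          (auto intro!: pm_lin subspace_keys simp: mon_def mul_single subgroup.m_closed[OF K] split: if_splits)
    qed (auto intro!: pm_lin subspace_keys)
  qed
  then have "two_sided (sub K P) ?D"
    by (auto simp: two_sided_def subspace_keys) (auto simp: sub_def)
  moreover have "{letter H x \<otimes>\<^bsub>A\<^esub> letter H x' |x x'. x \<in> P \<and> x' \<in> P} \<subseteq> ?D"
    by (auto simp: letter_mon mul_mon) (auto simp: mon_def subgroup.one_closed[OF K])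
  ultimately have "J \<subseteq> ?D" using genideal_subset[OF K] deg by blast
  then have ev: "evaluate (linear_part y) p = 0" if "p \<in> J" for p
    unfolding evaluate_def using that by (intro sum.neutral) fastforce
  have uC: "u \<in> C" using two_sidedD(1)[OF J'] KC u by auto
  let ?S = "{pm_tensor a b |a b. a \<in> J \<and> b \<in> sub K P} \<union> {pm_tensor a b |a b. a \<in> sub K P \<and> b \<in> J}"
  have cu: "coprod H \<psi> d u \<in> pm_span ?S"
    using J u by (simp add: hopf_ideal_def)
  note sJ = two_sidedD(2)[OF J']
  have "contract_left (linear_part y) (coprod H \<psi> d u) \<in> J"
    by (rule pm_linear_span_mem[OF pm_linear_contract(1) sJ cu])
      (auto simp: contract_left_tensor ev pm.subspace_0[OF sJ] pm.subspace_scale[OF sJ])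
  then show "dL y u \<in> J" by (simp add: contract_coprod[OF uC])
  have "contract_right (linear_part y) (coprod H \<psi> d u) \<in> J"
    by (rule pm_linear_span_mem[OF pm_linear_contract(2) sJ cu])
      (auto simp: contract_right_tensor ev pm.subspace_0[OF sJ] pm.subspace_scale[OF sJ])
  then have *: "mon (d y) [] \<cdot> dR y u \<in> J" by (simp add: contract_coprod[OF uC])
  \<comment> \<open>The right slice comes with the group-like \<open>d y\<close> in front; it is
    cancelled by its inverse, which belongs to the algebra because
    \<open>d y \<in> K\<close>.\<close>
  assume dy: "d y \<in> K"
  have "mon (inv d y) [] \<cdot> (mon (d y) [] \<cdot> dR y u) \<in> J"
    using dy by (intro two_sidedD(3)[OF J'] * sub_mon) (auto simp: subgroup.m_inv_closed[OF K])
  moreover have "dR y u \<in> C" using d_sub(2)[OF subgroup_self uC] .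
  ultimately show "dR y u \<in> J" by (simp add: mul_mon flip: mul_assoc)
qed

end

section \<open>The bracket relations and the Verma-type representation\<close>

text \<open>The assumption \<open>cross\<close> is
  \<open>\<chi>^j(g_i) = p_ji = \<chi>^i(f_j)\<close>: the scalar in the bracket of
  \<open>x_i\<close> and \<open>x_j^-\<close> can be read off from the group-like of either letter.
  This ties the bracket to the coproduct.\<close>

locale bracket_algebra = skew_hopf H "letter_char \<psi>" "case_sum g f"
  for H :: "('h, 'm) monoid_scheme" (structure) and \<psi> :: "'i \<Rightarrow> 'h \<Rightarrow> 'k::field" and g f :: "'i \<Rightarrow> 'h" +
  assumes cross: "\<psi> j (g i) = \<psi> i (f j)"
begin

notation mul (infixl \<open>\<cdot>\<close> 75)

lemma letter_char_simps [simp]: "letter_char \<psi> (Inl i) = \<psi> i" "letter_char \<psi> (Inr i) h = inverse (\<psi> i h)"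
  by (simp_all add: letter_char_def)

lemma gf_closed [simp]: "g i \<in> carrier H" "f i \<in> carrier H"
  using d_closed[of "Inl i"] d_closed[of "Inr i"] by simp_all

lemma \<psi>_hom: "\<psi> i \<in> hom H kstar"
  using char[of "Inl i"] by simp

lemma \<psi>_simps [simp]:
  "a \<in> carrier H \<Longrightarrow> b \<in> carrier H \<Longrightarrow> \<psi> i (a \<otimes> b) = \<psi> i a * \<psi> i b"
  "a \<in> carrier H \<Longrightarrow> \<psi> i a \<noteq> 0" "\<psi> i \<one> = 1"
  using char_mult[of a b "Inl i"] char_nonzero[of a "Inl i"] char_one[of "Inl i"] by simp_all

lemma \<psi>_cancel: "h \<in> carrier H \<Longrightarrow> \<psi> i h * (inverse (\<psi> i h) * z) = z"
  by (simp flip: mult.assoc)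

lemma one_hom: "(\<lambda>_. 1) \<in> hom H kstar"
  by (simp add: hom_def kstar_def)

abbreviation X :: "'i \<Rightarrow> ('h, 'i + 'i, 'k) skew" where "X i \<equiv> mon \<one> [Inl i]"
abbreviation Y :: "'i \<Rightarrow> ('h, 'i + 'i, 'k) skew" where "Y i \<equiv> mon \<one> [Inr i]"
abbreviation E :: "'h \<Rightarrow> ('h, 'i + 'i, 'k) skew" where "E h \<equiv> mon h []"
abbreviation CX :: "('h, 'i + 'i, 'k) skew set" where "CX \<equiv> sub (carrier H) (range Inl)"
abbreviation CY :: "('h, 'i + 'i, 'k) skew set" where "CY \<equiv> sub (carrier H) (range Inr)"

definition rel :: "'i \<Rightarrow> 'i \<Rightarrow> ('h, 'i + 'i, 'k) skew" where
  "rel i j = (if i = j then mon \<one> [] - E (g i \<otimes> f i) else 0)"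

section \<open>Congruence modulo the bracket relations\<close>

definition Br :: "('h, 'i + 'i, 'k) skew set" where
  "Br = Idl\<^bsub>alg (carrier H) UNIV\<^esub> (bracket_rels H \<psi> g f)"

definition eqv :: "('h, 'i + 'i, 'k) skew \<Rightarrow> ('h, 'i + 'i, 'k) skew \<Rightarrow> bool" (infix \<open>\<approx>\<close> 50) where
  "p \<approx> q \<longleftrightarrow> p - q \<in> Br"

lemma rel_C [simp]: "rel i j \<in> C"
  by (simp add: rel_def)

lemma CXY_C [simp]: "p \<in> CX \<Longrightarrow> p \<in> C" "p \<in> CY \<Longrightarrow> p \<in> C"
  by (rule subset_C[of "carrier H"]; simp)+

lemma bracket_rels_eq:
  "bracket_rels H \<psi> g f = {X i \<cdot> Y j - (pm_scale (\<psi> i (f j)) (Y j \<cdot> X i) + rel i j) |i j. True}"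
  by (simp add: bracket_rels_def bracket_def Let_def letter_mon gr_mon rel_def algebra_simps cong: if_cong)

lemma bracket_rels_C: "bracket_rels H \<psi> g f \<subseteq> C"
  by (auto simp: bracket_rels_eq)

lemmas Br_ideal = two_sided_genideal[OF subgroup_self bracket_rels_C, folded Br_def]
lemmas Br_subspace = two_sidedD(2)[OF Br_ideal(1)]

lemma eqv_refl [simp]: "p \<approx> p"
  by (simp add: eqv_def pm.subspace_0[OF Br_subspace])

lemma eqv_trans [trans]: "p \<approx> q \<Longrightarrow> q \<approx> r \<Longrightarrow> p \<approx> r"
  using pm.subspace_add[OF Br_subspace, of "p - q" "q - r"] by (simp add: eqv_def)

lemma eqv_eq_trans [trans]: "p = q \<Longrightarrow> q \<approx> r \<Longrightarrow> p \<approx> r" "p \<approx> q \<Longrightarrow> q = r \<Longrightarrow> p \<approx> r"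
  by simp_all

lemma eqv_add: "p \<approx> q \<Longrightarrow> p' \<approx> q' \<Longrightarrow> p + p' \<approx> q + q'"
  using pm.subspace_add[OF Br_subspace, of "p - q" "p' - q'"] by (simp add: eqv_def algebra_simps)

lemma eqv_diff: "p \<approx> q \<Longrightarrow> p' \<approx> q' \<Longrightarrow> p - p' \<approx> q - q'"
  using pm.subspace_diff[OF Br_subspace, of "p - q" "p' - q'"] by (simp add: eqv_def algebra_simps)

lemma eqv_scale: "p \<approx> q \<Longrightarrow> pm_scale c p \<approx> pm_scale c q"
  using pm.subspace_scale[OF Br_subspace, of "p - q" c] by (simp add: eqv_def pm.scale_right_diff_distrib)

lemma eqv_mul_left: "r \<in> C \<Longrightarrow> p \<approx> q \<Longrightarrow> r \<cdot> p \<approx> r \<cdot> q"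
  using two_sidedD(3)[OF Br_ideal(1), of r "p - q"] by (simp add: eqv_def mul_right)

lemma eqv_mul_right: "r \<in> C \<Longrightarrow> p \<approx> q \<Longrightarrow> p \<cdot> r \<approx> q \<cdot> r"
  using two_sidedD(4)[OF Br_ideal(1), of r "p - q"] by (simp add: eqv_def mul_left)

lemma eqv_bracket: "X i \<cdot> Y j \<approx> pm_scale (\<psi> i (f j)) (Y j \<cdot> X i) + rel i j"
  unfolding eqv_def using Br_ideal(2) by (auto simp: bracket_rels_eq)

lemma eqv_linear:
  assumes "p \<in> sub K P" "pm_linear F" "pm_linear F'"
    "\<And>h w. h \<in> K \<Longrightarrow> w \<in> lists P \<Longrightarrow> F (mon h w) \<approx> F' (mon h w)"
  shows "F p \<approx> F' p"
  using sub_linear_mem[OF assms(1) pm_linear_diff[OF assms(2,3)] Br_subspace] assms(4) by (simp add: eqv_def)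

section \<open>Crossing formulas: moving a letter through elements of the opposite half\<close>

lemma mon_Cons: "mon \<one> (x # w) = mon \<one> [x] \<cdot> mon \<one> w"
  by (simp add: mul_mon)

lemma mon_E: "h \<in> carrier H \<Longrightarrow> mon h w = E h \<cdot> mon \<one> w"
  by (simp add: mul_mon)

lemma letter_E: "h \<in> carrier H \<Longrightarrow> mon \<one> [x] \<cdot> E h = pm_scale (letter_char \<psi> x h) (E h \<cdot> mon \<one> [x])"
  by (simp add: mul_mon)

lemma letter_E_assoc:
  assumes "h \<in> carrier H" "p \<in> C"
  shows "mon \<one> [x] \<cdot> (E h \<cdot> p) = pm_scale (letter_char \<psi> x h) (E h \<cdot> (mon \<one> [x] \<cdot> p))"
  using assms by (simp add: letter_E mul_left flip: mul_assoc)

lemma E_comm: "h \<in> carrier H \<Longrightarrow> k \<in> carrier H \<Longrightarrow> E h \<cdot> E k = E k \<cdot> E h"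
  by (simp add: mul_mon m_comm)

lemma \<psi>_dprod: "\<psi> i (dprod w) = (\<Prod>x\<leftarrow>w. \<psi> i (case_sum g f x))"
  by (induction w) (auto split: sum.splits)

abbreviation \<Omega> :: "'i \<Rightarrow> ('h, 'i + 'i, 'k) skew" where "\<Omega> i \<equiv> E (g i \<otimes> f i)"

lemma rel_mul: "p \<in> C \<Longrightarrow> rel i j \<cdot> p = (if i = j then p - \<Omega> i \<cdot> p else 0)"
  by (simp add: rel_def mul_left)

abbreviation twist :: "'h \<Rightarrow> ('h, 'i + 'i, 'k) skew \<Rightarrow> ('h, 'i + 'i, 'k) skew" where
  "twist h \<equiv> diag (\<lambda>_. 1) (\<lambda>x. letter_char \<psi> x h)"

lemma twist_mul: "p \<in> C \<Longrightarrow> q \<in> C \<Longrightarrow> twist h (p \<cdot> q) = twist h p \<cdot> twist h q"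
  by (rule diag_mul[OF one_hom])

text \<open>Let \<open>Y j\<close> travel to the left through \<open>w = v x_j v'\<close>. It
  collects \<open>wchar v' (f j)\<close> from \<open>v'\<close>, and the bracket at
  \<open>x_j\<close> then leaves \<open>v (1 - g_j f_j) v'\<close>. By \<open>cross\<close> the
  scalar is the weight in \<open>dLw\<close>, which accounts for the term from 1. Bringing
  \<open>g_j f_j\<close> to the front adds \<open>wchar v (g j)\<close>, the weight in
  \<open>dRw\<close>, and \<open>wchar v (f j)\<close>, which completes the twist by
  \<open>f j\<close>.\<close>

lemma word_mul_Y:
  assumes "w \<in> lists (range Inl)"
  shows "mon \<one> w \<cdot> Y j \<approx> pm_scale (wchar w (f j)) (Y j \<cdot> mon \<one> w) + dLw (Inl j) w
           - \<Omega> j \<cdot> twist (f j) (dRw (Inl j) w)"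
  using assms
proof (induction w)
  case Nil
  show ?case by (simp add: diag_linear mul_right)
next
  case (Cons x w)
  then obtain k where x: "x = Inl k" by auto
  \<comment> \<open>The scalar collected by \<open>Y j\<close> from the letters already crossed is
    the weight of the next term of \<open>dLw\<close>.\<close>
  have c: "wchar w (f j) = \<psi> j (dprod w)"
    using Cons.hyps(2) unfolding \<psi>_dprod wchar_def
    by (intro arg_cong[where f = prod_list] map_cong) (auto simp: cross)
  let ?L = "dLw (Inl j) w" and ?R = "twist (f j) (dRw (Inl j) w)"
  have C: "?L \<in> C" "?R \<in> C" by simp_all
  have "mon \<one> (x # w) \<cdot> Y j = X k \<cdot> (mon \<one> w \<cdot> Y j)"
    by (simp add: x mul_assoc mon_Cons[of _ w])
  also have "\<dots> \<approx> X k \<cdot> (pm_scale (wchar w (f j)) (Y j \<cdot> mon \<one> w) + ?L - \<Omega> j \<cdot> ?R)"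
    by (rule eqv_mul_left) (use Cons.IH in auto)
  also have "\<dots> = pm_scale (wchar w (f j)) (X k \<cdot> Y j \<cdot> mon \<one> w) + X k \<cdot> ?L
      - pm_scale (\<psi> k (g j \<otimes> f j)) (\<Omega> j \<cdot> (X k \<cdot> ?R))"
    by (simp add: mul_right mul_assoc C letter_E_assoc)
  also have "\<dots> \<approx> pm_scale (wchar w (f j)) ((pm_scale (\<psi> k (f j)) (Y j \<cdot> X k) + rel k j) \<cdot> mon \<one> w) + X k \<cdot> ?L
      - pm_scale (\<psi> k (g j \<otimes> f j)) (\<Omega> j \<cdot> (X k \<cdot> ?R))"
    by (intro eqv_diff eqv_add eqv_scale eqv_mul_right eqv_bracket) auto
  also have "\<dots> = pm_scale (wchar (x # w) (f j)) (Y j \<cdot> mon \<one> (x # w)) + dLw (Inl j) (x # w)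
           - \<Omega> j \<cdot> twist (f j) (dRw (Inl j) (x # w))"
    by (simp add: x mon_Cons[of _ w] mul_left mul_assoc rel_mul mul_right twist_mul diag_linear C
        pm.scale_right_distrib pm.scale_right_diff_distrib c mult_ac wchar_def[symmetric])
  finally show ?case .
qed

text \<open>A group element \<open>h\<close> in front of the word adds the factor of
  \<open>h Y_j = \<psi> j h * Y_j h\<close>, hence the character \<open>\<psi> j\<close> in the
  first twist. The other two terms do not move past \<open>h\<close>, apart from
  \<open>\<Omega> j\<close>, which commutes with it.\<close>

lemma mul_Y:
  assumes "u \<in> CX"
  shows "u \<cdot> Y j \<approx> Y j \<cdot> diag (\<psi> j) (\<lambda>x. letter_char \<psi> x (f j)) u + dL (Inl j) u
           - \<Omega> j \<cdot> twist (f j) (dR (Inl j) u)"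
proof (rule eqv_linear[OF assms])
  fix h and w :: "('i + 'i) list" assume h: "h \<in> carrier H" and w: "w \<in> lists (range Inl)"
  have "mon h w \<cdot> Y j = E h \<cdot> (mon \<one> w \<cdot> Y j)"
    by (simp add: mon_E[OF h, of w] mul_assoc h)
  also have "\<dots> \<approx> E h \<cdot> (pm_scale (wchar w (f j)) (Y j \<cdot> mon \<one> w) + dLw (Inl j) w
           - \<Omega> j \<cdot> twist (f j) (dRw (Inl j) w))"
    by (intro eqv_mul_left word_mul_Y w) (simp add: h)
  also have "\<dots> = pm_scale (wchar w (f j)) (E h \<cdot> (Y j \<cdot> mon \<one> w)) + E h \<cdot> dLw (Inl j) w
           - \<Omega> j \<cdot> (E h \<cdot> twist (f j) (dRw (Inl j) w))"
    by (simp add: mul_right h E_comm flip: mul_assoc)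
  also have "pm_scale (wchar w (f j)) (E h \<cdot> (Y j \<cdot> mon \<one> w)) =
      Y j \<cdot> diag (\<psi> j) (\<lambda>x. letter_char \<psi> x (f j)) (mon h w)"
    by (simp add: h mul_right mul_mon wchar_def mult_ac)
  also have "E h \<cdot> twist (f j) (dRw (Inl j) w) = twist (f j) (dR (Inl j) (mon h w))"
    by (simp add: h twist_mul)
  also have "E h \<cdot> dLw (Inl j) w = dL (Inl j) (mon h w)" by simp
  finally show "mon h w \<cdot> Y j \<approx> Y j \<cdot> diag (\<psi> j) (\<lambda>x. letter_char \<psi> x (f j)) (mon h w) + dL (Inl j) (mon h w)
           - \<Omega> j \<cdot> twist (f j) (dR (Inl j) (mon h w))" .
qed (auto intro!: pm_lin)

text \<open>The scalar that \<open>X i\<close> collects in crossing: \<open>\<psi> i h\<close> from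
  a group element and \<open>\<psi> i (f k)\<close> from a letter \<open>Inr k\<close>.\<close>

abbreviation dtwist :: "'i \<Rightarrow> ('h, 'i + 'i, 'k) skew \<Rightarrow> ('h, 'i + 'i, 'k) skew" where
  "dtwist i \<equiv> diag (\<psi> i) (\<lambda>x. \<psi> i (case_sum g f x))"

lemma dtwist_mul: "p \<in> C \<Longrightarrow> q \<in> C \<Longrightarrow> dtwist i (p \<cdot> q) = dtwist i p \<cdot> dtwist i q"
  by (rule diag_mul[OF \<psi>_hom])

text \<open>At \<open>v = v1 y_i v2\<close> the letter \<open>X i\<close> has collected
  \<open>\<psi> i (dprod v1)\<close> and leaves \<open>v1 (1 - g_i f_i) v2\<close>. The weight in
  \<open>dLw\<close> is the inverse of \<open>\<psi> i (dprod v2)\<close>, so applying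
  \<open>dtwist i\<close> to it restores this scalar. For the other term, moving
  \<open>g_i f_i\<close> to the front cancels it against \<open>wchar v1 (g i)\<close> by
  \<open>cross\<close>, leaving \<open>wchar v1 (f i)\<close>, the weight in
  \<open>dRw\<close>.\<close>

lemma X_mul_word:
  assumes "v \<in> lists (range Inr)"
  shows "X i \<cdot> mon \<one> v \<approx> dtwist i (mon \<one> v) \<cdot> X i + dtwist i (dLw (Inr i) v) - \<Omega> i \<cdot> dRw (Inr i) v"
  using assms
proof (induction v)
  case Nil
  show ?case by (simp add: diag_linear mul_right)
next
  case (Cons x v)
  then obtain k where x: "x = Inr k" by auto
  let ?v = "dtwist i (mon \<one> v)" and ?L = "dtwist i (dLw (Inr i) v)" and ?R = "dRw (Inr i) v"
  have C: "?L \<in> C" "?v \<in> C" "?R \<in> C" by simp_all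
  \<comment> \<open>The letter \<open>Inr i\<close> carries the inverse character, so its weight in
    \<open>dLw\<close> cancels the factor that \<open>dtwist i\<close> puts on the remaining
    word.\<close>
  have c: "(\<Prod>x\<leftarrow>v. \<psi> i (case_sum g f x)) * inverse (\<psi> i (dprod v)) = 1" for i
    using \<psi>_simps(2)[of "dprod v" i] by (simp flip: \<psi>_dprod del: \<psi>_simps)
  have "X i \<cdot> mon \<one> (x # v) = X i \<cdot> Y k \<cdot> mon \<one> v"
    by (simp add: x mul_assoc mon_Cons[of _ v])
  also have "\<dots> \<approx> (pm_scale (\<psi> i (f k)) (Y k \<cdot> X i) + rel i k) \<cdot> mon \<one> v"
    by (intro eqv_mul_right eqv_bracket) auto
  also have "\<dots> = pm_scale (\<psi> i (f k)) (Y k \<cdot> (X i \<cdot> mon \<one> v)) + rel i k \<cdot> mon \<one> v"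
    by (simp add: mul_left mul_assoc)
  also have "\<dots> \<approx> pm_scale (\<psi> i (f k)) (Y k \<cdot> (?v \<cdot> X i + ?L - \<Omega> i \<cdot> ?R)) + rel i k \<cdot> mon \<one> v"
    by (intro eqv_add eqv_scale eqv_mul_left eqv_refl Cons.IH) auto
  also have "\<dots> = dtwist i (mon \<one> (x # v)) \<cdot> X i + dtwist i (dLw (Inr i) (x # v)) - \<Omega> i \<cdot> dRw (Inr i) (x # v)"
    by (simp add: x mon_Cons[of _ v] rel_mul mul_left mul_right dtwist_mul diag_linear letter_E_assoc C
        pm.scale_right_distrib pm.scale_right_diff_distrib mul_assoc cross del: diag_mon)
      (auto simp: mul_left mul_right mul_assoc c \<psi>_cancel mult.commute[of _ "prod_list _"])
  finally show ?case .
qed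

text \<open>The group element in front contributes \<open>\<psi> i h\<close> to every term. In the
  last one nothing else is collected, hence a twist that is trivial on letters.\<close>

lemma X_mul:
  assumes "a \<in> CY"
  shows "X i \<cdot> a \<approx> dtwist i a \<cdot> X i + dtwist i (dL (Inr i) a) - \<Omega> i \<cdot> diag (\<psi> i) (\<lambda>_. 1) (dR (Inr i) a)"
proof (rule eqv_linear[OF assms])
  fix h and v :: "('i + 'i) list" assume h: "h \<in> carrier H" and v: "v \<in> lists (range Inr)"
  have R: "diag (\<psi> i) (\<lambda>_. 1) (dRw (Inr i) v) = dRw (Inr i) v"
    by (rule sub_linear_eq[OF dw_sub(2)[of v UNIV]]) (auto intro!: pm_lin simp: map_replicate_const)
  have "X i \<cdot> mon h v = pm_scale (\<psi> i h) (E h \<cdot> (X i \<cdot> mon \<one> v))"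
    by (simp add: mon_E[OF h, of v] h letter_E_assoc)
  also have "\<dots> \<approx> pm_scale (\<psi> i h) (E h \<cdot>
      (dtwist i (mon \<one> v) \<cdot> X i + dtwist i (dLw (Inr i) v) - \<Omega> i \<cdot> dRw (Inr i) v))"
    by (intro eqv_scale eqv_mul_left X_mul_word v) (simp add: h)
  also have "\<dots> = pm_scale (\<psi> i h) (E h \<cdot> dtwist i (mon \<one> v) \<cdot> X i + E h \<cdot> dtwist i (dLw (Inr i) v)
      - \<Omega> i \<cdot> (E h \<cdot> dRw (Inr i) v))"
    by (simp add: mul_right h E_comm del: diag_mon flip: mul_assoc)
  also have "\<dots> = dtwist i (mon h v) \<cdot> X i + dtwist i (dL (Inr i) (mon h v))
      - \<Omega> i \<cdot> diag (\<psi> i) (\<lambda>_. 1) (dR (Inr i) (mon h v))"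
    by (simp add: h dtwist_mul diag_mul[OF \<psi>_hom] R mul_left mul_right mul_mon
        pm.scale_right_distrib pm.scale_right_diff_distrib mult_ac)
  finally show "X i \<cdot> mon h v \<approx> dtwist i (mon h v) \<cdot> X i + dtwist i (dL (Inr i) (mon h v))
      - \<Omega> i \<cdot> diag (\<psi> i) (\<lambda>_. 1) (dR (Inr i) (mon h v))" .
qed (auto intro!: pm_lin)

text \<open>
  The letters \<open>Inr j\<close> act by left multiplication, and \<open>Inl i\<close> is commuted to the right past the leading
  letters \<open>Inr j\<close> by the bracket relations. On words in which all \<open>Inr\<close> precede all \<open>Inl\<close> this is the
  left regular representation of the algebra defined by the bracket relations.
\<close>

primrec Lw :: "'i \<Rightarrow> ('i + 'i) list \<Rightarrow> ('h, 'i + 'i, 'k) skew" where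
  "Lw i [] = X i"
| "Lw i (x # u) = (case x of Inl j \<Rightarrow> mon \<one> (Inl i # Inl j # u)
     | Inr j \<Rightarrow> pm_scale (\<psi> i (f j)) (Y j \<cdot> Lw i u) + rel i j \<cdot> mon \<one> u)"

definition act :: "'i + 'i \<Rightarrow> ('h, 'i + 'i, 'k) skew \<Rightarrow> ('h, 'i + 'i, 'k) skew" where
  "act x = (case x of Inl i \<Rightarrow> lin_ext (\<lambda>(h, u). pm_scale (\<psi> i h) (E h \<cdot> Lw i u)) | Inr j \<Rightarrow> (\<lambda>m. Y j \<cdot> m))"

text \<open>The operator by which \<open>p\<close> acts; applied to the unit it computes the normal
  form of \<open>p\<close>.\<close>

definition rho :: "('h, 'i + 'i, 'k) skew \<Rightarrow> ('h, 'i + 'i, 'k) skew \<Rightarrow> ('h, 'i + 'i, 'k) skew" where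
  "rho p m = lin_ext (\<lambda>(h, w). E h \<cdot> foldr act w m) p"

lemma pm_linear_act: "pm_linear (act x)"
  by (cases x) (auto intro!: pm_lin simp: act_def pm_linear_lin_ext)

lemmas pm_linear_act' [pm_lin] = pm_linear_comp[OF pm_linear_act]
lemmas act_linear = pm_linearD[OF pm_linear_act]

lemma act_Inr [simp]: "act (Inr j) m = Y j \<cdot> m"
  by (simp add: act_def)

lemma act_Inl_mon [simp]: "act (Inl i) (mon h u) = pm_scale (\<psi> i h) (E h \<cdot> Lw i u)"
  by (simp add: act_def mon_def lin_ext_single)

lemma pm_linear_foldr_act [pm_lin]: "pm_linear F \<Longrightarrow> pm_linear (\<lambda>m. foldr act w (F m))"
  by (induction w) (auto intro: pm_lin)

lemma pm_linear_rho_left [pm_lin]: "pm_linear F \<Longrightarrow> pm_linear (\<lambda>p. rho (F p) m)"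
  by (simp add: rho_def pm_linear_lin_ext')

lemma pm_linear_rho_right [pm_lin]: "pm_linear F \<Longrightarrow> pm_linear (\<lambda>m. rho p (F m))"
  unfolding rho_def lin_ext_def case_prod_beta by (intro pm_lin)

lemmas rho_left = pm_linearD[OF pm_linear_rho_left[OF pm_linear_ident]]
lemmas rho_right = pm_linearD[OF pm_linear_rho_right[OF pm_linear_ident]]

lemma rho_mon: "rho (mon h w) m = E h \<cdot> foldr act w m"
  by (simp add: rho_def mon_def lin_ext_single)

section \<open>The action is a representation that kills the bracket relations\<close>

lemma Lw_C [simp]: "Lw i u \<in> C"
  by (induction u) (auto split: sum.splits)

lemma act_C [simp]: "m \<in> C \<Longrightarrow> act x m \<in> C"
  by (cases x; erule sub_linear_mem) (auto intro!: pm_lin)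

lemma foldr_act_C [simp]: "m \<in> C \<Longrightarrow> foldr act w m \<in> C"
  by (induction w) auto

lemma rho_C [simp]: "p \<in> C \<Longrightarrow> m \<in> C \<Longrightarrow> rho p m \<in> C"
  by (rule sub_linear_mem[of p]) (auto intro!: pm_lin simp: rho_mon)

text \<open>Matches the relation \<open>x h = \<psi>_x(h) h x\<close> of the skew group algebra; it
  is the only input for multiplicativity of \<open>rho\<close>, as words act letter by
  letter.\<close>

lemma act_E:
  assumes "m \<in> C" "h \<in> carrier H"
  shows "act x (E h \<cdot> m) = pm_scale (letter_char \<psi> x h) (E h \<cdot> act x m)"
proof (cases x)
  case (Inl i)
  show ?thesis unfolding Inl
  proof (rule sub_linear_eq[OF assms(1)])
    fix k u assume k: "k \<in> carrier H"
    have "E h \<cdot> mon k u = mon (h \<otimes> k) u" by (simp add: mul_mon)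
    moreover have "E (h \<otimes> k) = E h \<cdot> E k" by (simp add: mul_mon)
    ultimately show "act (Inl i) (E h \<cdot> mon k u) = pm_scale (letter_char \<psi> (Inl i) h) (E h \<cdot> act (Inl i) (mon k u))"
      using assms(2) k by (simp add: mul_right mul_assoc)
  qed (auto intro!: pm_lin)
next
  case (Inr j)
  then show ?thesis using assms by (simp add: letter_E_assoc)
qed

lemma foldr_act_E:
  "m \<in> C \<Longrightarrow> h \<in> carrier H \<Longrightarrow> foldr act w (E h \<cdot> m) = pm_scale (wchar w h) (E h \<cdot> foldr act w m)"
  by (induction w) (simp_all add: act_linear act_E mult_ac)

lemma rho_mul:
  assumes "p \<in> C" "q \<in> C" "m \<in> C"
  shows "rho (p \<cdot> q) m = rho p (rho q m)"
proof (rule sub_linear_eq[OF assms(1)])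
  fix k v assume k: "k \<in> carrier H"
  show "rho (mon k v \<cdot> q) m = rho (mon k v) (rho q m)"
  proof (rule sub_linear_eq[OF assms(2)])
    fix h w assume h: "h \<in> carrier H"
    have "E (k \<otimes> h) = E k \<cdot> E h" by (simp add: mul_mon)
    then show "rho (mon k v \<cdot> mon h w) m = rho (mon k v) (rho (mon h w) m)"
      using assms(3) h k by (simp add: mul_mon[of k v h w] rho_left rho_mon foldr_act_E mul_right mul_assoc)
  qed (auto intro!: pm_lin)
qed (auto intro!: pm_lin)

lemma rho_letter: "m \<in> C \<Longrightarrow> rho (mon \<one> [x]) m = act x m"
  by (simp add: rho_mon)

lemma rho_E: "rho (E h) m = E h \<cdot> m"
  by (simp add: rho_mon)

text \<open>Valid on every word, normal or not: the \<open>Inr\<close> case of \<open>Lw\<close> is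
  the bracket relation solved for \<open>x_i x_j^-\<close>, and the remaining factors are moved past
  the group element.\<close>

lemma act_bracket:
  assumes "m \<in> C"
  shows "act (Inl i) (Y j \<cdot> m) = pm_scale (\<psi> i (f j)) (Y j \<cdot> act (Inl i) m) + rel i j \<cdot> m"
proof (rule sub_linear_eq[OF assms])
  fix h u assume h: "h \<in> carrier H"
  have 1: "Y j \<cdot> mon h u = pm_scale (inverse (\<psi> j h)) (mon h (Inr j # u))"
    using h by (simp add: mul_mon)
  have 2: "E h \<cdot> (rel i j \<cdot> mon \<one> u) = rel i j \<cdot> mon h u"
    using h by (simp add: rel_def mul_left mul_right mon_E[OF h, of u] E_comm flip: mul_assoc)
  \<comment> \<open>The correction term exists only for \<open>i = j\<close>, where the two opposite
    characters cancel.\<close>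
  have 3: "pm_scale (\<psi> i h * inverse (\<psi> j h)) (rel i j \<cdot> mon h u) = rel i j \<cdot> mon h u"
    using h by (simp add: rel_def mul_left)
  show "act (Inl i) (Y j \<cdot> mon h u) = pm_scale (\<psi> i (f j)) (Y j \<cdot> act (Inl i) (mon h u)) + rel i j \<cdot> mon h u"
    using h by (simp add: 1 act_linear mul_right letter_E_assoc pm.scale_right_distrib 2 3 mult_ac)
qed (auto intro!: pm_lin)

text \<open>The annihilator of the module is a two-sided ideal, \<open>rho\<close> being
  multiplicative, and it contains the bracket relators.\<close>

lemma rho_Br:
  assumes "p \<in> Br" "m \<in> C"
  shows "rho p m = 0"
proof -
  have "two_sided C {p \<in> C. \<forall>m\<in>C. rho p m = 0}"
    by (auto simp: two_sided_def rho_left rho_right rho_mul intro!: pm.subspaceI)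
  moreover have "rho (X i \<cdot> Y j - (pm_scale (\<psi> i (f j)) (Y j \<cdot> X i) + rel i j)) m = 0" if "m \<in> C" for i j m
  proof -
    have "rho (rel i j) m = rel i j \<cdot> m" using that by (simp add: rel_def rho_left rho_E mul_left)
    then show ?thesis using that by (simp add: rho_left rho_mul rho_letter act_bracket)
  qed
  ultimately have "Br \<subseteq> {p \<in> C. \<forall>m\<in>C. rho p m = 0}"
    unfolding Br_def by (intro genideal_subset[OF subgroup_self]) (auto simp: bracket_rels_eq)
  then show ?thesis using assms by auto
qed

text \<open>Turns the crossing formulas, which are only congruences, into equalities of
  operators.\<close>

lemma rho_eqv: "p \<approx> q \<Longrightarrow> m \<in> C \<Longrightarrow> rho p m = rho q m"
  using rho_Br[of "p - q" m] by (simp add: eqv_def rho_left)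

section \<open>The action compared with left multiplication\<close>

lemma Lw_eqv: "Lw i u \<approx> X i \<cdot> mon \<one> u"
proof (induction u)
  case (Cons x u)
  show ?case
  proof (cases x)
    case (Inl j)
    then show ?thesis by (simp add: mul_mon)
  next
    case (Inr j)
    have "Lw i (x # u) \<approx> pm_scale (\<psi> i (f j)) (Y j \<cdot> (X i \<cdot> mon \<one> u)) + rel i j \<cdot> mon \<one> u"
      unfolding Inr using Cons.IH by (auto intro!: eqv_add eqv_scale eqv_mul_left)
    also have "\<dots> = (pm_scale (\<psi> i (f j)) (Y j \<cdot> X i) + rel i j) \<cdot> mon \<one> u"
      by (simp add: mul_left mul_assoc)
    also have "\<dots> \<approx> X i \<cdot> Y j \<cdot> mon \<one> u"
      using eqv_scale[OF eqv_mul_right[OF _ eqv_bracket[of i j]], of "mon \<one> u" "-1"]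
      by (simp add: eqv_def pm.scale_minus_left algebra_simps)
    also have "\<dots> = X i \<cdot> mon \<one> (x # u)" by (simp add: Inr mon_Cons[of _ u] mul_assoc)
    finally show ?thesis .
  qed
qed simp

lemma act_eqv:
  assumes "m \<in> C"
  shows "act x m \<approx> mon \<one> [x] \<cdot> m"
proof (cases x)
  case (Inl i)
  show ?thesis unfolding Inl
  proof (rule eqv_linear[OF assms])
    fix h u assume h: "h \<in> carrier H"
    have "act (Inl i) (mon h u) \<approx> pm_scale (\<psi> i h) (E h \<cdot> (X i \<cdot> mon \<one> u))"
      using h by (auto intro!: eqv_scale eqv_mul_left Lw_eqv)
    also have "\<dots> = X i \<cdot> mon h u" using h by (simp add: mon_E[OF h, of u] letter_E_assoc)
    finally show "act (Inl i) (mon h u) \<approx> X i \<cdot> mon h u" .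
  qed (auto intro!: pm_lin)
qed simp

lemma foldr_act_eqv: "m \<in> C \<Longrightarrow> foldr act w m \<approx> mon \<one> w \<cdot> m"
proof (induction w)
  case (Cons x w)
  have "foldr act (x # w) m \<approx> mon \<one> [x] \<cdot> foldr act w m" using act_eqv Cons.prems by simp
  also have "\<dots> \<approx> mon \<one> [x] \<cdot> (mon \<one> w \<cdot> m)" using Cons by (intro eqv_mul_left) auto
  also have "\<dots> = mon \<one> (x # w) \<cdot> m" using Cons.prems by (simp add: mon_Cons[of _ w] mul_assoc)
  finally show ?case .
qed simp

text \<open>With \<open>m\<close> the unit: reducing an element to normal form does not change its
  class.\<close>

lemma rho_eqv_mul:
  assumes "p \<in> C" "m \<in> C"
  shows "rho p m \<approx> p \<cdot> m"
proof (rule eqv_linear[OF assms(1)])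
  fix h w assume h: "h \<in> carrier H"
  have "rho (mon h w) m \<approx> E h \<cdot> (mon \<one> w \<cdot> m)"
    unfolding rho_mon using h assms(2) by (intro eqv_mul_left foldr_act_eqv) auto
  also have "\<dots> = mon h w \<cdot> m" using h assms(2) by (simp add: mon_E[OF h, of w] mul_assoc)
  finally show "rho (mon h w) m \<approx> mon h w \<cdot> m" .
qed (auto intro!: pm_lin)

text \<open>The letters \<open>Inr\<close> act by left multiplication, so nothing is
  reordered.\<close>

lemma rho_CY:
  assumes "p \<in> CY" "m \<in> C"
  shows "rho p m = p \<cdot> m"
proof (rule sub_linear_eq[OF assms(1)])
  fix h and w :: "('i + 'i) list" assume h: "h \<in> carrier H" and "w \<in> lists (range Inr)"
  from this(2) have "foldr act w m = mon \<one> w \<cdot> m"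
    using assms(2)
  proof (induction w)
    case (Cons x w)
    then obtain j where "x = Inr j" by auto
    with Cons show ?case by (simp add: mon_Cons[of _ w] mul_assoc)
  qed simp
  then show "rho (mon h w) m = mon h w \<cdot> m"
    unfolding rho_mon using h assms(2) by (simp add: mon_E[OF h, of w] mul_assoc)
qed (auto intro!: pm_lin)

lemma act_CX:
  assumes "m \<in> CX"
  shows "act (Inl i) m = X i \<cdot> m"
proof (rule sub_linear_eq[OF assms])
  fix h and w :: "('i + 'i) list" assume h: "h \<in> carrier H" and "w \<in> lists (range Inl)"
  from this(2) have "Lw i w = mon \<one> (Inl i # w)" by (cases w) auto
  then show "act (Inl i) (mon h w) = X i \<cdot> mon h w" using h by (simp add: mul_mon)
qed (auto intro!: pm_lin)

lemma CXY_mul [simp]: "p \<in> CX \<Longrightarrow> q \<in> CX \<Longrightarrow> p \<cdot> q \<in> CX" "p \<in> CY \<Longrightarrow> q \<in> CY \<Longrightarrow> p \<cdot> q \<in> CY"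
  by (rule sub_mul; simp)+

lemma CXY_mon [simp]: "X i \<in> CX" "Y i \<in> CY" "h \<in> carrier H \<Longrightarrow> E h \<in> sub (carrier H) P"
  by (simp_all add: sub_mon)

lemma rho_CX:
  assumes "p \<in> CX" "m \<in> CX"
  shows "rho p m = p \<cdot> m"
proof (rule sub_linear_eq[OF assms(1)])
  fix h and w :: "('i + 'i) list" assume h: "h \<in> carrier H" and "w \<in> lists (range Inl)"
  from this(2) have "foldr act w m = mon \<one> w \<cdot> m \<and> mon \<one> w \<cdot> m \<in> CX"
    using assms(2)
  proof (induction w)
    case (Cons x w)
    then obtain i where "x = Inl i" by auto
    with Cons show ?case by (simp add: act_CX mon_Cons[of _ w] mul_assoc)
  qed simp
  then show "rho (mon h w) m = mon h w \<cdot> m"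
    unfolding rho_mon using h assms(2) by (simp add: mon_E[OF h, of w] mul_assoc)
qed (auto intro!: pm_lin)

end

section \<open>The triangular decomposition\<close>

text \<open>Retains from the Hopf ideals only stability under diagonal automorphisms and under both
  derivations. \<open>KG\<close> and \<open>KF\<close> are the copies of the two groups inside
  \<open>H\<close>, and \<open>U\<close> and \<open>V\<close> generate the ideals.\<close>

locale triangular = bracket_algebra H \<psi> g f
  for H :: "('h, 'm) monoid_scheme" (structure) and \<psi> :: "'i \<Rightarrow> 'h \<Rightarrow> 'k::field" and g f :: "'i \<Rightarrow> 'h" +
  fixes KG KF :: "'h set" and J Jm U V :: "('h, 'i + 'i, 'k) skew set"
  assumes KG: "subgroup KG H" and KF: "subgroup KF H"
    and U: "U \<subseteq> sub KG (range Inl)" and J_eq: "J = Idl\<^bsub>alg KG (range Inl)\<^esub> U"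
    and V: "V \<subseteq> sub KF (range Inr)" and Jm_eq: "Jm = Idl\<^bsub>alg KF (range Inr)\<^esub> V"
    and J_diag: "\<kappa> \<in> hom H kstar \<Longrightarrow> u \<in> J \<Longrightarrow> diag \<kappa> c u \<in> J"
    and Jm_diag: "\<kappa> \<in> hom H kstar \<Longrightarrow> u \<in> Jm \<Longrightarrow> diag \<kappa> c u \<in> Jm"
    and J_d: "u \<in> J \<Longrightarrow> dL (Inl i) u \<in> J" "u \<in> J \<Longrightarrow> dR (Inl i) u \<in> J"
    and Jm_d: "u \<in> Jm \<Longrightarrow> dL (Inr i) u \<in> Jm" "u \<in> Jm \<Longrightarrow> dR (Inr i) u \<in> Jm"
begin

notation mul (infixl \<open>\<cdot>\<close> 75)
notation eqv (infix \<open>\<approx>\<close> 50)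

abbreviation GX :: "('h, 'i + 'i, 'k) skew set" where "GX \<equiv> sub KG (range Inl)"
abbreviation FX :: "('h, 'i + 'i, 'k) skew set" where "FX \<equiv> sub KF (range Inr)"
abbreviation kH :: "('h, 'i + 'i, 'k) skew set" where "kH \<equiv> sub (carrier H) {}"

lemmas J_ideal = two_sided_genideal[OF KG U, folded J_eq]
lemmas Jm_ideal = two_sided_genideal[OF KF V, folded Jm_eq]
lemmas J_subspace = two_sidedD(2)[OF J_ideal(1)]
lemmas Jm_subspace = two_sidedD(2)[OF Jm_ideal(1)]

lemma K_mem: "h \<in> KG \<Longrightarrow> h \<in> carrier H" "h \<in> KF \<Longrightarrow> h \<in> carrier H" "\<one> \<in> KG" "\<one> \<in> KF"
  using subgroup.subset[OF KG] subgroup.subset[OF KF] subgroup.one_closed[OF KG] subgroup.one_closed[OF KF] by auto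

lemma GX_CX [simp]: "p \<in> GX \<Longrightarrow> p \<in> CX" and FX_CY [simp]: "p \<in> FX \<Longrightarrow> p \<in> CY"
  using sub_mono[OF subgroup.subset[OF KG] order_refl[of "range Inl"]]
    sub_mono[OF subgroup.subset[OF KF] order_refl[of "range Inr"]] by auto

lemma J_GX: "p \<in> J \<Longrightarrow> p \<in> GX" and Jm_FX: "p \<in> Jm \<Longrightarrow> p \<in> FX"
  using two_sidedD(1)[OF J_ideal(1)] two_sidedD(1)[OF Jm_ideal(1)] by auto

lemma kH_C [simp]: "p \<in> kH \<Longrightarrow> p \<in> C" and kH_CX [simp]: "p \<in> kH \<Longrightarrow> p \<in> CX" and kH_CY [simp]: "p \<in> kH \<Longrightarrow> p \<in> CY"
  using sub_mono[OF order_refl[of "carrier H"]] by blast+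

lemma J_C [simp]: "p \<in> J \<Longrightarrow> p \<in> C" and Jm_C [simp]: "p \<in> Jm \<Longrightarrow> p \<in> C"
  using J_GX Jm_FX by auto

lemma GX_mul: "p \<in> GX \<Longrightarrow> q \<in> GX \<Longrightarrow> p \<cdot> q \<in> GX" and FX_mul: "p \<in> FX \<Longrightarrow> q \<in> FX \<Longrightarrow> p \<cdot> q \<in> FX"
  by (rule sub_mul; simp add: subgroup.m_closed[OF KG] subgroup.m_closed[OF KF])+

lemma XY_mem: "X i \<in> GX" "Y i \<in> FX" "E \<one> \<in> GX" "E \<one> \<in> FX"
  by (simp_all add: sub_mon K_mem)

section \<open>Submodules spanned by products in normal order\<close>

definition tri :: "('h, 'i + 'i, 'k) skew set \<Rightarrow> ('h, 'i + 'i, 'k) skew set \<Rightarrow> ('h, 'i + 'i, 'k) skew set" where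
  "tri S T = {a \<cdot> E h \<cdot> c |a h c. a \<in> S \<and> h \<in> carrier H \<and> c \<in> T}"

lemma triI: "a \<in> S \<Longrightarrow> h \<in> carrier H \<Longrightarrow> c \<in> T \<Longrightarrow> a \<cdot> E h \<cdot> c \<in> tri S T"
  by (auto simp: tri_def)

lemma E_mul_diag:
  assumes "a \<in> C" "k \<in> carrier H"
  shows "E k \<cdot> a = diag (\<lambda>_. 1) (\<lambda>x. inverse (letter_char \<psi> x k)) a \<cdot> E k"
proof (rule sub_linear_eq[OF assms(1)])
  fix h w assume h: "h \<in> carrier H"
  show "E k \<cdot> mon h w = diag (\<lambda>_. 1) (\<lambda>x. inverse (letter_char \<psi> x k)) (mon h w) \<cdot> E k"
    using h assms(2) by (simp add: mul_left mul_mon m_comm inverse_wchar)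
qed (auto intro!: pm_lin)

lemma mul_E_twist:
  assumes "u \<in> C" "h \<in> carrier H"
  shows "u \<cdot> E h = E h \<cdot> twist h u"
proof (rule sub_linear_eq[OF assms(1)])
  fix k w assume "k \<in> carrier H"
  then show "mon k w \<cdot> E h = E h \<cdot> twist h (mon k w)"
    using assms(2) by (simp add: mul_mon mul_right m_comm wchar_def)
qed (auto intro!: pm_lin)

text \<open>Proved once for the three pairs \<open>FX, GX\<close> and \<open>Jm, GX\<close> and
  \<open>FX, J\<close>. Crossing \<open>a\<close> with \<open>X i\<close> gives a twist of
  \<open>a\<close> followed by \<open>X i\<close>, and two terms with a derivative of
  \<open>a\<close> in its place. So \<open>S\<close> must be stable under twists and derivations,
  whereas \<open>T\<close> only has to absorb \<open>X i\<close> from the left.\<close>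

lemma tri_stable:
  assumes S: "S \<subseteq> CY" "\<And>j a. a \<in> S \<Longrightarrow> Y j \<cdot> a \<in> S"
      "\<And>\<kappa> c a. \<kappa> \<in> hom H kstar \<Longrightarrow> a \<in> S \<Longrightarrow> diag \<kappa> c a \<in> S"
      "\<And>i a. a \<in> S \<Longrightarrow> dL (Inr i) a \<in> S" "\<And>i a. a \<in> S \<Longrightarrow> dR (Inr i) a \<in> S"
    and T: "T \<subseteq> CX" "\<And>i c. c \<in> T \<Longrightarrow> X i \<cdot> c \<in> T"
    and m: "m \<in> tri S T"
  shows "k \<in> carrier H \<Longrightarrow> E k \<cdot> m \<in> tri S T" and "act x m \<in> pm_span (tri S T)"
proof -
  have Ek: "E k \<cdot> m \<in> tri S T" if "k \<in> carrier H" "m \<in> tri S T" for k m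
  proof -
    from that(2) obtain a h c where m: "a \<in> S" "h \<in> carrier H" "c \<in> T" "m = a \<cdot> E h \<cdot> c"
      by (auto simp: tri_def)
    have C: "a \<in> C" "c \<in> C" using m S(1) T(1) by auto
    let ?a = "diag (\<lambda>_. 1) (\<lambda>x. inverse (letter_char \<psi> x k)) a"
    have "E k \<cdot> m = E k \<cdot> a \<cdot> E h \<cdot> c" using C that m by (simp add: mul_assoc)
    also have "\<dots> = ?a \<cdot> (E k \<cdot> E h) \<cdot> c"
      unfolding E_mul_diag[OF C(1) that(1)] using C that m(2) by (simp add: mul_assoc)
    also have "\<dots> = ?a \<cdot> E (k \<otimes> h) \<cdot> c" by (simp add: mul_mon)
    finally show ?thesis using m that by (auto intro!: triI S(3) one_hom)
  qed
  then show "k \<in> carrier H \<Longrightarrow> E k \<cdot> m \<in> tri S T" using m by blast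
  from m obtain a h c where m: "a \<in> S" "h \<in> carrier H" "c \<in> T" "m = a \<cdot> E h \<cdot> c"
    by (auto simp: tri_def)
  let ?n = "E h \<cdot> c"
  have aY: "a \<in> CY" and cX: "c \<in> CX" using m S(1) T(1) by auto
  have C: "a \<in> C" "c \<in> C" using aY cX by auto
  have nX: "?n \<in> CX" using m cX by simp
  show "act x m \<in> pm_span (tri S T)"
  proof (cases x)
    case (Inr j)
    have "act x m = Y j \<cdot> a \<cdot> E h \<cdot> c" using C m by (simp add: Inr mul_assoc)
    then show ?thesis using m by (auto intro!: pm.span_base triI S(2))
  next
    case (Inl i)
    let ?R = "diag (\<psi> i) (\<lambda>_. 1) (dR (Inr i) a)" and ?L = "dtwist i (dL (Inr i) a)"
    have sub: "dtwist i a \<in> S" "?L \<in> S" "?R \<in> S" using m(1) by (auto intro!: S \<psi>_hom)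
    then have CY: "dtwist i a \<in> CY" "?L \<in> CY" "?R \<in> CY" using S(1) by blast+
    have Xn: "X i \<cdot> ?n = pm_scale (\<psi> i h) (E h \<cdot> (X i \<cdot> c))"
      using m C by (simp add: letter_E_assoc)
    \<comment> \<open>Rewritten through \<open>rho\<close> so that the crossing formula for
      \<open>X i\<close> and \<open>a\<close> applies as an equality.\<close>
    have "act x m = rho (X i) (rho a ?n)"
      using C m nX aY by (simp add: Inl rho_letter rho_CY mul_assoc)
    also have "\<dots> = rho (X i \<cdot> a) ?n" using C nX by (simp add: rho_mul)
    also have "\<dots> = rho (dtwist i a \<cdot> X i + ?L - \<Omega> i \<cdot> ?R) ?n"
      by (rule rho_eqv[OF X_mul[OF aY]]) (use nX in simp)
    also have "\<dots> = dtwist i a \<cdot> (X i \<cdot> ?n) + ?L \<cdot> ?n - \<Omega> i \<cdot> (?R \<cdot> ?n)"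
      using CY nX by (simp add: rho_left rho_mul rho_E rho_CY rho_CX mul_assoc)
    also have "\<dots> = pm_scale (\<psi> i h) (dtwist i a \<cdot> E h \<cdot> (X i \<cdot> c)) + ?L \<cdot> E h \<cdot> c - \<Omega> i \<cdot> (?R \<cdot> E h \<cdot> c)"
      unfolding Xn using CY C m by (simp add: mul_right mul_assoc)
    also have "\<dots> \<in> pm_span (tri S T)"
      using sub m by (intro pm.span_diff pm.span_add pm.span_scale pm.span_base Ek triI T(2)) auto
    finally show ?thesis .
  qed
qed

lemma span_rho_stable:
  assumes Q: "Q \<subseteq> C" "\<And>b k. b \<in> Q \<Longrightarrow> k \<in> carrier H \<Longrightarrow> E k \<cdot> b \<in> pm_span Q" "\<And>b x. b \<in> Q \<Longrightarrow> act x b \<in> pm_span Q"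
    and p: "p \<in> C" and m: "m \<in> pm_span Q"
  shows "rho p m \<in> pm_span Q"
proof (rule sub_linear_mem[OF p])
  fix h w assume h: "h \<in> carrier H"
  have "foldr act w m \<in> pm_span Q"
    by (induction w) (auto intro: m pm_linear_span_mem[OF pm_linear_act] Q(3))
  then have "E h \<cdot> foldr act w m \<in> pm_span Q"
    by (rule pm_linear_span_mem[rotated 2]) (auto intro!: pm_lin Q(2) h)
  then show "rho (mon h w) m \<in> pm_span Q" by (simp add: rho_mon)
qed (auto intro!: pm_lin)

abbreviation nrm :: "('h, 'i + 'i, 'k) skew set" where
  "nrm \<equiv> pm_span (tri FX GX)"

abbreviation ker :: "('h, 'i + 'i, 'k) skew set" where
  "ker \<equiv> pm_span (tri Jm GX \<union> tri FX J)"

lemma tri_C: "S \<subseteq> C \<Longrightarrow> T \<subseteq> C \<Longrightarrow> tri S T \<subseteq> C"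
  by (auto simp: tri_def subset_iff)

lemma nrm_C [simp]: "m \<in> nrm \<Longrightarrow> m \<in> C"
  using pm.span_minimal[OF tri_C subspace_sub, of FX GX] by (auto simp: subset_iff)

lemma tri_stable_nrm:
  assumes "m \<in> tri FX GX"
  shows "k \<in> carrier H \<Longrightarrow> E k \<cdot> m \<in> tri FX GX" and "act x m \<in> pm_span (tri FX GX)"
  by (rule tri_stable[OF _ _ _ _ _ _ _ assms]; simp add: subset_iff FX_mul GX_mul XY_mem d_sub[OF KF])+

lemma tri_stable_ker:
  shows "m \<in> tri Jm GX \<Longrightarrow> k \<in> carrier H \<Longrightarrow> E k \<cdot> m \<in> tri Jm GX"
    and "m \<in> tri Jm GX \<Longrightarrow> act x m \<in> pm_span (tri Jm GX)"
    and "m \<in> tri FX J \<Longrightarrow> k \<in> carrier H \<Longrightarrow> E k \<cdot> m \<in> tri FX J"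
    and "m \<in> tri FX J \<Longrightarrow> act x m \<in> pm_span (tri FX J)"
  by (rule tri_stable; assumption?; simp add: subset_iff FX_mul GX_mul XY_mem d_sub[OF KF] J_GX Jm_FX
      Jm_diag Jm_d two_sidedD(3)[OF Jm_ideal(1)] two_sidedD(3)[OF J_ideal(1)])+

lemma nrm_stable: "p \<in> C \<Longrightarrow> m \<in> nrm \<Longrightarrow> rho p m \<in> nrm"
  by (rule span_rho_stable) (simp_all add: tri_C subset_iff pm.span_base tri_stable_nrm)

lemma ker_stable: "p \<in> C \<Longrightarrow> m \<in> ker \<Longrightarrow> rho p m \<in> ker"
proof (rule span_rho_stable)
  show "act x b \<in> ker" if "b \<in> tri Jm GX \<union> tri FX J" for b x
    using that tri_stable_ker(2)[of b x] tri_stable_ker(4)[of b x]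
      pm.span_mono[of "tri Jm GX" "tri Jm GX \<union> tri FX J"] pm.span_mono[of "tri FX J" "tri Jm GX \<union> tri FX J"] by auto
  show "E k \<cdot> b \<in> ker" if "b \<in> tri Jm GX \<union> tri FX J" "k \<in> carrier H" for b k
    using that tri_stable_ker(1,3)[of b k] by (auto intro: pm.span_base)
  show "tri Jm GX \<union> tri FX J \<subseteq> C"
    using tri_C[of Jm GX] tri_C[of FX J] by (simp add: subset_iff)
qed

text \<open>The element \<open>u\<close> is carried through the left factor letter by letter. Each
  crossing replaces it by twists of \<open>u\<close> and of its derivatives, so the induction must
  run over all elements of \<open>J\<close> at once. Letters left in front of it are harmless by
  \<open>ker_stable\<close>.\<close>

lemma rho_J:
  assumes "u \<in> J" "m \<in> nrm"
  shows "rho u m \<in> ker"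
proof -
  note sp = pm.subspace_span[of "tri Jm GX \<union> tri FX J"]
  \<comment> \<open>Once \<open>u\<close> has passed the letters \<open>Inr\<close>, it crosses
    \<open>h\<close> at the cost of a twist and is absorbed by \<open>c\<close>, as \<open>J\<close>
    is an ideal.\<close>
  have base: "rho u (E h \<cdot> c) \<in> ker" if "u \<in> J" "h \<in> carrier H" "c \<in> GX" for u h c
  proof -
    have "rho u (E h \<cdot> c) = u \<cdot> E h \<cdot> c"
      using that J_GX by (simp add: rho_CX mul_assoc)
    also have "u \<cdot> E h = E h \<cdot> twist h u"
    using that by (intro mul_E_twist) auto
    also have "E h \<cdot> twist h u \<cdot> c = E \<one> \<cdot> E h \<cdot> (twist h u \<cdot> c)"
      using that by (simp add: mul_assoc)
    also have "\<dots> \<in> ker"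
      using that by (intro pm.span_base UnI2 triI XY_mem two_sidedD(4)[OF J_ideal(1)] J_diag one_hom) auto
    finally show ?thesis .
  qed
  have EY: "\<forall>u\<in>J. rho u (E h \<cdot> n) \<in> ker" if "\<forall>u\<in>J. rho u n \<in> ker" "h \<in> carrier H" "n \<in> C" for h n
  proof
    fix u assume u: "u \<in> J"
    have "u \<cdot> E h = E h \<cdot> twist h u"
    using that u by (intro mul_E_twist) auto
    then have "rho u (E h \<cdot> n) = rho (E h) (rho (twist h u) n)"
      using that u by (simp flip: rho_mul add: rho_E[of h n, symmetric] del: foldr.simps)
    also have "\<dots> \<in> ker" using that u by (intro ker_stable[OF _ bspec[OF that(1)]]) (auto intro!: J_diag one_hom)
    finally show "rho u (E h \<cdot> n) \<in> ker" .
  qed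
  \<comment> \<open>Each of the three terms of \<open>mul_Y\<close> again has an element of
    \<open>J\<close> next to \<open>n\<close>.\<close>
  have YY: "\<forall>u\<in>J. rho u (Y j \<cdot> n) \<in> ker" if IH: "\<forall>u\<in>J. rho u n \<in> ker" and n: "n \<in> C" for j n
  proof
    fix u assume u: "u \<in> J"
    let ?u = "diag (\<psi> j) (\<lambda>x. letter_char \<psi> x (f j)) u" and ?L = "dL (Inl j) u" and ?R = "twist (f j) (dR (Inl j) u)"
    have uJ: "?u \<in> J" "?L \<in> J" "?R \<in> J" using u by (auto intro!: J_diag J_d \<psi>_hom one_hom)
    have "rho u (Y j \<cdot> n) = rho (u \<cdot> Y j) n"
      using n u by (simp add: rho_mul rho_letter)
    also have "\<dots> = rho (Y j \<cdot> ?u + ?L - \<Omega> j \<cdot> ?R) n"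
      by (rule rho_eqv[OF mul_Y]) (use n J_GX u in auto)
    also have "\<dots> = rho (Y j) (rho ?u n) + rho ?L n - rho (\<Omega> j) (rho ?R n)"
      using n uJ by (simp add: rho_left rho_mul del: diag_sub)
    also have "\<dots> \<in> ker"
      using IH uJ by (intro pm.span_diff pm.span_add ker_stable[OF _ bspec[OF IH]]) auto
    finally show "rho u (Y j \<cdot> n) \<in> ker" .
  qed
  have tri: "\<forall>u\<in>J. rho u (a \<cdot> (E h \<cdot> c)) \<in> ker" if "a \<in> FX" "h \<in> carrier H" "c \<in> GX" for a h c
  proof
    fix u assume u: "u \<in> J"
    let ?n = "E h \<cdot> c"
    have n: "?n \<in> C" using that by simp
    show "rho u (a \<cdot> ?n) \<in> ker"
    proof (rule sub_linear_mem[OF that(1)])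
      fix k v assume k: "k \<in> KF" and "v \<in> lists (range (Inr :: 'i \<Rightarrow> 'i + 'i))"
      from this(2) have "\<forall>u\<in>J. rho u (mon \<one> v \<cdot> ?n) \<in> ker"
      proof (induction v)
        case Nil
        then show ?case using base that n by simp
      next
        case (Cons x v)
        then obtain j where x: "x = Inr j" by auto
        have "mon \<one> (x # v) \<cdot> ?n = Y j \<cdot> (mon \<one> v \<cdot> ?n)"
          using n by (simp add: x mon_Cons[of _ v] mul_assoc)
        then show ?case using YY[OF Cons.IH] n by simp
      qed
      then have "rho u (E k \<cdot> (mon \<one> v \<cdot> ?n)) \<in> ker"
        using EY k n u by (simp add: K_mem)
      then show "rho u (mon k v \<cdot> ?n) \<in> ker"
        using k n by (simp add: mon_E[of k v] K_mem mul_assoc)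
    qed (auto intro!: pm_lin sp)
  qed
  have "rho u b \<in> ker" if "b \<in> tri FX GX" for b
  proof -
    from that obtain a h c where b: "a \<in> FX" "h \<in> carrier H" "c \<in> GX" "b = a \<cdot> E h \<cdot> c"
      by (auto simp: tri_def)
    then have "b = a \<cdot> (E h \<cdot> c)" by (simp add: mul_assoc)
    then show ?thesis using tri b(1-3) assms(1) by blast
  qed
  then show ?thesis
    by (rule pm_linear_span_mem[OF pm_linear_rho_right[OF pm_linear_ident] sp assms(2)])
qed

section \<open>The full defining ideal sends normal elements into the kernel\<close>

definition Itri :: "('h, 'i + 'i, 'k) skew set" where
  "Itri = Idl\<^bsub>A\<^esub> (bracket_rels H \<psi> g f \<union> U \<union> V)"

lemma UV_C: "bracket_rels H \<psi> g f \<union> U \<union> V \<subseteq> C"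
  using bracket_rels_C U V by auto

lemmas I_ideal = two_sided_genideal[OF subgroup_self UV_C, folded A_eq_alg, folded Itri_def]
lemmas I_subspace = two_sidedD(2)[OF I_ideal(1)]

lemma Br_I: "Br \<subseteq> Itri"
  unfolding Br_def using I_ideal by (intro genideal_subset[OF subgroup_self]) auto

lemma ideal_restrict:
  assumes "two_sided C I'" "subgroup K H"
  shows "two_sided (sub K P) (I' \<inter> sub K P)"
  using assms subset_C[OF subgroup.subset[OF assms(2)], of _ P]
  by (auto simp: two_sided_def sub_mul subgroup.m_closed[OF assms(2)] intro!: pm.subspace_inter)

lemma J_I: "J \<subseteq> Itri" and Jm_I: "Jm \<subseteq> Itri"
proof -
  have "J \<subseteq> Itri \<inter> GX"
    unfolding J_eq using I_ideal(2) U by (intro genideal_subset[OF KG ideal_restrict[OF I_ideal(1) KG]]) blast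
  then show "J \<subseteq> Itri" by auto
  have "Jm \<subseteq> Itri \<inter> FX"
    unfolding Jm_eq using I_ideal(2) V by (intro genideal_subset[OF KF ideal_restrict[OF I_ideal(1) KF]]) blast
  then show "Jm \<subseteq> Itri" by auto
qed

text \<open>The \<open>p\<close> that map \<open>nrm\<close> into \<open>ker\<close> form a
  two-sided ideal: left multiples because \<open>ker\<close> is a submodule, right multiples because
  \<open>nrm\<close> is one. It remains to check the generators.\<close>

lemma rho_I:
  assumes "p \<in> Itri" "m \<in> nrm"
  shows "rho p m \<in> ker"
proof -
  let ?N = "{p \<in> C. \<forall>m\<in>nrm. rho p m \<in> ker}"
  have "two_sided C ?N"
    by (auto simp: two_sided_def rho_left rho_mul nrm_stable ker_stable pm.span_zero pm.span_add pm.span_scale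
        intro!: pm.subspaceI)
  moreover have "bracket_rels H \<psi> g f \<subseteq> ?N"
    using bracket_rels_C Br_ideal(2) by (auto simp: rho_Br pm.span_zero)
  moreover have "U \<subseteq> ?N" using J_ideal(2) by (auto simp: rho_J)
  \<comment> \<open>Elements of \<open>V\<close> multiply the left factor directly and are absorbed
    there, without any crossing.\<close>
  moreover have "rho v m \<in> ker" if "v \<in> V" "m \<in> nrm" for v m
  proof (rule pm_linear_span_mem[OF _ _ that(2)])
    fix b assume "b \<in> tri FX GX"
    then obtain a h c where b: "a \<in> FX" "h \<in> carrier H" "c \<in> GX" "b = a \<cdot> E h \<cdot> c"
      by (auto simp: tri_def)
    have v: "v \<in> Jm" using that Jm_ideal(2) by auto
    then have "rho v b = v \<cdot> a \<cdot> E h \<cdot> c"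
      using b Jm_FX by (simp add: rho_CY mul_assoc)
    then show "rho v b \<in> ker"
      using b v by (auto intro!: pm.span_base triI two_sidedD(4)[OF Jm_ideal(1)])
  qed (auto intro!: pm_lin)
  then have "V \<subseteq> ?N" using V by auto
  ultimately have "Itri \<subseteq> ?N"
    unfolding Itri_def A_eq_alg by (intro genideal_subset[OF subgroup_self]) auto
  then show ?thesis using assms by auto
qed

text \<open>On the unit, \<open>c\<close>, then \<open>b\<close>, then \<open>a\<close> act by left
  multiplication and nothing is reordered: products in this order are their own normal
  forms.\<close>

lemma rho_tri:
  assumes "a \<in> FX" "b \<in> kH" "c \<in> GX"
  shows "rho (a \<cdot> b \<cdot> c) (E \<one>) = a \<cdot> b \<cdot> c"
proof -
  have "rho (a \<cdot> b \<cdot> c) (E \<one>) = rho a (rho b (rho c (E \<one>)))"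
    using assms by (simp add: rho_mul)
  also have "rho c (E \<one>) = c" using assms by (simp add: rho_CX)
  finally show ?thesis using assms by (simp add: rho_CY mul_assoc)
qed

lemma one_nrm: "E \<one> \<in> nrm"
proof -
  have "E \<one> \<cdot> E \<one> \<cdot> E \<one> \<in> nrm" by (intro pm.span_base triI XY_mem one_closed)
  then show ?thesis by simp
qed

subsection \<open>Comparison with the tensor product\<close>

definition cF :: "('h, 'i + 'i, 'k) skew \<Rightarrow> ('h, 'i + 'i, 'k) skew set" where
  "cF a = Jm +>\<^bsub>alg KF (range Inr)\<^esub> a"

definition cG :: "('h, 'i + 'i, 'k) skew \<Rightarrow> ('h, 'i + 'i, 'k) skew set" where
  "cG c = J +>\<^bsub>alg KG (range Inl)\<^esub> c"

abbreviation QF :: "('k, ('h, 'i + 'i, 'k) skew set) module" where "QF \<equiv> quot_alg (alg KF (range Inr)) Jm"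
abbreviation QG :: "('k, ('h, 'i + 'i, 'k) skew set) module" where "QG \<equiv> quot_alg (alg KG (range Inl)) J"

sublocale qF: concrete_space "alg KF (range Inr)" Jm
  rewrites "\<And>a. Jm +>\<^bsub>alg KF (range Inr)\<^esub> a = cF a" and "carrier (alg KF (range Inr)) = FX"
  by unfold_locales (simp_all add: Jm_subspace subset_iff Jm_FX cF_def)

sublocale qG: concrete_space "alg KG (range Inl)" J
  rewrites "\<And>a. J +>\<^bsub>alg KG (range Inl)\<^esub> a = cG a" and "carrier (alg KG (range Inl)) = GX"
  by unfold_locales (simp_all add: J_subspace subset_iff J_GX cG_def)

sublocale qI: concrete_space A Itri
  rewrites "carrier A = C"
  by unfold_locales (use I_ideal I_subspace in \<open>simp_all add: two_sided_def\<close>)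

lemma quot_alg_mult: "monoid.mult (quot_alg R W) = rcoset_mult R W"
  by (simp add: quot_alg_def ring.defs module.defs FactRing_def)

lemma cF_mult: "a \<in> FX \<Longrightarrow> b \<in> FX \<Longrightarrow> cF a \<otimes>\<^bsub>QF\<^esub> cF b = cF (a \<cdot> b)"
  using ideal.rcoset_mult_add[of Jm "alg KF (range Inr)" a b] Jm_ideal(1)
  by (simp add: quot_alg_mult ideal_alg_iff[OF KF] cF_def)

lemma cG_mult: "a \<in> GX \<Longrightarrow> b \<in> GX \<Longrightarrow> cG a \<otimes>\<^bsub>QG\<^esub> cG b = cG (a \<cdot> b)"
  using ideal.rcoset_mult_add[of J "alg KG (range Inl)" a b] J_ideal(1)
  by (simp add: quot_alg_mult ideal_alg_iff[OF KG] cG_def)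

section \<open>Presentation of the triple tensor product by representatives\<close>

type_synonym ('a, 'b, 'c) free3 = "('a, 'b, 'c) skew set \<times> ('a, 'b, 'c) skew \<times> ('a, 'b, 'c) skew set \<Rightarrow>\<^sub>0 'c"

text \<open>A free generator addressed by representatives of its outer entries. It depends on
  \<open>a\<close> and \<open>c\<close> only through their cosets, and is multilinear only modulo
  the tensor relations.\<close>

definition T :: "('h, 'i + 'i, 'k) skew \<Rightarrow> ('h, 'i + 'i, 'k) skew \<Rightarrow> ('h, 'i + 'i, 'k) skew \<Rightarrow> ('h, 'i + 'i, 'k) free3" where
  "T a b c = Poly_Mapping.single (cF a, b, cG c) 1"

abbreviation kF :: "('h, 'i + 'i, 'k) skew set" where "kF \<equiv> sub KF {}"
abbreviation kG :: "('h, 'i + 'i, 'k) skew set" where "kG \<equiv> sub KG {}"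

definition Rl :: "('h, 'i + 'i, 'k) free3 set" where
  "Rl = tensor3_rels QF (alg (carrier H) {}) QG kF cF (\<lambda>r. r) kG (\<lambda>s. s) cG"

lemma kFG [simp]: "r \<in> kF \<Longrightarrow> r \<in> FX" "r \<in> kF \<Longrightarrow> r \<in> kH" "s \<in> kG \<Longrightarrow> s \<in> GX" "s \<in> kG \<Longrightarrow> s \<in> kH"
  using sub_mono[of KF KF "{}" "range Inr"] sub_mono[of KG KG "{}" "range Inl"]
    sub_mono[OF subgroup.subset[OF KF] order_refl[of "{}"]] sub_mono[OF subgroup.subset[OF KG] order_refl[of "{}"]]
  by auto

lemma kH_mul: "p \<in> kH \<Longrightarrow> q \<in> kH \<Longrightarrow> p \<cdot> q \<in> kH"
  by (rule sub_mul) auto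

text \<open>Every coset has a representative and the operations on cosets are induced from
  representatives, so quantifying over cosets or over elements gives the same relators.\<close>

lemma Rl_eq: "Rl =
    {T (a + a') b c - T a b c - T a' b c |a a' b c. a \<in> FX \<and> a' \<in> FX \<and> b \<in> kH \<and> c \<in> GX} \<union>
    {T a (b + b') c - T a b c - T a b' c |a b b' c. a \<in> FX \<and> b \<in> kH \<and> b' \<in> kH \<and> c \<in> GX} \<union>
    {T a b (c + c') - T a b c - T a b c' |a b c c'. a \<in> FX \<and> b \<in> kH \<and> c \<in> GX \<and> c' \<in> GX} \<union>
    {T (pm_scale t a) b c - pm_scale t (T a b c) |t a b c. a \<in> FX \<and> b \<in> kH \<and> c \<in> GX} \<union>
    {T a (pm_scale t b) c - pm_scale t (T a b c) |t a b c. a \<in> FX \<and> b \<in> kH \<and> c \<in> GX} \<union>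
    {T a b (pm_scale t c) - pm_scale t (T a b c) |t a b c. a \<in> FX \<and> b \<in> kH \<and> c \<in> GX} \<union>
    {T (a \<cdot> r) b c - T a (r \<cdot> b) c |a r b c. a \<in> FX \<and> r \<in> kF \<and> b \<in> kH \<and> c \<in> GX} \<union>
    {T a (b \<cdot> s) c - T a b (s \<cdot> c) |a b s c. a \<in> FX \<and> b \<in> kH \<and> s \<in> kG \<and> c \<in> GX}"
  unfolding Rl_def tensor3_rels_def Let_def qF.quot_carrier qG.quot_carrier T_def alg_simps
proof (intro arg_cong2[of _ _ _ _ "(\<union>)"], goal_cases)
  case 1
  show ?case by (auto simp: qF.quot_add) (metis qF.quot_add)+
next
  case 2
  show ?case by blast
next
  case 3
  show ?case by (auto simp: qG.quot_add) (metis qG.quot_add)+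
next
  case 4
  show ?case by (auto simp: qF.quot_smult) (metis qF.quot_smult)+
next
  case 5
  show ?case by blast
next
  case 6
  show ?case by (auto simp: qG.quot_smult) (metis qG.quot_smult)+
next
  case 7
  show ?case
  proof (intro equalityI subsetI, goal_cases)
    case (1 x)
    then show ?case by clarify (metis cF_mult kFG(1))
  next
    case (2 x)
    then obtain a r b c where x: "x = Poly_Mapping.single (cF (a \<cdot> r), b, cG c) 1 - Poly_Mapping.single (cF a, r \<cdot> b, cG c) 1"
      "a \<in> FX" "r \<in> kF" "b \<in> kH" "c \<in> GX" by blast
    show ?case
      by (rule CollectI, rule exI[of _ "cF a"], rule exI[of _ r], rule exI[of _ b], rule exI[of _ "cG c"])
        (use x in \<open>auto simp: cF_mult\<close>)
  qed
next
  case 8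
  show ?case
  proof (intro equalityI subsetI, goal_cases)
    case (1 x)
    then show ?case by clarify (metis cG_mult kFG(3))
  next
    case (2 x)
    then obtain a b r c where x: "x = Poly_Mapping.single (cF a, b \<cdot> r, cG c) 1 - Poly_Mapping.single (cF a, b, cG (r \<cdot> c)) 1"
      "a \<in> FX" "b \<in> kH" "r \<in> kG" "c \<in> GX" by blast
    show ?case
      by (rule CollectI, rule exI[of _ "cF a"], rule exI[of _ b], rule exI[of _ r], rule exI[of _ "cG c"])
        (use x in \<open>auto simp: cG_mult\<close>)
  qed
qed

definition W :: "('h, 'i + 'i, 'k) free3 set" where
  "W = pm_span Rl"

lemma W_subspace: "pm.subspace W"
  by (simp add: W_def)

lemma W_mem: "r \<in> Rl \<Longrightarrow> r \<in> W"
  unfolding W_def by (rule pm.span_base)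

lemma W_rels:
  assumes "a \<in> FX" "b \<in> kH" "c \<in> GX"
  shows "a' \<in> FX \<Longrightarrow> T (a + a') b c - T a b c - T a' b c \<in> W"
    and "b' \<in> kH \<Longrightarrow> T a (b + b') c - T a b c - T a b' c \<in> W"
    and "c' \<in> GX \<Longrightarrow> T a b (c + c') - T a b c - T a b c' \<in> W"
    and "T (pm_scale t a) b c - pm_scale t (T a b c) \<in> W"
    and "T a (pm_scale t b) c - pm_scale t (T a b c) \<in> W"
    and "T a b (pm_scale t c) - pm_scale t (T a b c) \<in> W"
    and "r \<in> kF \<Longrightarrow> T (a \<cdot> r) b c - T a (r \<cdot> b) c \<in> W"
    and "s \<in> kG \<Longrightarrow> T a (b \<cdot> s) c - T a b (s \<cdot> c) \<in> W"
proof -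
  show "a' \<in> FX \<Longrightarrow> T (a + a') b c - T a b c - T a' b c \<in> W"
    by (rule W_mem, unfold Rl_eq, rule UnI1, rule UnI1, rule UnI1, rule UnI1, rule UnI1, rule UnI1, rule UnI1, use assms in blast)
  show "b' \<in> kH \<Longrightarrow> T a (b + b') c - T a b c - T a b' c \<in> W"
    by (rule W_mem, unfold Rl_eq, rule UnI1, rule UnI1, rule UnI1, rule UnI1, rule UnI1, rule UnI1, rule UnI2, use assms in blast)
  show "c' \<in> GX \<Longrightarrow> T a b (c + c') - T a b c - T a b c' \<in> W"
    by (rule W_mem, unfold Rl_eq, rule UnI1, rule UnI1, rule UnI1, rule UnI1, rule UnI1, rule UnI2, use assms in blast)
  show "T (pm_scale t a) b c - pm_scale t (T a b c) \<in> W"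
    by (rule W_mem, unfold Rl_eq, rule UnI1, rule UnI1, rule UnI1, rule UnI1, rule UnI2, use assms in blast)
  show "T a (pm_scale t b) c - pm_scale t (T a b c) \<in> W"
    by (rule W_mem, unfold Rl_eq, rule UnI1, rule UnI1, rule UnI1, rule UnI2, use assms in blast)
  show "T a b (pm_scale t c) - pm_scale t (T a b c) \<in> W"
    by (rule W_mem, unfold Rl_eq, rule UnI1, rule UnI1, rule UnI2, use assms in blast)
  show "r \<in> kF \<Longrightarrow> T (a \<cdot> r) b c - T a (r \<cdot> b) c \<in> W"
    by (rule W_mem, unfold Rl_eq, rule UnI1, rule UnI2, use assms in blast)
  show "s \<in> kG \<Longrightarrow> T a (b \<cdot> s) c - T a b (s \<cdot> c) \<in> W"
    by (rule W_mem, unfold Rl_eq, rule UnI2, use assms in blast)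
qed

lemma Rl_cases:
  assumes "r \<in> Rl"
    "\<And>a a' b c. a \<in> FX \<Longrightarrow> a' \<in> FX \<Longrightarrow> b \<in> kH \<Longrightarrow> c \<in> GX \<Longrightarrow> P (T (a + a') b c - T a b c - T a' b c)"
    "\<And>a b b' c. a \<in> FX \<Longrightarrow> b \<in> kH \<Longrightarrow> b' \<in> kH \<Longrightarrow> c \<in> GX \<Longrightarrow> P (T a (b + b') c - T a b c - T a b' c)"
    "\<And>a b c c'. a \<in> FX \<Longrightarrow> b \<in> kH \<Longrightarrow> c \<in> GX \<Longrightarrow> c' \<in> GX \<Longrightarrow> P (T a b (c + c') - T a b c - T a b c')"
    "\<And>t a b c. a \<in> FX \<Longrightarrow> b \<in> kH \<Longrightarrow> c \<in> GX \<Longrightarrow> P (T (pm_scale t a) b c - pm_scale t (T a b c))"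
    "\<And>t a b c. a \<in> FX \<Longrightarrow> b \<in> kH \<Longrightarrow> c \<in> GX \<Longrightarrow> P (T a (pm_scale t b) c - pm_scale t (T a b c))"
    "\<And>t a b c. a \<in> FX \<Longrightarrow> b \<in> kH \<Longrightarrow> c \<in> GX \<Longrightarrow> P (T a b (pm_scale t c) - pm_scale t (T a b c))"
    "\<And>a r b c. a \<in> FX \<Longrightarrow> r \<in> kF \<Longrightarrow> b \<in> kH \<Longrightarrow> c \<in> GX \<Longrightarrow> P (T (a \<cdot> r) b c - T a (r \<cdot> b) c)"
    "\<And>a b s c. a \<in> FX \<Longrightarrow> b \<in> kH \<Longrightarrow> s \<in> kG \<Longrightarrow> c \<in> GX \<Longrightarrow> P (T a (b \<cdot> s) c - T a b (s \<cdot> c))"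
  shows "P r"
  using assms(1) unfolding Rl_eq Un_iff mem_Collect_eq by (elim disjE exE conjE; hypsubst; intro assms(2-))

abbreviation free :: "('k, ('h, 'i + 'i, 'k) free3) module" where
  "free \<equiv> free_space (carrier QF \<times> kH \<times> carrier QG)"

lemma T_free: "a \<in> FX \<Longrightarrow> b \<in> kH \<Longrightarrow> c \<in> GX \<Longrightarrow> T a b c \<in> carrier free"
  by (simp add: free_space_def T_def qF.quot_carrierI qG.quot_carrierI)

lemma free_subspace: "pm.subspace (carrier free)"
  by (simp add: free_space_def subspace_keys)

lemma W_free: "W \<subseteq> carrier free"
  unfolding W_def
proof (rule pm.span_minimal[OF _ free_subspace], rule subsetI)
  fix r assume "r \<in> Rl"
  then show "r \<in> carrier free"
    by (rule Rl_cases)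
      (intro pm.subspace_diff[OF free_subspace] pm.subspace_scale[OF free_subspace] T_free;
        simp add: FX_mul GX_mul kH_mul)+
qed

sublocale qW: concrete_space free W
  by unfold_locales (simp_all add: W_subspace W_free free_subspace, simp_all add: free_space_def)

section \<open>The multiplication map on the level of representatives\<close>

definition toA :: "('h, 'i + 'i, 'k) free3 \<Rightarrow> ('h, 'i + 'i, 'k) skew" where
  "toA = lin_ext (\<lambda>(Q, b, R). (SOME a. a \<in> Q) \<cdot> b \<cdot> (SOME c. c \<in> R))"

lemma pm_linear_toA: "pm_linear toA"
  by (simp add: toA_def pm_linear_lin_ext)

lemmas toA_linear = pm_linearD[OF pm_linear_toA]

lemma I_mul: "u \<in> Itri \<Longrightarrow> p \<in> C \<Longrightarrow> p \<cdot> u \<in> Itri" "u \<in> Itri \<Longrightarrow> p \<in> C \<Longrightarrow> u \<cdot> p \<in> Itri"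
  using two_sidedD(3,4)[OF I_ideal(1)] by auto

text \<open>The chosen representatives differ from \<open>a\<close> and \<open>c\<close> by elements
  of \<open>Jm\<close> and \<open>J\<close>, both contained in \<open>Itri\<close>; the two changes
  are made one after the other.\<close>

lemma toA_T:
  assumes "a \<in> FX" "b \<in> kH" "c \<in> GX"
  shows "toA (T a b c) - a \<cdot> b \<cdot> c \<in> Itri"
proof -
  let ?a = "SOME x. x \<in> cF a" and ?c = "SOME x. x \<in> cG c"
  have a: "?a - a \<in> Itri" "?a \<in> FX" and c: "?c - c \<in> Itri" "?c \<in> GX"
    using qF.coset_someI[OF assms(1)] qG.coset_someI[OF assms(3)] J_I Jm_I by auto
  have "toA (T a b c) - a \<cdot> b \<cdot> c = (?a - a) \<cdot> b \<cdot> ?c + a \<cdot> b \<cdot> (?c - c)"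
    by (simp add: toA_def T_def mul_left mul_right)
  also have "\<dots> \<in> Itri"
    using assms a c by (intro pm.subspace_add[OF I_subspace] I_mul) auto
  finally show ?thesis .
qed

lemma toA_W:
  assumes "r \<in> W"
  shows "toA r \<in> Itri"
proof (rule pm_linear_span_mem[OF pm_linear_toA I_subspace assms[unfolded W_def]])
  \<comment> \<open>The defect caused by choosing representatives. The honest product satisfies
    every tensor relation exactly, so each relator is sent to a combination of defects.\<close>
  define D where "D a b c = toA (T a b c) - a \<cdot> b \<cdot> c" for a b c
  have D: "D a b c \<in> Itri" if "a \<in> FX" "b \<in> kH" "c \<in> GX" for a b c
    using toA_T that by (simp add: D_def)
  have T: "toA (T a b c) = D a b c + a \<cdot> b \<cdot> c" for a b c by (simp add: D_def)
  note closed = pm.subspace_diff[OF I_subspace] pm.subspace_scale[OF I_subspace] D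
  fix r assume "r \<in> Rl"
  then show "toA r \<in> Itri"
  proof (rule Rl_cases, unfold toA_linear, goal_cases)
    case (1 a a' b c)
    have "toA (T (a + a') b c) - toA (T a b c) - toA (T a' b c) = D (a + a') b c - D a b c - D a' b c"
      by (simp add: T mul_left)
    also have "\<dots> \<in> Itri" using 1 by (intro closed) auto
    finally show ?case .
  next
    case (2 a b b' c)
    have "toA (T a (b + b') c) - toA (T a b c) - toA (T a b' c) = D a (b + b') c - D a b c - D a b' c"
      by (simp add: T mul_left mul_right)
    also have "\<dots> \<in> Itri" using 2 by (intro closed) auto
    finally show ?case .
  next
    case (3 a b c c')
    have "toA (T a b (c + c')) - toA (T a b c) - toA (T a b c') = D a b (c + c') - D a b c - D a b c'"
      by (simp add: T mul_left mul_right)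
    also have "\<dots> \<in> Itri" using 3 by (intro closed) auto
    finally show ?case .
  next
    case (4 t a b c)
    have "toA (T (pm_scale t a) b c) - pm_scale t (toA (T a b c)) = D (pm_scale t a) b c - pm_scale t (D a b c)"
      by (simp add: T mul_left mul_right pm.scale_right_distrib)
    also have "\<dots> \<in> Itri" using 4 by (intro closed) auto
    finally show ?case .
  next
    case (5 t a b c)
    have "toA (T a (pm_scale t b) c) - pm_scale t (toA (T a b c)) = D a (pm_scale t b) c - pm_scale t (D a b c)"
      by (simp add: T mul_left mul_right pm.scale_right_distrib)
    also have "\<dots> \<in> Itri" using 5 by (intro closed) auto
    finally show ?case .
  next
    case (6 t a b c)
    have "toA (T a b (pm_scale t c)) - pm_scale t (toA (T a b c)) = D a b (pm_scale t c) - pm_scale t (D a b c)"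
      by (simp add: T mul_left mul_right pm.scale_right_distrib)
    also have "\<dots> \<in> Itri" using 6 by (intro closed) auto
    finally show ?case .
  next
    case (7 a r b c)
    have "a \<cdot> r \<cdot> b \<cdot> c = a \<cdot> (r \<cdot> b) \<cdot> c" using 7 by (simp add: mul_assoc)
    then have "toA (T (a \<cdot> r) b c) - toA (T a (r \<cdot> b) c) = D (a \<cdot> r) b c - D a (r \<cdot> b) c"
      by (simp add: T)
    also have "\<dots> \<in> Itri" using 7 by (intro closed FX_mul kH_mul) auto
    finally show ?case .
  next
    case (8 a b s c)
    have "a \<cdot> (b \<cdot> s) \<cdot> c = a \<cdot> b \<cdot> (s \<cdot> c)" using 8 by (simp add: mul_assoc)
    then have "toA (T a (b \<cdot> s) c) - toA (T a b (s \<cdot> c)) = D a (b \<cdot> s) c - D a b (s \<cdot> c)"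
      by (simp add: T)
    also have "\<dots> \<in> Itri" using 8 by (intro closed GX_mul kH_mul) auto
    finally show ?case .
  qed
qed

text \<open>
  On normal words \<open>h v w\<close>, with \<open>v\<close> in the letters \<open>Inr\<close> and \<open>w\<close> in the letters \<open>Inl\<close>, this is
  \<open>v \<otimes> h \<otimes> w\<close> up to the scalar in \<open>h v = \<psi>\<^sub>v(h)\<^sup>-\<^sup>1 v h\<close>; its values on other words are junk.
\<close>

definition toT :: "('h, 'i + 'i, 'k) skew \<Rightarrow> ('h, 'i + 'i, 'k) free3" where
  "toT = lin_ext (\<lambda>(h, u). let v = takeWhile (Not \<circ> isl) u in
     pm_scale (inverse (wchar v h)) (T (mon \<one> v) (E h) (mon \<one> (dropWhile (Not \<circ> isl) u))))"

lemma pm_linear_toT: "pm_linear toT"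
  by (simp add: toT_def pm_linear_lin_ext)

lemmas pm_linear_toT' [pm_lin] = pm_linear_comp[OF pm_linear_toT]
lemmas toT_linear = pm_linearD[OF pm_linear_toT]

section \<open>From normal words back to tensors\<close>

lemma toT_mon:
  assumes "v \<in> lists (range Inr)" "w \<in> lists (range Inl)"
  shows "toT (mon h (v @ w)) = pm_scale (inverse (wchar v h)) (T (mon \<one> v) (E h) (mon \<one> w))"
proof -
  have "takeWhile (Not \<circ> isl) w = []" "dropWhile (Not \<circ> isl) w = w"
    using assms(2) by (cases w; auto)+
  moreover have "x \<in> set v \<Longrightarrow> (Not \<circ> isl) x" for x using assms(1) by auto
  ultimately have "takeWhile (Not \<circ> isl) (v @ w) = v" "dropWhile (Not \<circ> isl) (v @ w) = w"
    by (simp_all add: takeWhile_append2 dropWhile_append2)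
  then show ?thesis by (simp add: toT_def mon_def lin_ext_single)
qed

text \<open>Multiplication merges \<open>k\<close>, \<open>h\<close> and \<open>l\<close> into one
  group element, which \<open>toT\<close> puts in the middle. Balancing over \<open>k[F]\<close> and
  over \<open>k[G]\<close> moves \<open>k\<close> and \<open>l\<close> there in the tensor as
  well.\<close>

lemma toT_mono:
  assumes "k \<in> KF" "h \<in> carrier H" "l \<in> KG" "v \<in> lists (range Inr)" "w \<in> lists (range Inl)"
  shows "toT (mon k v \<cdot> E h \<cdot> mon l w) - T (mon k v) (E h) (mon l w) \<in> W"
proof -
  note KC = K_mem(1)[OF assms(3)] K_mem(2)[OF assms(1)]
  \<comment> \<open>From \<open>k v = wchar v k ^ -1 * v k\<close>: the group element has to stand
    on the right of the word before it can be moved across the tensor sign.\<close>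
  let ?s = "inverse (wchar v k)"
  have v: "mon \<one> v \<in> FX" and w: "mon \<one> w \<in> GX" and k: "E k \<in> kF" and l: "E l \<in> kG"
    and lw: "mon l w \<in> GX" and E: "E h \<in> kH" "E k \<cdot> E h \<in> kH"
    using assms by (simp_all add: sub_mon K_mem kH_mul del: in_lists_conv_set)
  have "toT (mon k v \<cdot> E h \<cdot> mon l w) = pm_scale ?s (T (mon \<one> v) (E k \<cdot> E h \<cdot> E l) (mon \<one> w))"
    using assms KC by (simp add: mul_mon mul_left toT_linear toT_mon) (simp add: field_simps)
  moreover have "T (mon k v) (E h) (mon l w) = T (pm_scale ?s (mon \<one> v \<cdot> E k)) (E h) (mon l w)"
    using KC by (simp add: mul_mon)
  moreover have 1: "T (pm_scale ?s (mon \<one> v \<cdot> E k)) (E h) (mon l w) - pm_scale ?s (T (mon \<one> v \<cdot> E k) (E h) (mon l w)) \<in> W"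
    by (rule W_rels(4)) (use v k lw E in \<open>simp_all add: FX_mul\<close>)
  moreover have 2: "T (mon \<one> v \<cdot> E k) (E h) (mon l w) - T (mon \<one> v) (E k \<cdot> E h) (mon l w) \<in> W"
    by (rule W_rels(7)) (use v k lw E in simp_all)
  moreover have 3: "T (mon \<one> v) (E k \<cdot> E h \<cdot> E l) (mon \<one> w) - T (mon \<one> v) (E k \<cdot> E h) (mon l w) \<in> W"
    using W_rels(8)[of "mon \<one> v" "E k \<cdot> E h" "mon \<one> w" "E l"] v w l E KC by (simp add: mon_E[of l w])
  ultimately show ?thesis
    using pm.subspace_diff[OF W_subspace
        pm.subspace_scale[OF W_subspace pm.subspace_diff[OF W_subspace 3 2], of ?s] 1]
    by (simp add: pm.scale_right_diff_distrib)
qed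

lemma toT_tri:
  assumes "a \<in> FX" "b \<in> kH" "c \<in> GX"
  shows "toT (a \<cdot> b \<cdot> c) - T a b c \<in> W"
proof -
  define D where "D a b c = toT (a \<cdot> b \<cdot> c) - T a b c" for a b c
  \<comment> \<open>The homogeneity relators for the scalar 0.\<close>
  have zero: "T 0 b c \<in> W" "T a 0 c \<in> W" "T a b 0 \<in> W" if "a \<in> FX" "b \<in> kH" "c \<in> GX" for a b c
    using W_rels(4-6)[OF that, of 0] by simp_all
  note closed = pm.subspace_add[OF W_subspace] pm.subspace_diff[OF W_subspace] pm.subspace_scale[OF W_subspace]
  \<comment> \<open>As \<open>T\<close> is not linear in its arguments, monomials cannot be extended
    linearly. Instead the good values of each argument form a subspace, the failure of linearity
    being a relator.\<close>
  have sa: "pm.subspace {a \<in> FX. D a b c \<in> W}" if "b \<in> kH" "c \<in> GX" for b c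
  proof (rule pm.subspaceI)
    show "0 \<in> {a \<in> FX. D a b c \<in> W}"
      using zero(1)[OF _ that, of 0] pm.subspace_neg[OF W_subspace] by (simp add: D_def mul_left toT_linear)
    fix a a' t assume a: "a \<in> {a \<in> FX. D a b c \<in> W}"
    have "D (pm_scale t a) b c = pm_scale t (D a b c) - (T (pm_scale t a) b c - pm_scale t (T a b c))"
      by (simp add: D_def mul_left toT_linear pm.scale_right_diff_distrib)
    also have "\<dots> \<in> W" using a that by (intro closed W_rels) auto
    finally show "pm_scale t a \<in> {a \<in> FX. D a b c \<in> W}" using a by simp
    assume a': "a' \<in> {a \<in> FX. D a b c \<in> W}"
    have "D (a + a') b c = D a b c + D a' b c - (T (a + a') b c - T a b c - T a' b c)"
      by (simp add: D_def mul_left toT_linear)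
    also have "\<dots> \<in> W" using a a' that by (intro closed W_rels) auto
    finally show "a + a' \<in> {a \<in> FX. D a b c \<in> W}" using a a' by simp
  qed
  have sb: "pm.subspace {b \<in> kH. D a b c \<in> W}" if "a \<in> FX" "c \<in> GX" for a c
  proof (rule pm.subspaceI)
    show "0 \<in> {b \<in> kH. D a b c \<in> W}"
      using zero(2)[OF that(1) _ that(2), of 0] pm.subspace_neg[OF W_subspace]
      by (simp add: D_def mul_left mul_right toT_linear)
    fix b b' t assume b: "b \<in> {b \<in> kH. D a b c \<in> W}"
    have "D a (pm_scale t b) c = pm_scale t (D a b c) - (T a (pm_scale t b) c - pm_scale t (T a b c))"
      by (simp add: D_def mul_left mul_right toT_linear pm.scale_right_diff_distrib)
    also have "\<dots> \<in> W" using b that by (intro closed W_rels) auto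
    finally show "pm_scale t b \<in> {b \<in> kH. D a b c \<in> W}" using b by simp
    assume b': "b' \<in> {b \<in> kH. D a b c \<in> W}"
    have "D a (b + b') c = D a b c + D a b' c - (T a (b + b') c - T a b c - T a b' c)"
      by (simp add: D_def mul_left mul_right toT_linear)
    also have "\<dots> \<in> W" using b b' that by (intro closed W_rels) auto
    finally show "b + b' \<in> {b \<in> kH. D a b c \<in> W}" using b b' by simp
  qed
  have sc: "pm.subspace {c \<in> GX. D a b c \<in> W}" if "a \<in> FX" "b \<in> kH" for a b
  proof (rule pm.subspaceI)
    show "0 \<in> {c \<in> GX. D a b c \<in> W}"
      using zero(3)[OF that, of 0] pm.subspace_neg[OF W_subspace] by (simp add: D_def mul_right toT_linear)
    fix c c' t assume c: "c \<in> {c \<in> GX. D a b c \<in> W}"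
    have "D a b (pm_scale t c) = pm_scale t (D a b c) - (T a b (pm_scale t c) - pm_scale t (T a b c))"
      by (simp add: D_def mul_right toT_linear pm.scale_right_diff_distrib)
    also have "\<dots> \<in> W" using c that by (intro closed W_rels) auto
    finally show "pm_scale t c \<in> {c \<in> GX. D a b c \<in> W}" using c by simp
    assume c': "c' \<in> {c \<in> GX. D a b c \<in> W}"
    have "D a b (c + c') = D a b c + D a b c' - (T a b (c + c') - T a b c - T a b c')"
      by (simp add: D_def mul_right toT_linear)
    also have "\<dots> \<in> W" using c c' that by (intro closed W_rels) auto
    finally show "c + c' \<in> {c \<in> GX. D a b c \<in> W}" using c c' by simp
  qed
  have mm: "D (mon k v) (E h) c \<in> W"
    if "k \<in> KF" "v \<in> lists (range Inr)" "h \<in> carrier H" "c \<in> GX" for k v h c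
    using sub_linear_mem[OF that(4) pm_linear_ident sc[of "mon k v" "E h"]] that toT_mono[of k h]
    by (simp add: D_def sub_mon del: in_lists_conv_set)
  have m: "D (mon k v) b c \<in> W"
    if "k \<in> KF" "v \<in> lists (range Inr)" "b \<in> kH" "c \<in> GX" for k v b c
    using sub_linear_mem[OF that(3) pm_linear_ident sb[of "mon k v" c]] that mm
    by (simp add: sub_mon del: in_lists_conv_set)
  have "D a b c \<in> W"
    using sub_linear_mem[OF assms(1) pm_linear_ident sa[OF assms(2,3)]] m assms
    by (simp add: sub_mon del: in_lists_conv_set)
  then show ?thesis by (simp add: D_def)
qed

text \<open>A factor in \<open>Jm\<close> or \<open>J\<close> has the coset of 0, and tensors with a
  zero entry lie in \<open>W\<close>.\<close>

lemma toT_ker: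
  assumes "m \<in> ker"
  shows "toT m \<in> W"
proof (rule pm_linear_span_mem[OF pm_linear_toT W_subspace assms])
  have z: "cF a = cF 0" if "a \<in> Jm" for a using that by (simp add: qF.coset_eq_iff)
  have z': "cG c = cG 0" if "c \<in> J" for c using that by (simp add: qG.coset_eq_iff)
  fix m assume "m \<in> tri Jm GX \<union> tri FX J"
  then obtain a h c where m: "m = a \<cdot> E h \<cdot> c" "h \<in> carrier H" "a \<in> FX" "c \<in> GX" "a \<in> Jm \<or> c \<in> J"
    using J_GX Jm_FX by (auto simp: tri_def)
  then have E: "E h \<in> kH" by (simp add: sub_mon)
  have "T a (E h) c \<in> W"
    using m(5) W_rels(4)[OF m(3) E m(4), of 0] W_rels(6)[OF m(3) E m(4), of 0] z[of a] z'[of c]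
    by (auto simp: T_def)
  then show "toT m \<in> W"
    using pm.subspace_add[OF W_subspace toT_tri[OF m(3) E m(4)]] m(1) by fastforce
qed

lemma toT_nrm:
  assumes "m \<in> nrm"
  shows "toT m \<in> carrier free" and "toA (toT m) - m \<in> Itri"
proof -
  have *: "toT b - T a (E h) c \<in> W" "T a (E h) c \<in> carrier free" "toA (T a (E h) c) - b \<in> Itri"
    if "a \<in> FX" "h \<in> carrier H" "c \<in> GX" "b = a \<cdot> E h \<cdot> c" for a b c h
    using that toT_tri[of a "E h" c] T_free[of a "E h" c] toA_T[of a "E h" c] by (simp_all add: sub_mon)
  show "toT m \<in> carrier free"
  proof (rule pm_linear_span_mem[OF pm_linear_toT free_subspace assms])
    fix b assume "b \<in> tri FX GX"
    then obtain a h c where "a \<in> FX" "h \<in> carrier H" "c \<in> GX" "b = a \<cdot> E h \<cdot> c" by (auto simp: tri_def)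
    note * = *[OF this]
    have "toT b - T a (E h) c + T a (E h) c \<in> carrier free"
      using * W_free by (intro pm.subspace_add[OF free_subspace]) auto
    then show "toT b \<in> carrier free" by simp
  qed
  show "toA (toT m) - m \<in> Itri"
  proof (rule pm_linear_span_mem[OF _ I_subspace assms, of "\<lambda>m. toA (toT m) - m"])
    fix b assume "b \<in> tri FX GX"
    then obtain a h c where "a \<in> FX" "h \<in> carrier H" "c \<in> GX" "b = a \<cdot> E h \<cdot> c" by (auto simp: tri_def)
    note * = *[OF this]
    have "toA (toT b - T a (E h) c) + (toA (T a (E h) c) - b) \<in> Itri"
      using * toA_W by (intro pm.subspace_add[OF I_subspace]) auto
    then show "toA (toT b) - b \<in> Itri" by (simp add: toA_linear)
  qed (intro pm_linear_diff pm_linear_comp[OF pm_linear_toA] pm_linear_toT pm_linear_ident)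
qed

lemma toA_C: "x \<in> carrier free \<Longrightarrow> toA x \<in> C"
  and toT_toA: "x \<in> carrier free \<Longrightarrow> toT (rho (toA x) (E \<one>)) - x \<in> W"
proof -
  have *: "toA (Poly_Mapping.single q 1) \<in> C \<and>
      toT (rho (toA (Poly_Mapping.single q 1)) (E \<one>)) - Poly_Mapping.single q 1 \<in> W"
    if "q \<in> carrier QF \<times> kH \<times> carrier QG" for q
  proof -
    from that obtain a b c where q: "q = (cF a, b, cG c)" "a \<in> FX" "b \<in> kH" "c \<in> GX"
      by (auto elim!: qF.quot_carrierE qG.quot_carrierE)
    let ?a = "SOME x. x \<in> cF a" and ?c = "SOME x. x \<in> cG c"
    have a: "cF ?a = cF a" "?a \<in> FX" and c: "cG ?c = cG c" "?c \<in> GX"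
      using qF.coset_someI[OF q(2)] qG.coset_someI[OF q(4)] by (simp_all add: qF.coset_eq_iff qG.coset_eq_iff)
    have "toA (Poly_Mapping.single q 1) = ?a \<cdot> b \<cdot> ?c" by (simp add: toA_def q(1))
    \<comment> \<open>With exactly those representatives that \<open>toA\<close> chooses, the
      generator is recovered without a defect, so \<open>toT_tri\<close> applies directly.\<close>
    moreover have "Poly_Mapping.single q 1 = T ?a b ?c" by (simp add: T_def a c q(1))
    ultimately show ?thesis
      using a c q toT_tri[of ?a b ?c] by (simp add: rho_tri)
  qed
  fix x assume "x \<in> carrier free"
  then have x: "Poly_Mapping.keys x \<subseteq> carrier QF \<times> kH \<times> carrier QG" by (simp add: free_space_def)
  show "toA x \<in> C" by (rule pm_linear_mem[OF pm_linear_toA subspace_sub x]) (use * in blast)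
  show "toT (rho (toA x) (E \<one>)) - x \<in> W"
    by (rule pm_linear_mem[OF _ W_subspace x, of "\<lambda>x. toT (rho (toA x) (E \<one>)) - x"])
      (use * in \<open>auto intro!: pm_lin pm_linear_toA\<close>)
qed

theorem triangular_decomposition:
  "\<exists>\<phi>. linear_iso (tensor3 QF (alg (carrier H) {}) QG kF cF (\<lambda>r. r) kG (\<lambda>s. s) cG) (quot_alg A Itri) \<phi> \<and>
    (\<forall>a\<in>FX. \<forall>b\<in>kH. \<forall>c\<in>GX.
      \<phi> (pure3 QF (alg (carrier H) {}) QG kF cF (\<lambda>r. r) kG (\<lambda>s. s) cG (cF a) b (cG c)) =
        Itri +>\<^bsub>A\<^esub> (a \<cdot> b \<cdot> c))"
proof -
  have "\<exists>\<phi>. linear_iso (quot_alg free W) (quot_alg A Itri) \<phi> \<and>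
      (\<forall>x\<in>carrier free. \<phi> (W +>\<^bsub>free\<^esub> x) = Itri +>\<^bsub>A\<^esub> toA x)"
  proof (rule linear_iso_quot[OF qW.concrete_space_axioms qI.concrete_space_axioms,
        where g = "\<lambda>y. toT (rho y (E \<one>))"])
    show "pm_linear (\<lambda>y. toT (rho y (E \<one>)))" by (intro pm_lin)
    show "toT (rho y (E \<one>)) \<in> carrier free" if "y \<in> carrier A" for y
      using that by (intro toT_nrm nrm_stable one_nrm) simp
    show "toT (rho y (E \<one>)) \<in> W" if "y \<in> Itri" for y
      using that by (intro toT_ker rho_I one_nrm)
    show "toA (toT (rho y (E \<one>))) - y \<in> Itri" if "y \<in> carrier A" for y
    proof -
      have y: "y \<in> C" using that by simp
      \<comment> \<open>The normal form differs from \<open>y\<close> by bracket relations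
        only.\<close>
      have "rho y (E \<one>) - y \<in> Itri"
        using rho_eqv_mul[OF y, of "E \<one>"] y Br_I by (auto simp: eqv_def)
      then show ?thesis
        using pm.subspace_add[OF I_subspace toT_nrm(2)[OF nrm_stable[OF y one_nrm]]] by fastforce
    qed
  qed (auto simp: pm_linear_toA toA_C toA_W toT_toA)
  then obtain \<phi> where \<phi>: "linear_iso (quot_alg free W) (quot_alg A Itri) \<phi>"
      "\<And>x. x \<in> carrier free \<Longrightarrow> \<phi> (W +>\<^bsub>free\<^esub> x) = Itri +>\<^bsub>A\<^esub> toA x" by blast
  have "\<phi> (W +>\<^bsub>free\<^esub> T a b c) = Itri +>\<^bsub>A\<^esub> (a \<cdot> b \<cdot> c)" if "a \<in> FX" "b \<in> kH" "c \<in> GX" for a b c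
    using that by (simp add: \<phi>(2) T_free qI.coset_eq_iff toA_T)
  then show ?thesis
    using \<phi>(1) by (intro exI[of _ \<phi>]) (simp add: tensor3_def pure3_def T_def flip: Rl_def W_def)
qed

end

section \<open>Instantiation in the quotient of \<open>G \<times> F\<close> by
  \<open>N\<close>\<close>

theorem proposition3p4:
  fixes G :: "('g, 'm) monoid_scheme" and F :: "('f, 'n) monoid_scheme"
    and N :: "('g \<times> 'f) set" and H :: "('g \<times> 'f) set monoid"
    and g :: "'i::finite \<Rightarrow> 'g" and f :: "'i \<Rightarrow> 'f"
    and \<chi> :: "'i \<Rightarrow> 'g \<Rightarrow> 'k::field" and \<chi>m :: "'i \<Rightarrow> 'f \<Rightarrow> 'k"
    and gH fH :: "'i \<Rightarrow> ('g \<times> 'f) set" and \<psi> :: "'i \<Rightarrow> ('g \<times> 'f) set \<Rightarrow> 'k"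
    and d :: "'i + 'i \<Rightarrow> ('g \<times> 'f) set"
    and A GX FX kG kF kH kX kXm :: "('k, (('g \<times> 'f) set, 'i + 'i, 'k) skew) module"
    and J Jm I :: "(('g \<times> 'f) set, 'i + 'i, 'k) skew set"
    and u :: "'s \<Rightarrow> (('g \<times> 'f) set, 'i + 'i, 'k) skew" and S :: "'s set"
    and um :: "'t \<Rightarrow> (('g \<times> 'f) set, 'i + 'i, 'k) skew" and T :: "'t set"
  assumes "comm_group G" and "comm_group F"
    and "\<And>i. g i \<in> carrier G" and "\<And>i. f i \<in> carrier F"
    and "generate F (range f) = carrier F"
    and "\<And>i. \<chi> i \<in> hom G kstar" and "\<And>i. \<chi>m i \<in> hom F kstar"
    and "\<And>i j. \<chi>m i (f j) = inverse (\<chi> j (g i))"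
    and "subgroup N (G \<times>\<times> F)"
    and "\<And>i z. z \<in> N \<Longrightarrow> ext_char \<chi> \<chi>m i z = 1"
    and "inj_on (embG G F N) (carrier G)" and "inj_on (embF G F N) (carrier F)"
    and H: "H = (G \<times>\<times> F) Mod N"
    and gH: "gH = (\<lambda>i. embG G F N (g i))" and fH: "fH = (\<lambda>i. embF G F N (f i))"
    and \<psi>: "\<psi> = quot_char \<chi> \<chi>m"
    and d: "d = case_sum gH fH"
    and A: "A = skew_alg H (letter_char \<psi>)"
    and kX: "kX = subalg A (range (\<lambda>i. letter H (Inl i)))"
    and kXm: "kXm = subalg A (range (\<lambda>i. letter H (Inr i)))"
    and kG: "kG = subalg A (gr ` embG G F N ` carrier G)"
    and kF: "kF = subalg A (gr ` embF G F N ` carrier F)"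
    and kH: "kH = subalg A (gr ` carrier H)"
    and GX: "GX = subalg A (gr ` embG G F N ` carrier G \<union> range (\<lambda>i. letter H (Inl i)))"
    and FX: "FX = subalg A (gr ` embF G F N ` carrier F \<union> range (\<lambda>i. letter H (Inr i)))"
    and "hopf_ideal H (letter_char \<psi>) d GX J" and "const_homogeneous_ideal J"
    and "J \<subseteq> Idl\<^bsub>GX\<^esub> {letter H (Inl i) \<otimes>\<^bsub>A\<^esub> letter H (Inl j) |i j. True}"
    and "hopf_ideal H (letter_char \<psi>) d FX Jm" and "const_homogeneous_ideal Jm"
    and "Jm \<subseteq> Idl\<^bsub>FX\<^esub> {letter H (Inr i) \<otimes>\<^bsub>A\<^esub> letter H (Inr j) |i j. True}"
    and "\<And>s. s \<in> S \<Longrightarrow> u s \<in> carrier kX \<and> const_homogeneous (u s)"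
    and "J = Idl\<^bsub>GX\<^esub> (u ` S)"
    and "\<And>t. t \<in> T \<Longrightarrow> um t \<in> carrier kXm \<and> const_homogeneous (um t)"
    and "Jm = Idl\<^bsub>FX\<^esub> (um ` T)"
    and I: "I = Idl\<^bsub>A\<^esub> (bracket_rels H \<psi> gH fH \<union> u ` S \<union> um ` T)"
  shows "\<exists>\<phi>. linear_iso
      (tensor3 (quot_alg FX Jm) kH (quot_alg GX J)
        (carrier kF) (\<lambda>r. Jm +>\<^bsub>FX\<^esub> r) (\<lambda>r. r) (carrier kG) (\<lambda>s. s) (\<lambda>s. J +>\<^bsub>GX\<^esub> s))
      (quot_alg A I) \<phi> \<and>
    (\<forall>a\<in>carrier FX. \<forall>b\<in>carrier kH. \<forall>c\<in>carrier GX.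
      \<phi> (pure3 (quot_alg FX Jm) kH (quot_alg GX J)
          (carrier kF) (\<lambda>r. Jm +>\<^bsub>FX\<^esub> r) (\<lambda>r. r) (carrier kG) (\<lambda>s. s) (\<lambda>s. J +>\<^bsub>GX\<^esub> s)
          (Jm +>\<^bsub>FX\<^esub> a) b (J +>\<^bsub>GX\<^esub> c))
      = I +>\<^bsub>A\<^esub> (a \<otimes>\<^bsub>A\<^esub> b \<otimes>\<^bsub>A\<^esub> c))"
proof -
  let ?L = "range (Inl :: 'i \<Rightarrow> 'i + 'i)" and ?R = "range (Inr :: 'i \<Rightarrow> 'i + 'i)"
  let ?KG = "embG G F N ` carrier G" and ?KF = "embF G F N ` carrier F"
  interpret G: comm_group G by fact
  interpret F: comm_group F by fact
  interpret GF: comm_group "G \<times>\<times> F"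
    by (rule group.group_comm_groupI[OF DirProd_group])
      (auto simp: G.group_axioms F.group_axioms DirProd_def G.m_comm F.m_comm)
  interpret N: normal N "G \<times>\<times> F"
    using GF.subgroup_imp_normal \<open>subgroup N (G \<times>\<times> F)\<close> by blast
  interpret H: comm_group H
    unfolding H by (rule GF.abelian_FactGroup) fact
  have coset_hom: "(\<lambda>z. N #>\<^bsub>G \<times>\<times> F\<^esub> z) \<in> hom (G \<times>\<times> F) H"
    unfolding H by (rule N.r_coset_hom_Mod)
  have emb: "embG G F N \<in> hom G H" "embF G F N \<in> hom F H"
    using coset_hom by (auto simp: hom_def embG_def embF_def Pi_iff)
      (metis F.one_closed F.r_one G.one_closed G.r_one mult_DirProd)+
  have KG: "subgroup ?KG H" and KF: "subgroup ?KF H"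
    using emb by (auto intro!: group_hom.img_is_subgroup group_hom.intro group_hom_axioms.intro
        G.group_axioms F.group_axioms H.group_axioms)
  have ext: "ext_char \<chi> \<chi>m i \<in> hom (G \<times>\<times> F) kstar" for i
    using \<open>\<And>i. \<chi> i \<in> hom G kstar\<close>[of i] \<open>\<And>i. \<chi>m i \<in> hom F kstar\<close>[of i]
    by (auto simp: hom_def kstar_def ext_char_def Pi_iff)
  \<comment> \<open>The extended character is trivial on \<open>N\<close>, so its image on a coset
    is a singleton and \<open>the_elem\<close> returns its value.\<close>
  have \<psi>_coset: "\<psi> i (N #>\<^bsub>G \<times>\<times> F\<^esub> z) = ext_char \<chi> \<chi>m i z" if z: "z \<in> carrier (G \<times>\<times> F)" for i z
  proof -
    have "ext_char \<chi> \<chi>m i (n \<otimes>\<^bsub>G \<times>\<times> F\<^esub> z) = ext_char \<chi> \<chi>m i z" if "n \<in> N" for n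
      using hom_mult[OF ext N.mem_carrier[OF that] z] that \<open>\<And>i z. z \<in> N \<Longrightarrow> ext_char \<chi> \<chi>m i z = 1\<close>
      by (simp add: kstar_def)
    then have "(\<lambda>n. ext_char \<chi> \<chi>m i (n \<otimes>\<^bsub>G \<times>\<times> F\<^esub> z)) ` N = {ext_char \<chi> \<chi>m i z}"
      using N.one_closed by (intro equalityI subsetI) (auto simp del: one_DirProd intro: rev_image_eqI[OF N.one_closed])
    moreover have "ext_char \<chi> \<chi>m i ` (N #>\<^bsub>G \<times>\<times> F\<^esub> z) = (\<lambda>n. ext_char \<chi> \<chi>m i (n \<otimes>\<^bsub>G \<times>\<times> F\<^esub> z)) ` N"
      by (auto simp: r_coset_def)
    ultimately have "ext_char \<chi> \<chi>m i ` (N #>\<^bsub>G \<times>\<times> F\<^esub> z) = {ext_char \<chi> \<chi>m i z}" by simp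
    then show ?thesis by (simp add: \<psi> quot_char_def)
  qed
  have carrier_H: "\<exists>z\<in>carrier (G \<times>\<times> F). h = N #>\<^bsub>G \<times>\<times> F\<^esub> z" if "h \<in> carrier H" for h
    using that by (auto simp: H FactGroup_def RCOSETS_def)
  have mult_H: "(N #>\<^bsub>G \<times>\<times> F\<^esub> z) \<otimes>\<^bsub>H\<^esub> (N #>\<^bsub>G \<times>\<times> F\<^esub> z') = N #>\<^bsub>G \<times>\<times> F\<^esub> (z \<otimes>\<^bsub>G \<times>\<times> F\<^esub> z')"
    if "z \<in> carrier (G \<times>\<times> F)" "z' \<in> carrier (G \<times>\<times> F)" for z z'
    using hom_mult[OF coset_hom that] by simp
  have \<psi>_hom: "\<psi> i \<in> hom H kstar" for i
  proof (rule homI)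
    show "\<psi> i h \<in> carrier kstar" if "h \<in> carrier H" for h
      using carrier_H[OF that] hom_in_carrier[OF ext] by (metis \<psi>_coset)
    show "\<psi> i (h \<otimes>\<^bsub>H\<^esub> h') = \<psi> i h \<otimes>\<^bsub>kstar\<^esub> \<psi> i h'" if "h \<in> carrier H" "h' \<in> carrier H" for h h'
    proof -
      from that obtain z z' where z: "z \<in> carrier (G \<times>\<times> F)" "z' \<in> carrier (G \<times>\<times> F)"
        "h = N #>\<^bsub>G \<times>\<times> F\<^esub> z" "h' = N #>\<^bsub>G \<times>\<times> F\<^esub> z'"
        using carrier_H by metis
      then show ?thesis
        using hom_mult[OF ext z(1,2)] by (simp only: mult_H \<psi>_coset GF.m_closed)
    qed
  qed
  have one: "\<chi> i \<one>\<^bsub>G\<^esub> = 1" "\<chi>m i \<one>\<^bsub>F\<^esub> = 1" for i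
  proof -
    have "\<chi> i \<one>\<^bsub>G\<^esub> * \<chi> i \<one>\<^bsub>G\<^esub> = \<chi> i \<one>\<^bsub>G\<^esub>" "\<chi> i \<one>\<^bsub>G\<^esub> \<noteq> 0"
      using \<open>\<And>i. \<chi> i \<in> hom G kstar\<close>[of i] hom_mult[of "\<chi> i" G kstar "\<one>\<^bsub>G\<^esub>" "\<one>\<^bsub>G\<^esub>"]
        hom_in_carrier[of "\<chi> i" G kstar "\<one>\<^bsub>G\<^esub>"] by (simp_all add: kstar_def)
    then show "\<chi> i \<one>\<^bsub>G\<^esub> = 1" by simp
    have "\<chi>m i \<one>\<^bsub>F\<^esub> * \<chi>m i \<one>\<^bsub>F\<^esub> = \<chi>m i \<one>\<^bsub>F\<^esub>" "\<chi>m i \<one>\<^bsub>F\<^esub> \<noteq> 0"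
      using \<open>\<And>i. \<chi>m i \<in> hom F kstar\<close>[of i] hom_mult[of "\<chi>m i" F kstar "\<one>\<^bsub>F\<^esub>" "\<one>\<^bsub>F\<^esub>"]
        hom_in_carrier[of "\<chi>m i" F kstar "\<one>\<^bsub>F\<^esub>"] by (simp_all add: kstar_def)
    then show "\<chi>m i \<one>\<^bsub>F\<^esub> = 1" by simp
  qed
  have gH_mem: "gH i \<in> ?KG" and fH_mem: "fH i \<in> ?KF" for i
    using \<open>\<And>i. g i \<in> carrier G\<close> \<open>\<And>i. f i \<in> carrier F\<close> by (auto simp: gH fH)
  \<comment> \<open>Both sides are \<open>p_ji\<close>: on the image of \<open>F\<close> the
    extended character is the inverse of \<open>\<chi>m\<close>, whose value at \<open>f j\<close>
    is the inverse of \<open>\<chi> j (g i)\<close>.\<close>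
  have cross: "\<psi> j (gH i) = \<psi> i (fH j)" for i j
    using \<open>\<And>i. g i \<in> carrier G\<close> \<open>\<And>i. f i \<in> carrier F\<close> \<open>\<And>i j. \<chi>m i (f j) = inverse (\<chi> j (g i))\<close>
    by (simp add: gH fH embG_def embF_def \<psi>_coset ext_char_def one)
  interpret b: bracket_algebra H \<psi> gH fH
  proof
    show "letter_char \<psi> x \<in> hom H kstar" for x
      using \<psi>_hom by (cases x) (auto simp: letter_char_def hom_def kstar_def Pi_iff)
    show "case_sum gH fH x \<in> carrier H" for x
      using gH_mem fH_mem subgroup.subset[OF KG] subgroup.subset[OF KF] by (cases x) auto
  qed (rule cross)
  have A_alg: "A = b.alg (carrier H) UNIV" by (simp add: A b.A_eq_alg)
  have GX_alg: "GX = b.alg ?KG ?L" and FX_alg: "FX = b.alg ?KF ?R"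
    using b.subalg_eq_alg[OF KG order_refl, of ?L] b.subalg_eq_alg[OF KF order_refl, of ?R]
    by (auto simp: GX FX A image_image)
  have kG_alg: "kG = b.alg ?KG {}" and kF_alg: "kF = b.alg ?KF {}" and kH_alg: "kH = b.alg (carrier H) {}"
    using b.subalg_eq_alg[OF KG order_refl, of "{}"] b.subalg_eq_alg[OF KF order_refl, of "{}"]
      b.subalg_eq_alg[OF H.subgroup_self order_refl, of "{}"]
    by (auto simp: kG kF kH A)
  \<comment> \<open>The free algebras are the case with no group generators and trivial group
    part.\<close>
  have kX_alg: "kX = b.alg {\<one>\<^bsub>H\<^esub>} ?L" and kXm_alg: "kXm = b.alg {\<one>\<^bsub>H\<^esub>} ?R"
    using b.subalg_eq_alg[OF H.triv_subgroup, of "{}" ?L] b.subalg_eq_alg[OF H.triv_subgroup, of "{}" ?R]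
    by (auto simp: kX kXm A image_image)
  have u: "x \<in> b.sub {\<one>\<^bsub>H\<^esub>} ?L \<and> const_homogeneous x" if "x \<in> u ` S" for x
    using that \<open>\<And>s. s \<in> S \<Longrightarrow> u s \<in> carrier kX \<and> const_homogeneous (u s)\<close> by (auto simp: kX_alg)
  have um: "x \<in> b.sub {\<one>\<^bsub>H\<^esub>} ?R \<and> const_homogeneous x" if "x \<in> um ` T" for x
    using that \<open>\<And>t. t \<in> T \<Longrightarrow> um t \<in> carrier kXm \<and> const_homogeneous (um t)\<close> by (auto simp: kXm_alg)
  have J: "J = Idl\<^bsub>b.alg ?KG ?L\<^esub> (u ` S)" and Jm: "Jm = Idl\<^bsub>b.alg ?KF ?R\<^esub> (um ` T)"
    using \<open>J = Idl\<^bsub>GX\<^esub> (u ` S)\<close> \<open>Jm = Idl\<^bsub>FX\<^esub> (um ` T)\<close> by (simp_all only: GX_alg FX_alg)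
  have J_hopf: "hopf_ideal H (letter_char \<psi>) (case_sum gH fH) (b.alg ?KG ?L) J"
    "J \<subseteq> Idl\<^bsub>b.alg ?KG ?L\<^esub> {letter H x \<otimes>\<^bsub>b.A\<^esub> letter H x' |x x'. x \<in> ?L \<and> x' \<in> ?L}"
  proof -
    show "hopf_ideal H (letter_char \<psi>) (case_sum gH fH) (b.alg ?KG ?L) J"
      using \<open>hopf_ideal H (letter_char \<psi>) d GX J\<close> by (simp only: GX_alg d)
    have "{letter H x \<otimes>\<^bsub>b.A\<^esub> letter H x' |x x'. x \<in> ?L \<and> x' \<in> ?L} =
        {letter H (Inl i) \<otimes>\<^bsub>A\<^esub> letter H (Inl j) |i j. True}"
      by (auto simp: A)
    then show "J \<subseteq> Idl\<^bsub>b.alg ?KG ?L\<^esub> {letter H x \<otimes>\<^bsub>b.A\<^esub> letter H x' |x x'. x \<in> ?L \<and> x' \<in> ?L}"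
      using \<open>J \<subseteq> Idl\<^bsub>GX\<^esub> {letter H (Inl i) \<otimes>\<^bsub>A\<^esub> letter H (Inl j) |i j. True}\<close> by (simp only: GX_alg)
  qed
  have Jm_hopf: "hopf_ideal H (letter_char \<psi>) (case_sum gH fH) (b.alg ?KF ?R) Jm"
    "Jm \<subseteq> Idl\<^bsub>b.alg ?KF ?R\<^esub> {letter H x \<otimes>\<^bsub>b.A\<^esub> letter H x' |x x'. x \<in> ?R \<and> x' \<in> ?R}"
  proof -
    show "hopf_ideal H (letter_char \<psi>) (case_sum gH fH) (b.alg ?KF ?R) Jm"
      using \<open>hopf_ideal H (letter_char \<psi>) d FX Jm\<close> by (simp only: FX_alg d)
    have "{letter H x \<otimes>\<^bsub>b.A\<^esub> letter H x' |x x'. x \<in> ?R \<and> x' \<in> ?R} =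
        {letter H (Inr i) \<otimes>\<^bsub>A\<^esub> letter H (Inr j) |i j. True}"
      by (auto simp: A)
    then show "Jm \<subseteq> Idl\<^bsub>b.alg ?KF ?R\<^esub> {letter H x \<otimes>\<^bsub>b.A\<^esub> letter H x' |x x'. x \<in> ?R \<and> x' \<in> ?R}"
      using \<open>Jm \<subseteq> Idl\<^bsub>FX\<^esub> {letter H (Inr i) \<otimes>\<^bsub>A\<^esub> letter H (Inr j) |i j. True}\<close> by (simp only: FX_alg)
  qed
  interpret t: triangular H \<psi> gH fH ?KG ?KF J Jm "u ` S" "um ` T"
  proof (intro triangular.intro b.bracket_algebra_axioms triangular_axioms.intro)
    show "subgroup ?KG H" "subgroup ?KF H" by (fact KG KF)+
    show "u ` S \<subseteq> b.sub ?KG ?L"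
      using u b.sub_mono[of "{\<one>\<^bsub>H\<^esub>}" ?KG ?L ?L] subgroup.one_closed[OF KG] by auto
    show "um ` T \<subseteq> b.sub ?KF ?R"
      using um b.sub_mono[of "{\<one>\<^bsub>H\<^esub>}" ?KF ?R ?R] subgroup.one_closed[OF KF] by auto
    show "J = Idl\<^bsub>b.alg ?KG ?L\<^esub> (u ` S)" "Jm = Idl\<^bsub>b.alg ?KF ?R\<^esub> (um ` T)" by (fact J Jm)+
    show "b.diag \<kappa> c v \<in> J" if "\<kappa> \<in> hom H kstar" "v \<in> J" for \<kappa> c v
      by (rule b.diag_ideal[OF KG J u that])
    show "b.diag \<kappa> c v \<in> Jm" if "\<kappa> \<in> hom H kstar" "v \<in> Jm" for \<kappa> c v
      by (rule b.diag_ideal[OF KF Jm um that])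
    \<comment> \<open>The group-like of \<open>x_i\<close> is \<open>g_i\<close>, which lies in the
      image of \<open>G\<close>; this is the side condition for the right derivation.\<close>
    show "b.dL (Inl i) v \<in> J" "b.dR (Inl i) v \<in> J" if "v \<in> J" for v i
      using b.hopf_ideal_derivation[OF KG J_hopf that, of "Inl i"] gH_mem by simp_all
    show "b.dL (Inr i) v \<in> Jm" "b.dR (Inr i) v \<in> Jm" if "v \<in> Jm" for v i
      using b.hopf_ideal_derivation[OF KF Jm_hopf that, of "Inr i"] fH_mem by simp_all
  qed
  have "I = t.Itri" by (simp add: I t.Itri_def A)
  then show ?thesis
    using t.triangular_decomposition
    unfolding t.cF_def[abs_def] t.cG_def[abs_def] A_alg GX_alg FX_alg kG_alg kF_alg kH_alg b.alg_simps b.A_eq_alg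
    by simp
qed

end
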